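(* Let $X_1$ be a random vector in $\mathbb R^d$ such that $0\in\operatorname{int}\mathcal D_{\mathcal L}$. Then the functional $I_D$ on $BV[0,1]$ is tight with respect to $\rho_*$ (its sub-level sets $\{h\in BV[0,1]:I_D(h)\le\alpha\}$ are compact in $(BV[0,1],\rho_* )$). Moreover, $$I_D(h)=\int_0^1 I(h'(t))dt+\int_{\mathbb S^{d-1}}I_\infty(\ell)\,\sigma^{h_s}(d\ell),\qquad h\in BV[0,1],$$ which in dimension $d=1$ reads $$I_D(h)=\int_0^1 I(h'(t))dt+h_s^+(1)I_\infty(1)+h_s^-(1)I_\infty(-1).$$
   Context: $\mathcal L(u):=\mathbb Ee^{u\cdot X_1}$, $\mathcal D_{\mathcal L}:=\{u:\mathcal L(u)<\infty\}$, $K:=\log\mathcal L$, $I(v):=\sup_{u\in\mathbb R^d}(u\cdot v-K(u))$, and $I_\infty(v):=\sup\{u\cdot v:u\in\mathcal D_{\mathcal L}\}$. $D[0,1]$: càdlàg functions $[0,1]\to\mathbb R^d$. For $h\in D[0,1]$ and finite $\mathbf t\subset(0,1]$, $h^{\mathbf t}$ is the continuous function linear between consecutive points of $\mathbf t\cup\{0,1\}$ with $h^{\mathbf t}(0)=0$, $h^{\mathbf t}(s)=h(s)$ for $s\in\mathbf t\cup\{1\}$. $\operatorname{Var}(h):=\sup_{\mathbf t}\int_0^1|(h^{\mathbf t})'|ds$, $I_D(h):=\sup_{\mathbf t}\int_0^1I((h^{\mathbf t})'(s))ds$ (suprema over finite $\mathbf t\subset(0,1]$), $BV[0,1]:=\{\operatorname{Var}<\infty\}$.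 $\rho_*(g,h):=\int_0^1|g-h|ds+|g(1)-h(1)|$. For $h\in BV[0,1]$: $dh$ is the $\mathbb R^d$-valued Borel measure on $[0,1]$ with $dh([0,x])=h(x)$; $h'$ is the a.e. derivative (integrable), $h_a(t):=\int_0^th'(s)ds$, $h_s:=h-h_a$ (so $dh_s$ is singular). $V^h(t):=\operatorname{Var}(h(\cdot\wedge t))$; $dV^h$ is the total variation measure of $dh$, and $\dot h$ is the Radon–Nikodym density with $dh=\dot h\,dV^h$, $|\dot h|=1$ $dV^h$-a.e. $\sigma^h$ is the push-forward of $dV^h$ under $\dot h$, a measure on the unit sphere $\mathbb S^{d-1}$. For $d=1$, $dh_s=dh_s^+-dh_s^-$ is the Jordan decomposition into mutually singular non-negative measures and $h_s^\pm(t):=dh_s^\pm([0,t])$. *)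

theory Defs
  imports "HOL-Probability.Probability"
begin

definition Lfun :: "'w measure \<Rightarrow> ('w \<Rightarrow> 'a::euclidean_space) \<Rightarrow> 'a \<Rightarrow> ennreal" where
  "Lfun M X u = (\<integral>\<^sup>+ \<omega>. ennreal (exp (u \<bullet> X \<omega>)) \<partial>M)"

definition DL :: "'w measure \<Rightarrow> ('w \<Rightarrow> 'a::euclidean_space) \<Rightarrow> 'a set" where
  "DL M X = {u. Lfun M X u < \<infinity>}"

definition Kfun :: "'w measure \<Rightarrow> ('w \<Rightarrow> 'a::euclidean_space) \<Rightarrow> 'a \<Rightarrow> ereal" where
  "Kfun M X u = (if Lfun M X u < \<infinity> then ereal (ln (enn2real (Lfun M X u))) else \<infinity>)"

definition Irate :: "'w measure \<Rightarrow> ('w \<Rightarrow> 'a::euclidean_space) \<Rightarrow> 'a \<Rightarrow> ereal" where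
  "Irate M X v = (SUP u\<in>UNIV. ereal (u \<bullet> v) - Kfun M X u)"

definition Iinf :: "'w measure \<Rightarrow> ('w \<Rightarrow> 'a::euclidean_space) \<Rightarrow> 'a \<Rightarrow> ereal" where
  "Iinf M X v = (SUP u\<in>DL M X. ereal (u \<bullet> v))"

text \<open>Functions on [0,1] are represented as functions on the reals that vanish outside [0,1].\<close>
definition cadlag :: "(real \<Rightarrow> 'a::euclidean_space) \<Rightarrow> bool" where
  "cadlag h \<longleftrightarrow> (\<forall>t\<in>{0..<1}. continuous (at_right t) h) \<and>
                (\<forall>t\<in>{0<..1}. \<exists>l. (h \<longlongrightarrow> l) (at_left t))"

definition D01 :: "(real \<Rightarrow> 'a::euclidean_space) set" where
  "D01 = {h. cadlag h \<and> (\<forall>t. t \<notin> {0..1} \<longrightarrow> h t = 0)}"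

definition partitions :: "real set set" where
  "partitions = {T. finite T \<and> T \<subseteq> {0<..1}}"

definition polygon :: "(real \<Rightarrow> 'a::euclidean_space) \<Rightarrow> real set \<Rightarrow> real \<Rightarrow> 'a" where
  "polygon h T s =
    (let P = insert 0 (insert 1 T);
         val = (\<lambda>p. if p = 0 then 0 else h p);
         lo = Max {p\<in>P. p \<le> s};
         hi = Min {p\<in>P. s \<le> p}
     in if s \<le> 0 then 0 else if 1 \<le> s then h 1
        else if lo = hi then val lo
        else val lo + ((s - lo) / (hi - lo)) *\<^sub>R (val hi - val lo))"

definition Var :: "(real \<Rightarrow> 'a::euclidean_space) \<Rightarrow> ennreal" where
  "Var h = (SUP T\<in>partitions.
      \<integral>\<^sup>+ s\<in>{0..1}. ennreal (norm (vector_derivative (polygon h T) (at s))) \<partial>lborel)"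

definition BV01 :: "(real \<Rightarrow> 'a::euclidean_space) set" where
  "BV01 = {h\<in>D01. Var h < \<infinity>}"

definition ID :: "'w measure \<Rightarrow> ('w \<Rightarrow> 'a::euclidean_space) \<Rightarrow> (real \<Rightarrow> 'a) \<Rightarrow> ennreal" where
  "ID M X h = (SUP T\<in>partitions.
      \<integral>\<^sup>+ s\<in>{0..1}. e2ennreal (Irate M X (vector_derivative (polygon h T) (at s))) \<partial>lborel)"

definition rho_star :: "(real \<Rightarrow> 'a::euclidean_space) \<Rightarrow> (real \<Rightarrow> 'a) \<Rightarrow> real" where
  "rho_star g h = (LINT s:{0..1}|lborel. norm (g s - h s)) + norm (g 1 - h 1)"

definition dern :: "(real \<Rightarrow> 'a::euclidean_space) \<Rightarrow> real \<Rightarrow> 'a" where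
  "dern h t = vector_derivative h (at t)"

definition hac :: "(real \<Rightarrow> 'a::euclidean_space) \<Rightarrow> real \<Rightarrow> 'a" where
  "hac h t = (if t \<in> {0..1} then (LINT s:{0..t}|lborel. dern h s) else 0)"

definition hsing :: "(real \<Rightarrow> 'a::euclidean_space) \<Rightarrow> real \<Rightarrow> 'a" where
  "hsing h t = h t - hac h t"

text \<open>V^h(t) = Var(h(. min t)); dV^h is the Lebesgue-Stieltjes measure with dV^h([0,x]) = V^h(x).\<close>
definition Vfun :: "(real \<Rightarrow> 'a::euclidean_space) \<Rightarrow> real \<Rightarrow> real" where
  "Vfun h t = enn2real (Var (\<lambda>s. h (min s t)))"

definition dV :: "(real \<Rightarrow> 'a::euclidean_space) \<Rightarrow> real measure" where
  "dV h = interval_measure (\<lambda>x. if x < 0 then 0 else Vfun h (min x 1))"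

text \<open>The density hdot with dh = hdot dV^h, where dh is characterised by dh([0,x]) = h(x)
  (intervals [0,x] generate the Borel sets of [0,1]); |hdot| = 1 dV^h-a.e.\<close>
definition hdot :: "(real \<Rightarrow> 'a::euclidean_space) \<Rightarrow> real \<Rightarrow> 'a" where
  "hdot h = (SOME g. g \<in> borel_measurable borel \<and> (AE x in dV h. norm (g x) = 1) \<and>
     (\<forall>x\<in>{0..1}. set_integrable (dV h) {0..x} g \<and> (LINT s:{0..x}|dV h. g s) = h x))"

definition sigma_meas :: "(real \<Rightarrow> 'a::euclidean_space) \<Rightarrow> 'a measure" where
  "sigma_meas h = distr (dV h) borel (hdot h)"

end

theory Submission
  imports Defs
begin

text \<open>
  Write \<open>I\<close> as a supremum of affine functions \<open>u \<bullet> v - k\<close> over the graph of \<open>K\<close>. Then \<open>I\<^sub>D(h)\<close> is the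
  supremum of \<open>\<Sum> u\<^sub>i \<bullet> \<Delta>h\<^sub>i - k\<^sub>i \<Delta>t\<^sub>i\<close> over all partitions and all choices of \<open>(u\<^sub>i, k\<^sub>i)\<close>; the total
  variation is the special case of the pairs \<open>(u, 0)\<close> with \<open>|u| \<le> 1\<close>.

  Upper bound: each increment \<open>u \<bullet> \<Delta>h - k \<Delta>t\<close> is the integral of \<open>u \<bullet> h' - k\<close> plus that of
  \<open>u \<bullet> g\<close> against the singular part, hence at most the integral of \<open>I(h')\<close> plus that of \<open>I\<^sub>\<infinity>(g)\<close>;
  neither Jensen's inequality nor approximation is needed.

  Lower bound: the rate accumulated up to time \<open>x\<close> is the least function whose increments dominate
  all \<open>u \<bullet> \<Delta>h - k \<Delta>t\<close>, and minimality makes it right-continuous. Its Stieltjes measure dominates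
  \<open>u \<bullet> dh - k dt\<close> on every Borel set for every \<open>(u, k)\<close>. Splitting the line according to which of finitely
  many pairs is best, and passing to a countable dense set of pairs, gives the formula.

  Compactness: \<open>K\<close> is bounded near \<open>0\<close>, so the variation is bounded on sub-level sets; Helly's theorem
  yields pointwise limits off a countable set, and partition sums are continuous under such limits.
\<close>

section \<open>Polygons and chains of affine minorants\<close>

text \<open>The rate may be infinite, so the proof works with real sums of affine minorants and with
  real bounds on them. The pair \<open>(0, 0)\<close>, which expresses \<open>K 0 = 0\<close>,
  belongs to both sets of pairs in play; a negative term can be traded for 0, which makes truncation
  in \<open>ennreal\<close> harmless. The recurring device is a verification principle: a function
  that is nonnegative before time 0 and whose increments dominate all affine terms bounds every sum.
  Suitable competitors yield right-continuity, the property |hdot| = 1, the singularity of the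
  variation of the singular part, and the upper bound. Its counterpart is that an increasing
  right-continuous function has a nonnegative Stieltjes measure, so inequalities between increments
  extend to all Borel sets. On a Lebesgue null set the term \<open>k dt\<close> vanishes and only
  \<open>u \<bullet> dh\<close> survives; this is how the recession function arises. The derivative
  in the formula is pointwise, with an unspecified value where none exists, so almost everywhere
  differentiation and measurability have to be established for it.\<close>

definition sup_rate :: "('a::real_inner \<times> real) set \<Rightarrow> 'a \<Rightarrow> ennreal" where
  "sup_rate S v = (SUP p\<in>S. ennreal (fst p \<bullet> v - snd p))"

definition recession_rate :: "('a::real_inner \<times> real) set \<Rightarrow> 'a \<Rightarrow> ennreal" where
  "recession_rate S v = (SUP p\<in>S. ennreal (fst p \<bullet> v))"

definition clamp01 :: "real \<Rightarrow> real" where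
  "clamp01 x = max 0 (min x 1)"

definition extend01 :: "(real \<Rightarrow> 'a::real_normed_vector) \<Rightarrow> real \<Rightarrow> 'a" where
  "extend01 h x = (if x < 0 then 0 else h (min x 1))"

text \<open>
  \<open>reach Q S H x c\<close>: some partition with points in \<open>Q\<close> ending in \<open>x\<close>, and some choice of a pair of \<open>S\<close>
  on each of its intervals, has the sum \<open>c\<close>. Starting at negative times, where \<open>H\<close> vanishes and
  \<open>clamp01\<close> is constant, makes the jump \<open>h 0\<close> an ordinary increment.
\<close>

inductive reach :: "real set \<Rightarrow> ('a::real_inner \<times> real) set \<Rightarrow> (real \<Rightarrow> 'a) \<Rightarrow> real \<Rightarrow> real \<Rightarrow> bool"
  for Q S H where
  start: "x < 0 \<Longrightarrow> reach Q S H x 0"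
| step: "reach Q S H a c \<Longrightarrow> a < b \<Longrightarrow> b \<in> Q \<Longrightarrow> (u, k) \<in> S \<Longrightarrow>
    reach Q S H b (c + (u \<bullet> (H b - H a) - k * (clamp01 b - clamp01 a)))"

section \<open>Integrals along polygons as sums over consecutive knots\<close>

definition cons_pairs :: "real set \<Rightarrow> (real \<times> real) set" where
  "cons_pairs P = {(a, b). a \<in> P \<and> b \<in> P \<and> a < b \<and> P \<inter> {a<..<b} = {}}"

lemma cons_pairs_insert:
  assumes "finite P" "P \<noteq> {}" "\<And>p. p \<in> P \<Longrightarrow> p < b"
  shows "cons_pairs (insert b P) = insert (Max P, b) (cons_pairs P)"
proof -
  have M: "Max P \<in> P" "\<And>p. p \<in> P \<Longrightarrow> p \<le> Max P"
    using assms by auto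
  have "(x, y) \<in> cons_pairs (insert b P) \<longleftrightarrow> (x, y) \<in> insert (Max P, b) (cons_pairs P)" for x y
  proof
    assume *: "(x, y) \<in> cons_pairs (insert b P)"
    then have 1: "x \<in> insert b P" "y \<in> insert b P" "x < y" "insert b P \<inter> {x<..<y} = {}"
      by (auto simp: cons_pairs_def)
    from 1 assms have xP: "x \<in> P" by force
    show "(x, y) \<in> insert (Max P, b) (cons_pairs P)"
    proof (cases "y = b")
      case True
      have "x = Max P"
      proof (rule ccontr)
        assume "x \<noteq> Max P"
        with M xP have "x < Max P" by force
        with 1 M True assms(3)[OF M(1)] show False by auto
      qed
      with True show ?thesis by auto
    next
      case False
      with 1 xP show ?thesis by (auto simp: cons_pairs_def)
    qed
  next
    assume "(x, y) \<in> insert (Max P, b) (cons_pairs P)"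
    then show "(x, y) \<in> cons_pairs (insert b P)"
    proof
      assume "(x, y) = (Max P, b)"
      then have xy: "x = Max P" "y = b" by auto
      have "insert b P \<inter> {Max P<..<b} = {}" using M(2) by fastforce
      then show ?thesis using xy M(1) assms(3) by (simp add: cons_pairs_def)
    next
      assume "(x, y) \<in> cons_pairs P"
      with assms show ?thesis by (fastforce simp: cons_pairs_def)
    qed
  qed
  then show ?thesis by auto
qed

lemma finite_cons_pairs: "finite P \<Longrightarrow> finite (cons_pairs P)"
  by (rule finite_subset[of _ "P \<times> P"]) (auto simp: cons_pairs_def)

lemma cons_pairs_unique:
  assumes "(a, b) \<in> cons_pairs P" "(a', b') \<in> cons_pairs P" "s \<in> {a<..<b}" "s \<in> {a'<..<b'}"
  shows "a = a' \<and> b = b'"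
proof -
  have "\<not> a < a'" "\<not> a' < a" "\<not> b < b'" "\<not> b' < b"
    using assms by (auto simp: cons_pairs_def disjoint_iff)
  then show ?thesis by auto
qed

lemma cons_pairs_cover:
  assumes "finite P" "0 \<in> P" "1 \<in> P" "s \<in> {0..1} - P"
  obtains a b where "(a, b) \<in> cons_pairs P" "s \<in> {a<..<b}"
proof
  let ?a = "Max {p\<in>P. p \<le> s}" and ?b = "Min {p\<in>P. s \<le> p}"
  have fin: "finite {p\<in>P. p \<le> s}" "finite {p\<in>P. s \<le> p}" using assms by auto
  have ne: "{p\<in>P. p \<le> s} \<noteq> {}" "{p\<in>P. s \<le> p} \<noteq> {}" using assms by auto
  have a: "?a \<in> P" "?a \<le> s" "\<And>p. p \<in> P \<Longrightarrow> p \<le> s \<Longrightarrow> p \<le> ?a"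
    using Max_in[OF fin(1) ne(1)] fin by auto
  have b: "?b \<in> P" "s \<le> ?b" "\<And>p. p \<in> P \<Longrightarrow> s \<le> p \<Longrightarrow> ?b \<le> p"
    using Min_in[OF fin(2) ne(2)] fin by auto
  have "s \<noteq> ?a" "s \<noteq> ?b" using a b assms by auto
  then have lt: "?a < s" "s < ?b" using a b by auto
  then show "s \<in> {?a<..<?b}" by auto
  have "P \<inter> {?a<..<?b} = {}"
  proof (safe)
    fix p assume p: "p \<in> P" "p \<in> {?a<..<?b}"
    then show "p \<in> {}" using a(3)[OF p(1)] b(3)[OF p(1)] by (cases "p \<le> s") auto
  qed
  then show "(?a, ?b) \<in> cons_pairs P" using a b lt by (auto simp: cons_pairs_def)
qed

text \<open>The polygon starts at 0 whatever the value \<open>h 0\<close>, so a jump of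
  \<open>h\<close> at time 0 is spread over the first interval.\<close>

definition knot :: "(real \<Rightarrow> 'a::zero) \<Rightarrow> real \<Rightarrow> 'a" where
  "knot h p = (if p = 0 then 0 else h p)"

lemma polygon_eq:
  fixes h :: "real \<Rightarrow> 'a::euclidean_space"
  assumes T: "T \<in> partitions" and ab: "(a, b) \<in> cons_pairs (insert 0 (insert 1 T))" and s: "s \<in> {a<..<b}"
  shows "polygon h T s = knot h a + ((s - a) / (b - a)) *\<^sub>R (knot h b - knot h a)"
proof -
  let ?P = "insert 0 (insert 1 T)"
  have fin: "finite ?P" and sub: "?P \<subseteq> {0..1}"
    using T by (auto simp: partitions_def)
  have 1: "a \<in> ?P" "b \<in> ?P" "?P \<inter> {a<..<b} = {}"
    using ab by (auto simp: cons_pairs_def)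
  have lo: "Max {p\<in>?P. p \<le> s} = a"
  proof (rule Max_eqI)
    fix y assume "y \<in> {p\<in>?P. p \<le> s}"
    then have y: "y \<in> ?P" "y \<le> s" by auto
    from y(1) have "y \<notin> {a<..<b}" using 1(3) by blast
    then show "y \<le> a" using y(2) s by auto
  qed (use fin 1 s in auto)
  have hi: "Min {p\<in>?P. s \<le> p} = b"
  proof (rule Min_eqI)
    fix y assume "y \<in> {p\<in>?P. s \<le> p}"
    then have y: "y \<in> ?P" "s \<le> y" by auto
    from y(1) have "y \<notin> {a<..<b}" using 1(3) by blast
    then show "b \<le> y" using y(2) s by auto
  qed (use fin 1 s in auto)
  have "a \<in> {0..1}" "b \<in> {0..1}" using 1(1,2) sub by blast+
  then have "\<not> s \<le> 0" "\<not> 1 \<le> s" "a \<noteq> b" using s by auto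
  then show ?thesis
    unfolding polygon_def Let_def lo hi knot_def by simp
qed

lemma vector_derivative_polygon:
  fixes h :: "real \<Rightarrow> 'a::euclidean_space"
  assumes T: "T \<in> partitions" and ab: "(a, b) \<in> cons_pairs (insert 0 (insert 1 T))" and s: "s \<in> {a<..<b}"
  shows "vector_derivative (polygon h T) (at s) = (1 / (b - a)) *\<^sub>R (knot h b - knot h a)"
proof (rule vector_derivative_at)
  have "((\<lambda>s. knot h a + ((s - a) / (b - a)) *\<^sub>R (knot h b - knot h a)) has_vector_derivative
     (1 / (b - a)) *\<^sub>R (knot h b - knot h a)) (at s)"
    using s by (auto intro!: derivative_eq_intros simp: has_vector_derivative_def divide_simps)
  then show "(polygon h T has_vector_derivative (1 / (b - a)) *\<^sub>R (knot h b - knot h a)) (at s)"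
    by (rule has_vector_derivative_transform_within_open[of _ _ _ "{a<..<b}"])
       (use s polygon_eq[OF T ab, where h=h] in auto)
qed

definition pair_sum :: "('a::real_vector \<Rightarrow> ennreal) \<Rightarrow> (real \<Rightarrow> 'a) \<Rightarrow> real set \<Rightarrow> ennreal" where
  "pair_sum f h P = (\<Sum>(a, b)\<in>cons_pairs P. ennreal (b - a) * f ((1 / (b - a)) *\<^sub>R (knot h b - knot h a)))"

text \<open>The derivative is constant between consecutive knots. The knots form a null set, so the
  value returned by \<open>vector_derivative\<close> there does not matter.\<close>

lemma nn_integral_polygon:
  fixes h :: "real \<Rightarrow> 'a::euclidean_space"
  assumes T: "T \<in> partitions"
  shows "(\<integral>\<^sup>+ s\<in>{0..1}. f (vector_derivative (polygon h T) (at s)) \<partial>lborel) = pair_sum f h (insert 0 (insert 1 T))"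
proof -
  let ?P = "insert 0 (insert 1 T)"
  let ?g = "\<lambda>a b. f ((1 / (b - a)) *\<^sub>R (knot h b - knot h a))"
  have fin: "finite ?P" and sub: "?P \<subseteq> {0..1}" using T by (auto simp: partitions_def)
  have fc: "finite (cons_pairs ?P)" by (rule finite_cons_pairs[OF fin])
  have "AE s in lborel. s \<notin> ?P"
    by (rule AE_not_in) (rule finite_imp_null_set_lborel[OF fin])
  then have "AE s in lborel. f (vector_derivative (polygon h T) (at s)) * indicator {0..1} s
      = (\<Sum>(a, b)\<in>cons_pairs ?P. ?g a b * indicator {a<..<b} s)"
  proof eventually_elim
    fix s assume sP: "s \<notin> ?P"
    show "f (vector_derivative (polygon h T) (at s)) * indicator {0..1} s
      = (\<Sum>(a, b)\<in>cons_pairs ?P. ?g a b * indicator {a<..<b} s)"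
    proof (cases "s \<in> {0..1}")
      case True
      with sP fin obtain a b where ab: "(a, b) \<in> cons_pairs ?P" "s \<in> {a<..<b}"
        using cons_pairs_cover[of ?P s] by blast
      have "(\<Sum>(a, b)\<in>cons_pairs ?P. ?g a b * indicator {a<..<b} s)
          = (\<Sum>q\<in>{(a, b)}. case q of (a, b) \<Rightarrow> ?g a b * indicator {a<..<b} s)"
      proof (rule sum.mono_neutral_right[OF fc])
        show "{(a, b)} \<subseteq> cons_pairs ?P" using ab by auto
        show "\<forall>i\<in>cons_pairs ?P - {(a, b)}. (case i of (a, b) \<Rightarrow> ?g a b * indicator {a<..<b} s) = 0"
          using cons_pairs_unique[OF ab(1) _ ab(2)] by (auto simp: indicator_def)
      qed
      then show ?thesis using True ab(2) vector_derivative_polygon[OF T ab, where h=h] by simp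
    next
      case False
      have "(\<Sum>(a, b)\<in>cons_pairs ?P. ?g a b * indicator {a<..<b} s) = 0"
      proof (rule sum.neutral, clarify)
        fix a b assume "(a, b) \<in> cons_pairs ?P"
        then have "a \<in> ?P" "b \<in> ?P" by (auto simp: cons_pairs_def)
        then have "a \<in> {0..1}" "b \<in> {0..1}" using sub by blast+
        then show "?g a b * indicator {a<..<b} s = 0" using False by (auto simp: indicator_def)
      qed
      then show ?thesis using False by simp
    qed
  qed
  then have "(\<integral>\<^sup>+ s\<in>{0..1}. f (vector_derivative (polygon h T) (at s)) \<partial>lborel)
     = (\<integral>\<^sup>+ s. (\<Sum>(a, b)\<in>cons_pairs ?P. ?g a b * indicator {a<..<b} s) \<partial>lborel)"
    by (rule nn_integral_cong_AE)
  also have "\<dots> = (\<Sum>q\<in>cons_pairs ?P. \<integral>\<^sup>+ s. (case q of (a, b) \<Rightarrow> ?g a b * indicator {a<..<b} s) \<partial>lborel)"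
    by (subst nn_integral_sum) (auto simp: split_beta)
  also have "\<dots> = pair_sum f h ?P"
    unfolding pair_sum_def
  proof (intro sum.cong refl, clarify)
    fix a b assume "(a, b) \<in> cons_pairs ?P"
    then have "a < b" unfolding cons_pairs_def by blast
    then show "(\<integral>\<^sup>+ s. ?g a b * indicator {a<..<b} s \<partial>lborel) = ennreal (b - a) * ?g a b"
      by (subst nn_integral_cmult_indicator) (auto simp: mult.commute)
  qed
  finally show ?thesis .
qed

text \<open>Multiplying by the length of the interval turns a slope into an increment. Being
  positive, the factor may be moved inside the truncation at 0.\<close>

lemma sup_rate_scale:
  assumes "0 < d"
  shows "ennreal d * sup_rate S ((1 / d) *\<^sub>R w) = (SUP p\<in>S. ennreal (fst p \<bullet> w - snd p * d))"
  unfolding sup_rate_def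
proof (subst SUP_mult_left_ennreal, intro SUP_cong refl)
  fix p assume "p \<in> S"
  have "ennreal d * ennreal (fst p \<bullet> ((1 / d) *\<^sub>R w) - snd p) = ennreal (d * (fst p \<bullet> ((1 / d) *\<^sub>R w) - snd p))"
    using assms by (subst ennreal_mult') auto
  also have "d * (fst p \<bullet> ((1 / d) *\<^sub>R w) - snd p) = fst p \<bullet> w - snd p * d"
    using assms by (simp add: field_simps)
  finally show "ennreal d * ennreal (fst p \<bullet> ((1 / d) *\<^sub>R w) - snd p) = ennreal (fst p \<bullet> w - snd p * d)" .
qed

section \<open>Partition sums and sums along chains\<close>

lemma reach_zero:
  assumes "(0, 0) \<in> S" "x < 0 \<or> x \<in> Q"
  shows "reach Q S H x 0"
proof (cases "x < 0")
  case False
  then have "reach Q S H x (0 + (0 \<bullet> (H x - H (-1)) - 0 * (clamp01 x - clamp01 (-1))))"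
    using assms by (intro reach.intros) auto
  then show ?thesis by simp
qed (auto intro: reach.start)

lemma ennreal_add_le: "ennreal (x + y) \<le> ennreal x + ennreal y"
  by (smt (verit, best) add_0 add.right_neutral ennreal_leI ennreal_neg ennreal_plus)

text \<open>Stand-in for the knot 0: at time -1 both \<open>extend01 h\<close> and
  \<open>clamp01\<close> vanish, so the first increment starts from the value 0 and contains the
  jump of \<open>h\<close> at 0.\<close>

definition shift_zero :: "real \<Rightarrow> real" where
  "shift_zero a = (if a = 0 then -1 else a)"

lemma extend01_shift_zero: "a \<in> {0..1} \<Longrightarrow> extend01 h (shift_zero a) = knot h a"
  by (auto simp: extend01_def shift_zero_def knot_def min_def)

lemma clamp01_shift_zero: "a \<in> {0..1} \<Longrightarrow> clamp01 (shift_zero a) = a"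
  by (auto simp: clamp01_def shift_zero_def)

text \<open>Splitting off the last interval matches the rule \<open>step\<close> of
  \<open>reach\<close>; the comparisons between the two kinds of sums are inductions along
  it.\<close>

lemma pair_sum_insert:
  assumes "finite P" "P \<noteq> {}" "\<And>p. p \<in> P \<Longrightarrow> p < b"
  shows "pair_sum f h (insert b P) = pair_sum f h P
     + ennreal (b - Max P) * f ((1 / (b - Max P)) *\<^sub>R (knot h b - knot h (Max P)))"
proof -
  have "(Max P, b) \<notin> cons_pairs P"
    using assms(3) by (auto simp: cons_pairs_def)
  moreover have "cons_pairs (insert b P) = insert (Max P, b) (cons_pairs P)"
    by (rule cons_pairs_insert) (use assms in auto)
  ultimately show ?thesis
    unfolding pair_sum_def using finite_cons_pairs[OF assms(1)] by (simp add: add.commute)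
qed

text \<open>Pairs on different intervals are chosen independently, so the supremum over earlier
  chains and the supremum over the last pair add up to one over longer chains.\<close>

lemma pair_sum_le_reach:
  fixes h :: "real \<Rightarrow> 'a::euclidean_space"
  assumes S: "(0, 0) \<in> S" and "finite T" "T \<subseteq> {0<..1}"
  shows "pair_sum (sup_rate S) h (insert 0 T)
      \<le> (SUP c\<in>{c. reach {0<..1} S (extend01 h) (shift_zero (Max (insert 0 T))) c}. ennreal c)"
  using assms(2,3)
proof (induction T rule: finite_linorder_max_induct)
  case empty
  have "cons_pairs {0} = {}" by (auto simp: cons_pairs_def)
  then show ?case by (simp add: pair_sum_def)
next
  case (insert b A)
  let ?H = "extend01 h"
  let ?a = "Max (insert 0 A)"
  let ?R = "\<lambda>x c. reach {0<..1} S ?H x c"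
  have b: "0 < b" "b \<le> 1" using insert.prems by auto
  have lt: "p < b" if "p \<in> insert 0 A" for p using that insert b by auto
  have fin: "finite (insert 0 A)" using insert by auto
  have aA: "?a \<in> insert 0 A" using fin by (intro Max_in) auto
  have a: "?a \<in> {0..1}" "?a < b" using aA insert.prems lt[OF aA] by auto
  have Mb: "Max (insert 0 (insert b A)) = b"
    using lt fin by (intro Max_eqI) (auto intro: less_imp_le)
  have sb: "shift_zero b = b" using b by (simp add: shift_zero_def)
  have sa: "shift_zero ?a < b" "shift_zero ?a < 0 \<or> shift_zero ?a \<in> {0<..1}"
    using a b by (auto simp: shift_zero_def split: if_splits)
  have "pair_sum (sup_rate S) h (insert 0 (insert b A)) = pair_sum (sup_rate S) h (insert b (insert 0 A))"
    by (simp add: insert_commute)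
  also have "\<dots> = pair_sum (sup_rate S) h (insert 0 A)
     + ennreal (b - ?a) * sup_rate S ((1 / (b - ?a)) *\<^sub>R (knot h b - knot h ?a))"
    by (rule pair_sum_insert) (use fin lt in auto)
  also have "\<dots> \<le> (SUP c\<in>{c. ?R (shift_zero ?a) c}. ennreal c)
     + (SUP p\<in>S. ennreal (fst p \<bullet> (knot h b - knot h ?a) - snd p * (b - ?a)))"
    using a insert.IH insert.prems by (intro add_mono) (auto simp: sup_rate_scale)
  also have "\<dots> \<le> (SUP c\<in>{c. ?R b c}. ennreal c)"
  proof -
    have ne: "{c. ?R (shift_zero ?a) c} \<noteq> {}" using reach_zero[OF S sa(2)] by auto
    have "ennreal c + ennreal (fst p \<bullet> (knot h b - knot h ?a) - snd p * (b - ?a)) \<le> (SUP c\<in>{c. ?R b c}. ennreal c)"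
      if c: "?R (shift_zero ?a) c" and p: "p \<in> S" for c p
    proof -
      \<comment> \<open>\<open>ennreal\<close> cuts negative numbers off at 0; the sum 0 is itself
        reachable, so it can replace a negative \<open>c\<close>.\<close>
      define c' where "c' = max c 0"
      have c': "?R (shift_zero ?a) c'" "ennreal c = ennreal c'" "0 \<le> c'"
        using c reach_zero[OF S sa(2)] by (auto simp: c'_def max_def ennreal_neg)
      define y where "y = fst p \<bullet> (knot h b - knot h ?a) - snd p * (b - ?a)"
      define y' where "y' = max y 0"
      have y: "y = fst p \<bullet> (?H b - ?H (shift_zero ?a)) - snd p * (clamp01 b - clamp01 (shift_zero ?a))"
        using extend01_shift_zero[OF a(1), of h] extend01_shift_zero[of b h] clamp01_shift_zero[OF a(1)] b
        by (simp add: y_def sb clamp01_def)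
      \<comment> \<open>If the last term is not positive, the pair \<open>(0, 0)\<close> realises
        its truncation.\<close>
      have "?R b (c' + y')"
      proof (cases "y > 0")
        case True
        have "(fst p, snd p) \<in> S" using p by simp
        from reach.step[OF c'(1) sa(1) _ this] show ?thesis
          using True b by (simp add: y'_def y)
      next
        case False
        from reach.step[OF c'(1) sa(1) _ S] show ?thesis using False b by (simp add: y'_def)
      qed
      moreover have "ennreal c + ennreal y = ennreal (c' + y')"
        using c' by (auto simp: y'_def max_def ennreal_neg)
      ultimately show ?thesis
        unfolding y_def[symmetric] by (auto intro!: SUP_upper)
    qed
    moreover have "S \<noteq> {}" using S by auto
    ultimately show ?thesis
      using ne by (simp add: ennreal_SUP_add_left[symmetric] ennreal_SUP_add_right SUP_le_iff)
  qed
  finally show ?case by (simp only: Mb sb)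
qed

lemma reach_dom: "reach Q S H x c \<Longrightarrow> x < 0 \<and> c = 0 \<or> x \<in> Q"
  by (induction rule: reach.induct) auto

text \<open>The positive points visited by the chain form the partition, and each affine term is at
  most the supremum over all pairs on its interval.\<close>

lemma reach_le_pair_sum:
  fixes h :: "real \<Rightarrow> 'a::euclidean_space"
  assumes "reach {0<..1} S (extend01 h) x c" "x \<in> {0<..1}"
  shows "\<exists>T. finite T \<and> T \<subseteq> {0<..x} \<and> x \<in> T \<and> ennreal c \<le> pair_sum (sup_rate S) h (insert 0 T)"
  using assms
proof (induction rule: reach.induct)
  case (start x)
  then show ?case by auto
next
  case (step a c b u k)
  let ?y = "u \<bullet> (extend01 h b - extend01 h a) - k * (clamp01 b - clamp01 a)"
  have b: "0 < b" "b \<le> 1" using step by auto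
  \<comment> \<open>\<open>a'\<close> is the knot replacing \<open>a\<close>: the knot 0 when
    \<open>a\<close> is negative, otherwise \<open>a\<close> itself.\<close>
  have key: "ennreal ?y \<le> ennreal (b - a') * sup_rate S ((1 / (b - a')) *\<^sub>R (knot h b - knot h a'))"
    if "a' \<in> {0..1}" "a' < b" "extend01 h a = extend01 h (shift_zero a')" "clamp01 a = clamp01 (shift_zero a')" for a'
  proof -
    have "?y = fst (u, k) \<bullet> (knot h b - knot h a') - snd (u, k) * (b - a')"
      using that extend01_shift_zero[of a' h] extend01_shift_zero[of b h] clamp01_shift_zero[of a'] b
      by (simp add: shift_zero_def[of b] clamp01_def[of b])
    then show ?thesis
      using that step.hyps(4) by (subst sup_rate_scale) (auto intro!: SUP_upper2[of "(u, k)"])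
  qed
  show ?case
  proof (cases "a < 0")
    case True
    \<comment> \<open>Steps lead into \<open>{0<..1}\<close>, so a chain still at a negative time
      has made no step.\<close>
    then have c: "c = 0" using reach_dom[OF step.hyps(1)] by auto
    have "cons_pairs {0} = {}" by (auto simp: cons_pairs_def)
    then have "pair_sum (sup_rate S) h {0} = 0"
      by (simp add: pair_sum_def)
    then have "pair_sum (sup_rate S) h (insert b {0}) = ennreal (b - 0) * sup_rate S ((1 / (b - 0)) *\<^sub>R (knot h b - knot h 0))"
      using b by (subst pair_sum_insert) auto
    moreover have "ennreal ?y \<le> ennreal (b - 0) * sup_rate S ((1 / (b - 0)) *\<^sub>R (knot h b - knot h 0))"
      using True b by (intro key) (auto simp: shift_zero_def extend01_def clamp01_def)
    ultimately have "ennreal (c + ?y) \<le> pair_sum (sup_rate S) h (insert 0 {b})"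
      by (simp add: c insert_commute)
    then show ?thesis using b by (intro exI[of _ "{b}"]) auto
  next
    case False
    then have a: "a \<in> {0<..1}" using reach_dom[OF step.hyps(1)] by auto
    then obtain T where T: "finite T" "T \<subseteq> {0<..a}" "a \<in> T" "ennreal c \<le> pair_sum (sup_rate S) h (insert 0 T)"
      using step.IH by blast
    have M: "Max (insert 0 T) = a" using T a by (intro Max_eqI) auto
    have "pair_sum (sup_rate S) h (insert b (insert 0 T)) = pair_sum (sup_rate S) h (insert 0 T) +
        ennreal (b - a) * sup_rate S ((1 / (b - a)) *\<^sub>R (knot h b - knot h a))"
      using T b step.hyps by (subst pair_sum_insert) (auto simp: M)
    moreover have "ennreal ?y \<le> ennreal (b - a) * sup_rate S ((1 / (b - a)) *\<^sub>R (knot h b - knot h a))"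
      using a step.hyps by (intro key) (auto simp: shift_zero_def)
    ultimately have "ennreal (c + ?y) \<le> pair_sum (sup_rate S) h (insert b (insert 0 T))"
      using T(4) by (auto intro!: order_trans[OF ennreal_add_le] add_mono)
    then show ?thesis using b T step.hyps
      by (intro exI[of _ "insert b T"]) (auto simp: insert_commute)
  qed
qed

text \<open>Stated through real bounds because the left side lives in \<open>ennreal\<close> and may
  be infinite, whereas chains have real, possibly negative sums.\<close>

lemma SUP_polygon_le_iff:
  fixes h :: "real \<Rightarrow> 'a::euclidean_space"
  assumes S: "(0, 0) \<in> S" and \<alpha>: "0 \<le> \<alpha>"
  shows "(SUP T\<in>partitions. \<integral>\<^sup>+ s\<in>{0..1}. sup_rate S (vector_derivative (polygon h T) (at s)) \<partial>lborel) \<le> ennreal \<alpha>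
    \<longleftrightarrow> (\<forall>c. reach {0<..1} S (extend01 h) 1 c \<longrightarrow> c \<le> \<alpha>)" (is "?L \<le> _ \<longleftrightarrow> ?R")
proof
  assume L: "?L \<le> ennreal \<alpha>"
  show ?R
  proof (intro allI impI)
    fix c assume "reach {0<..1} S (extend01 h) 1 c"
    from reach_le_pair_sum[OF this] obtain T where T: "finite T" "T \<subseteq> {0<..1}" "1 \<in> T"
       "ennreal c \<le> pair_sum (sup_rate S) h (insert 0 T)" by auto
    then have TP: "T \<in> partitions" by (auto simp: partitions_def)
    have "ennreal c \<le> pair_sum (sup_rate S) h (insert 0 (insert 1 T))"
      using T by (simp add: insert_absorb)
    also have "\<dots> \<le> ?L"
      unfolding nn_integral_polygon[OF TP, symmetric] by (rule SUP_upper[OF TP])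
    also note L
    finally show "c \<le> \<alpha>" using \<alpha> by simp
  qed
next
  assume R: ?R
  show "?L \<le> ennreal \<alpha>"
  proof (rule SUP_least)
    fix T :: "real set" assume T: "T \<in> partitions"
    then have T': "finite (insert 1 T)" "insert 1 T \<subseteq> {0<..1}" by (auto simp: partitions_def)
    have M: "Max (insert 0 (insert 1 T)) = 1" using T' by (intro Max_eqI) auto
    have "pair_sum (sup_rate S) h (insert 0 (insert 1 T)) \<le> (SUP c\<in>{c. reach {0<..1} S (extend01 h) 1 c}. ennreal c)"
      using pair_sum_le_reach[OF S T', of h] by (simp add: M shift_zero_def)
    also have "\<dots> \<le> ennreal \<alpha>" using R by (auto intro!: SUP_least ennreal_leI)
    finally show "(\<integral>\<^sup>+ s\<in>{0..1}. sup_rate S (vector_derivative (polygon h T) (at s)) \<partial>lborel) \<le> ennreal \<alpha>"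
      unfolding nn_integral_polygon[OF T] .
  qed
qed

section \<open>The rate accumulated up to time \<open>x\<close>\<close>

text \<open>The shape of the distribution function of a (vector) measure on \<open>[0, 1]\<close>;
  an atom at 0 appears as the jump away from the value 0 on the negative axis.\<close>

definition right_cont01 :: "(real \<Rightarrow> 'a::real_normed_vector) \<Rightarrow> bool" where
  "right_cont01 H \<longleftrightarrow> (\<forall>x<0. H x = 0) \<and> (\<forall>x\<ge>1. H x = H 1) \<and> (\<forall>x. continuous (at_right x) H)"

lemma right_cont01D:
  assumes "right_cont01 H"
  shows "x < 0 \<Longrightarrow> H x = 0" "1 \<le> x \<Longrightarrow> H x = H 1" "continuous (at_right x) H"
  using assms unfolding right_cont01_def by blast+

lemma continuous_at_right_cong:
  fixes f :: "real \<Rightarrow> 'b::topological_space"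
  assumes "x < b" "\<And>y. x \<le> y \<Longrightarrow> y < b \<Longrightarrow> f y = g y" "continuous (at_right x) f"
  shows "continuous (at_right x) g"
proof -
  have "(f \<longlongrightarrow> f x) (at_right x)" using assms(3) by (simp add: continuous_within)
  moreover have "\<forall>\<^sub>F y in at_right x. f y = g y"
    unfolding eventually_at_right_field using assms(1,2) by (intro exI[of _ b]) auto
  ultimately have "(g \<longlongrightarrow> f x) (at_right x)" by (rule Lim_transform_eventually)
  then show ?thesis using assms(1) assms(2)[of x] by (simp add: continuous_within)
qed

lemma right_cont01_extend01:
  assumes "cadlag h"
  shows "right_cont01 (extend01 h)"
proof -
  have "continuous (at_right x) (extend01 h)" for x
  proof -
    consider "x < 0" | "0 \<le> x" "x < 1" | "1 \<le> x" by linarith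
    then show ?thesis
    proof cases
      case 1
      then show ?thesis by - (rule continuous_at_right_cong[of x 0 "\<lambda>_. 0"], auto simp: extend01_def)
    next
      case 2
      then have "continuous (at_right x) h" using assms by (auto simp: cadlag_def)
      then show ?thesis using 2 by - (rule continuous_at_right_cong[of x 1 h], auto simp: extend01_def)
    next
      case 3
      then show ?thesis by - (rule continuous_at_right_cong[of x "x+1" "\<lambda>_. h 1"], auto simp: extend01_def)
    qed
  qed
  then show ?thesis by (auto simp: right_cont01_def extend01_def)
qed

lemma right_cont01_min:
  assumes "right_cont01 H" "0 \<le> t" "t \<le> 1"
  shows "right_cont01 (\<lambda>x. H (min x t))"
proof -
  have "continuous (at_right x) (\<lambda>x. H (min x t))" for x
  proof (cases "x < t")
    case True
    then show ?thesis using right_cont01D(3)[OF assms(1), of x]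
      by - (rule continuous_at_right_cong[of x t H], auto)
  next
    case False
    then show ?thesis by - (rule continuous_at_right_cong[of x "x+1" "\<lambda>_. H t"], auto)
  qed
  moreover have "H (min x t) = 0" if "x < 0" for x using that assms right_cont01D(1)[OF assms(1)] by simp
  moreover have "min x t = min 1 t" if "1 \<le> x" for x using that assms by simp
  ultimately show ?thesis unfolding right_cont01_def by metis
qed

section \<open>Moving partition points into a dense set, and lower semicontinuity\<close>

lemma reach_mono_Q: "reach Q S H x c \<Longrightarrow> Q \<subseteq> Q' \<Longrightarrow> reach Q' S H x c"
  by (induction rule: reach.induct) (auto intro: reach.intros)

lemma reach_neg:
  assumes "reach Q S H x c" "x < 0" "\<And>y. y < 0 \<Longrightarrow> H y = 0"
  shows "c = 0"
  using assms(1,2) by (induction rule: reach.induct) (auto simp: assms(3) clamp01_def)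

text \<open>Density is asked from the right because points will be moved to the right; the endpoint
  1 belongs to the set because it has to stay where it is.\<close>

definition dense01 :: "real set \<Rightarrow> bool" where
  "dense01 Q \<longleftrightarrow> 1 \<in> Q \<and> Q \<subseteq> {0<..1} \<and> (\<forall>x e. 0 \<le> x \<longrightarrow> x < 1 \<longrightarrow> 0 < e \<longrightarrow> (\<exists>q\<in>Q. x < q \<and> q < x + e))"

lemma clamp01_lipschitz: "x \<le> y \<Longrightarrow> 0 \<le> clamp01 y - clamp01 x \<and> clamp01 y - clamp01 x \<le> y - x"
  by (auto simp: clamp01_def)

lemma abs_step_le:
  assumes "norm v \<le> z" "\<bar>s\<bar> \<le> z" "norm v' \<le> z" "\<bar>s'\<bar> \<le> z"
  shows "\<bar>(u \<bullet> (v - v') - k * (s - s'))\<bar> \<le> (2 * norm u + 2 * \<bar>k\<bar>) * z"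
proof -
  have "\<bar>u \<bullet> (v - v')\<bar> \<le> norm u * norm (v - v')" by (rule Cauchy_Schwarz_ineq2)
  also have "\<dots> \<le> norm u * (2 * z)"
    using assms norm_triangle_ineq4[of v v'] by (intro mult_left_mono) auto
  finally have 1: "\<bar>u \<bullet> (v - v')\<bar> \<le> norm u * (2 * z)" .
  have "\<bar>k * (s - s')\<bar> \<le> \<bar>k\<bar> * (2 * z)"
    unfolding abs_mult using assms by (intro mult_left_mono) auto
  then show ?thesis using 1 by (simp add: algebra_simps) 
qed

text \<open>Every point of the chain is moved slightly to the right into \<open>Q\<close>, and
  right-continuity keeps the increments close. The bound on \<open>H q - H x\<close> is part of the
  claim because the next increment starts from the moved point.\<close>

lemma reach_approx:
  assumes H: "right_cont01 H" and Q: "dense01 Q"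
    and r: "reach UNIV S H x c" and "x \<le> 1" "0 < e"
  shows "\<exists>q c'. reach Q S H q c' \<and> x \<le> q \<and> q < x + e \<and> q \<le> 1 \<and> c - e < c' \<and> norm (H q - H x) < e"
  using r assms(4,5)
proof (induction arbitrary: e rule: reach.induct)
  case (start x)
  then show ?case by (intro exI[of _ x] exI[of _ 0]) (auto intro: reach.start)
next
  case (step a c b u k)
  have all: "reach UNIV S H b (c + (u \<bullet> (H b - H a) - k * (clamp01 b - clamp01 a)))" (is "reach _ _ _ _ ?c")
    using step.hyps by (intro reach.step)
  show ?case
  proof (cases "b < 0")
    case True
    have "?c = 0" using reach_neg[OF all True] right_cont01D(1)[OF H] by blast
    then show ?thesis using step.prems True by (intro exI[of _ b] exI[of _ 0]) (auto intro: reach.start)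
  next
    case False
    \<comment> \<open>\<open>C * z \<le> e\<close> absorbs the loss \<open>z\<close> inherited from
      the shorter chain and the errors \<open>2 * norm u * z\<close> and
      \<open>2 * \<bar>k\<bar> * z\<close> of the new term; the spare \<open>z\<close> makes the
      inequality strict. The bound \<open>z \<le> b - a\<close> keeps the moved points in
      order.\<close>
    define C where "C = 2 + 2 * norm u + 2 * \<bar>k\<bar>"
    define z where "z = min (e / C) (min e (b - a))"
    have C: "2 \<le> C" by (auto simp: C_def)
    have z: "0 < z" "z \<le> e" "z \<le> b - a" "z \<le> e / C"
      using step C by (auto simp: z_def)
    have Cz: "(1 + 2 * norm u + 2 * \<bar>k\<bar>) * z < e"
    proof -
      have "(1 + 2 * norm u + 2 * \<bar>k\<bar>) * z < C * z" using z by (simp add: C_def)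
      also have "\<dots> \<le> e" using z C by (simp add: field_simps)
      finally show ?thesis .
    qed
    obtain qa ca where qa: "reach Q S H qa ca" "a \<le> qa" "qa < a + z" "c - z < ca" "norm (H qa - H a) < z"
      using step.IH[of z] step.hyps step.prems z by auto
    have "\<exists>qb\<in>Q. b \<le> qb \<and> qb < b + z \<and> qb \<le> 1 \<and> norm (H qb - H b) < z"
    proof (cases "b = 1")
      case True
      then show ?thesis using Q z by (intro bexI[of _ 1]) (auto simp: dense01_def)
    next
      case b1: False
      have "(H \<longlongrightarrow> H b) (at_right b)" using right_cont01D(3)[OF H, of b] by (simp add: continuous_within)
      then have "\<forall>\<^sub>F y in at_right b. dist (H y) (H b) < z" using z by (auto dest: tendstoD)
      then obtain d where d: "d > b" "\<And>y. b < y \<Longrightarrow> y < d \<Longrightarrow> dist (H y) (H b) < z"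
        unfolding eventually_at_right_field by auto
      \<comment> \<open>\<open>d\<close> gives closeness of \<open>H\<close>, \<open>z\<close>
        bounds the shift, and \<open>1 - b\<close> keeps the moved point below 1.\<close>
      have "0 < min (d - b) (min z (1 - b))" using d z b1 step.prems by auto
      moreover have "0 \<le> b" "b < 1" using False b1 step.prems by auto
      ultimately obtain q where "q \<in> Q" "b < q" "q < b + min (d - b) (min z (1 - b))"
        using Q unfolding dense01_def by blast
      then show ?thesis using d(2)[of q] by (intro bexI[of _ q]) (auto simp: dist_norm)
    qed
    then obtain qb where qb: "qb \<in> Q" "b \<le> qb" "qb < b + z" "qb \<le> 1" "norm (H qb - H b) < z" by auto
    have ab: "qa < qb" using qa qb z by linarith
    let ?c' = "ca + (u \<bullet> (H qb - H qa) - k * (clamp01 qb - clamp01 qa))"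
    have r: "reach Q S H qb ?c'"
      using qa(1) ab qb(1) step.hyps(4) by (rule reach.step)
    have "\<bar>u \<bullet> ((H qb - H b) - (H qa - H a)) - k * ((clamp01 qb - clamp01 b) - (clamp01 qa - clamp01 a))\<bar>
      \<le> (2 * norm u + 2 * \<bar>k\<bar>) * z"
      using qa qb clamp01_lipschitz[of b qb] clamp01_lipschitz[of a qa]
      by (intro abs_step_le) auto
    moreover have "?c' - ?c = (ca - c) + (u \<bullet> ((H qb - H b) - (H qa - H a)) - k * ((clamp01 qb - clamp01 b) - (clamp01 qa - clamp01 a)))"
      by (simp add: algebra_simps)
    ultimately have "?c' - ?c > - e" using qa(4) Cz by (simp add: algebra_simps abs_le_iff)
    then show ?thesis using r qb z by (intro exI[of _ qb] exI[of _ ?c']) auto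
  qed
qed

text \<open>The same points and pairs serve for every \<open>n\<close>: the sum depends on the
  function only through its values at finitely many points of \<open>Q\<close> and at a negative
  time, where all functions vanish.\<close>

lemma reach_limit:
  assumes neg: "\<And>n x. x < 0 \<Longrightarrow> Hn n x = 0" "\<And>x. x < 0 \<Longrightarrow> H x = 0"
    and lim: "\<And>q. q \<in> Q \<Longrightarrow> (\<lambda>n. Hn n q) \<longlonglongrightarrow> H q"
    and r: "reach Q S H x c"
  shows "\<exists>cn. (\<forall>n. reach Q S (Hn n) x (cn n)) \<and> cn \<longlonglongrightarrow> c"
  using r
proof (induction rule: reach.induct)
  case (start x)
  then show ?case by (intro exI[of _ "\<lambda>_. 0"]) (auto intro: reach.start)
next
  case (step a c b u k)
  then obtain cn where cn: "\<And>n. reach Q S (Hn n) a (cn n)" "cn \<longlonglongrightarrow> c" by auto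
  have "(\<lambda>n. Hn n a) \<longlonglongrightarrow> H a"
    using reach_dom[OF step.hyps(1)] neg lim by (cases "a < 0") auto
  then have "(\<lambda>n. cn n + (u \<bullet> (Hn n b - Hn n a) - k * (clamp01 b - clamp01 a))) \<longlonglongrightarrow> c + (u \<bullet> (H b - H a) - k * (clamp01 b - clamp01 a))"
    using lim[OF step.hyps(3)] cn by (intro tendsto_intros)
  then show ?case
    using cn step.hyps by (intro exI[of _ "\<lambda>n. cn n + (u \<bullet> (Hn n b - Hn n a) - k * (clamp01 b - clamp01 a))"]) (auto intro: reach.step)
qed

text \<open>A sum for the limit is approximated by one with points in \<open>Q\<close>, which in
  turn is a limit of sums for \<open>Hn\<close>. With a constant sequence this admits arbitrary
  partition points; with a sequence selected by Helly's theorem it is lower semicontinuity.\<close>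

lemma reach_bound_lsc:
  assumes H: "right_cont01 H" and Q: "dense01 Q"
    and neg: "\<And>n x. x < 0 \<Longrightarrow> Hn n x = 0"
    and lim: "\<And>q. q \<in> Q \<Longrightarrow> (\<lambda>n. Hn n q) \<longlonglongrightarrow> H q"
    and bd: "\<And>n c. reach {0<..1} S (Hn n) 1 c \<Longrightarrow> c \<le> \<alpha>"
    and r: "reach UNIV S H 1 c"
  shows "c \<le> \<alpha>"
proof (rule field_le_epsilon)
  fix e :: real assume "0 < e"
  from reach_approx[OF H Q r order_refl this] obtain q c' where
    q: "reach Q S H q c'" "1 \<le> q" "q \<le> 1" "c - e < c'" by blast
  then have "q = 1" by simp
  with q have q': "reach Q S H 1 c'" by simp
  from reach_limit[of Hn H Q, OF neg right_cont01D(1)[OF H] lim q']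
  obtain cn where cn: "\<And>n. reach Q S (Hn n) 1 (cn n)" "cn \<longlonglongrightarrow> c'" by blast
  have "cn n \<le> \<alpha>" for n
    using bd[OF reach_mono_Q[OF cn(1)]] Q by (auto simp: dense01_def)
  then have "c' \<le> \<alpha>" by (intro LIMSEQ_le_const2[OF cn(2)]) auto
  then show "c \<le> \<alpha> + e" using q by linarith
qed

lemma dense01_Ioc: "dense01 {0<..1}"
proof -
  have "\<exists>q\<in>{0<..1}. x < q \<and> q < x + e" if "0 \<le> x" "x < 1" "0 < e" for x e :: real
  proof -
    have "x < min 1 (x + e)" using that by auto
    then obtain q where "x < q" "q < min 1 (x + e)" using dense by blast
    then show ?thesis using that by (intro bexI[of _ q]) auto
  qed
  then show ?thesis by (auto simp: dense01_def)
qed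

lemma SUP_polygon_le_iff_reach:
  fixes h :: "real \<Rightarrow> 'a::euclidean_space"
  assumes "(0, 0) \<in> S" "0 \<le> \<alpha>" "right_cont01 (extend01 h)"
  shows "(SUP T\<in>partitions. \<integral>\<^sup>+ s\<in>{0..1}. sup_rate S (vector_derivative (polygon h T) (at s)) \<partial>lborel) \<le> ennreal \<alpha>
    \<longleftrightarrow> (\<forall>c. reach UNIV S (extend01 h) 1 c \<longrightarrow> c \<le> \<alpha>)"
  unfolding SUP_polygon_le_iff[OF assms(1,2)]
  using reach_bound_lsc[OF assms(3) dense01_Ioc, of "\<lambda>_. extend01 h" S \<alpha>] assms(3)
  by (auto simp: right_cont01D(1) intro: reach_mono_Q)

section \<open>The minimal dominating function\<close>

definition rate_upto :: "('a::real_inner \<times> real) set \<Rightarrow> (real \<Rightarrow> 'a) \<Rightarrow> real \<Rightarrow> real" where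
  "rate_upto S H x = Sup {c. reach UNIV S H x c}"

text \<open>Verification principle: along a chain the increments of \<Psi> telescope and dominate
  the sum term by term.\<close>

lemma reach_least:
  assumes nn: "\<And>x. x < 0 \<Longrightarrow> 0 \<le> \<Psi> x"
    and st: "\<And>a b u k. a < b \<Longrightarrow> (u, k) \<in> S \<Longrightarrow> \<Psi> a + (u \<bullet> (H b - H a) - k * (clamp01 b - clamp01 a)) \<le> \<Psi> b"
    and r: "reach Q S H x c"
  shows "c \<le> \<Psi> x"
  using r
proof (induction rule: reach.induct)
  case (step a c b u k)
  then show ?case using st[of a b u k] by linarith
qed (use nn in auto)

text \<open>A bound at time 1 propagates to all times: earlier chains are prolonged by the pair
  \<open>(0, 0)\<close>, and after time 1 both \<open>H\<close> and \<open>clamp01\<close> stand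
  still.\<close>

locale bounded_rate =
  fixes S :: "('a::real_inner \<times> real) set" and H :: "real \<Rightarrow> 'a"
  assumes S0: "(0, 0) \<in> S" and rc: "right_cont01 H" and bdd: "bdd_above {c. reach UNIV S H 1 c}"
begin

lemma reach_mono: "reach UNIV S H x c \<Longrightarrow> x \<le> y \<Longrightarrow> reach UNIV S H y c"
  using reach.step[of UNIV S H x c y 0 0] S0 by (cases "x = y") auto

lemma reach_min1: "reach UNIV S H x c \<Longrightarrow> reach UNIV S H (min x 1) c"
proof (induction rule: reach.induct)
  case (start x)
  then show ?case by (auto intro: reach.start simp: min_def)
next
  case (step a c b u k)
  show ?case
  proof (cases "a < 1")
    case True
    have "H b = H (min b 1)" "clamp01 b = clamp01 (min b 1)" using right_cont01D(2)[OF rc, of b] by (auto simp: min_def clamp01_def)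
    then show ?thesis using step True reach.step[of UNIV S H a c "min b 1" u k] by auto
  next
    case False
    then have "H a = H 1" "H b = H 1" "clamp01 a = clamp01 b"
      using step.hyps right_cont01D(2)[OF rc, of a] right_cont01D(2)[OF rc, of b] by (auto simp: clamp01_def)
    then show ?thesis using step False by (simp add: min_absorb2)
  qed
qed

lemma bdd_reach: "bdd_above {c. reach UNIV S H x c}"
proof (rule bdd_above_mono[OF bdd])
  show "{c. reach UNIV S H x c} \<subseteq> {c. reach UNIV S H 1 c}"
    using reach_mono[OF reach_min1, of x _ 1] by auto
qed

lemma reach0: "reach UNIV S H x 0"
  by (rule reach_zero[OF S0]) auto

lemma reach_le_rate_upto: "reach UNIV S H x c \<Longrightarrow> c \<le> rate_upto S H x"
  unfolding rate_upto_def by (rule cSup_upper) (auto intro: bdd_reach)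

lemma rate_upto_leI: "(\<And>c. reach UNIV S H x c \<Longrightarrow> c \<le> y) \<Longrightarrow> rate_upto S H x \<le> y"
  unfolding rate_upto_def using reach0 by (intro cSup_least) auto

lemma rate_upto_neg: "x < 0 \<Longrightarrow> rate_upto S H x = 0"
  using reach_neg[of UNIV S H x] right_cont01D(1)[OF rc] reach_le_rate_upto[OF reach0, of x]
  by (intro antisym rate_upto_leI) auto

lemma rate_upto_ge1: "1 \<le> x \<Longrightarrow> rate_upto S H x = rate_upto S H 1"
  using reach_mono[of 1 _ x] reach_min1[of x]
  by (intro antisym rate_upto_leI reach_le_rate_upto) (auto simp: min_absorb2)

lemma rate_upto_step:
  assumes "a \<le> b" "(u, k) \<in> S"
  shows "rate_upto S H a + (u \<bullet> (H b - H a) - k * (clamp01 b - clamp01 a)) \<le> rate_upto S H b"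
proof (cases "a = b")
  case False
  then have "a < b" using assms by simp
  have "rate_upto S H a \<le> rate_upto S H b - (u \<bullet> (H b - H a) - k * (clamp01 b - clamp01 a))"
  proof (rule rate_upto_leI)
    fix c assume "reach UNIV S H a c"
    from reach_le_rate_upto[OF reach.step[OF this \<open>a < b\<close> UNIV_I assms(2)]]
    show "c \<le> rate_upto S H b - (u \<bullet> (H b - H a) - k * (clamp01 b - clamp01 a))" by simp
  qed
  then show ?thesis by simp
qed simp

lemma rate_upto_mono: "a \<le> b \<Longrightarrow> rate_upto S H a \<le> rate_upto S H b"
  using rate_upto_step[OF _ S0] by simp

lemma rate_upto_least:
  assumes nn: "\<And>x. x < 0 \<Longrightarrow> 0 \<le> \<Psi> x"
    and st: "\<And>a b u k. a < b \<Longrightarrow> (u, k) \<in> S \<Longrightarrow> \<Psi> a + (u \<bullet> (H b - H a) - k * (clamp01 b - clamp01 a)) \<le> \<Psi> b"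
  shows "rate_upto S H x \<le> \<Psi> x"
  using reach_least[of \<Psi> S H, OF nn st] by (intro rate_upto_leI) blast

text \<open>If \<open>rate_upto\<close> jumped to the right of \<open>x\<close>, removing the jump would give a smaller
  function with the same increment bounds, contradicting minimality.\<close>

lemma rate_upto_small_right:
  assumes "0 < e"
  shows "\<exists>y>x. rate_upto S H y < rate_upto S H x + e"
proof (rule ccontr)
  assume "\<not> ?thesis"
  then have J: "rate_upto S H x + e \<le> rate_upto S H y" if "x < y" for y using that by force
  have x: "0 \<le> x"
  proof (rule ccontr)
    assume "\<not> 0 \<le> x"
    then have "rate_upto S H (x / 2) = rate_upto S H x" by (simp add: rate_upto_neg)
    with J[of "x / 2"] \<open>\<not> 0 \<le> x\<close> assms show False by simp
  qed
  define \<Psi> where "\<Psi> y = (if x < y then rate_upto S H y - e else rate_upto S H y)" for y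
  have "rate_upto S H (x + 1) \<le> \<Psi> (x + 1)"
  proof (rule rate_upto_least)
    show "0 \<le> \<Psi> y" if "y < 0" for y using that x by (simp add: \<Psi>_def rate_upto_neg)
    fix a b :: real and u k assume ab: "a < b" and uk: "(u, k) \<in> S"
    show "\<Psi> a + (u \<bullet> (H b - H a) - k * (clamp01 b - clamp01 a)) \<le> \<Psi> b"
    proof (cases "a \<le> x \<and> x < b")
      case False
      then show ?thesis using rate_upto_step[OF less_imp_le[OF ab] uk] ab by (auto simp: \<Psi>_def)
    next
      \<comment> \<open>The step crosses \<open>x\<close>. From any \<open>y > x\<close> the value
        is already larger by \<open>e\<close>, and \<open>rate_upto_step\<close> applies from
        \<open>y\<close> to \<open>b\<close>; letting \<open>y\<close> decrease to \<open>x\<close>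
        preserves the gain \<open>e\<close>, which pays for the removed jump.\<close>
      case True
      have "\<forall>\<^sub>F y in at_right x. rate_upto S H x + e + (u \<bullet> (H b - H y) - k * (clamp01 b - clamp01 y)) \<le> rate_upto S H b"
        unfolding eventually_at_right_field
      proof (intro exI[of _ b] conjI allI impI)
        fix y assume y: "x < y" "y < b"
        show "rate_upto S H x + e + (u \<bullet> (H b - H y) - k * (clamp01 b - clamp01 y)) \<le> rate_upto S H b"
          using J[OF y(1)] rate_upto_step[OF less_imp_le[OF y(2)] uk] by linarith
      qed (use True in auto)
      moreover have "((\<lambda>y. rate_upto S H x + e + (u \<bullet> (H b - H y) - k * (clamp01 b - clamp01 y)))
          \<longlongrightarrow> rate_upto S H x + e + (u \<bullet> (H b - H x) - k * (clamp01 b - clamp01 x))) (at_right x)"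
        using right_cont01D(3)[OF rc, of x] unfolding clamp01_def continuous_within
        by (intro tendsto_intros) auto
      ultimately have "rate_upto S H x + e + (u \<bullet> (H b - H x) - k * (clamp01 b - clamp01 x)) \<le> rate_upto S H b"
        using tendsto_upperbound[of _ _ "at_right x"] by auto
      moreover have "rate_upto S H a + (u \<bullet> (H x - H a) - k * (clamp01 x - clamp01 a)) \<le> rate_upto S H x"
        using True by (intro rate_upto_step uk) auto
      ultimately show ?thesis using True by (auto simp: \<Psi>_def algebra_simps)
    qed
  qed
  then show False using assms by (simp add: \<Psi>_def)
qed

lemma right_cont01_rate_upto: "right_cont01 (rate_upto S H)"
proof -
  have "continuous (at_right x) (rate_upto S H)" for x
  proof (subst continuous_at_right_real_increasing)
    show "\<forall>e>0. \<exists>d>0. rate_upto S H (x + d) - rate_upto S H x < e"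
    proof (intro allI impI)
      fix e :: real assume "0 < e"
      from rate_upto_small_right[OF this, of x] obtain y where "x < y" "rate_upto S H y < rate_upto S H x + e" by blast
      then show "\<exists>d>0. rate_upto S H (x + d) - rate_upto S H x < e" by (intro exI[of _ "y - x"]) auto
    qed
  qed (rule rate_upto_mono)
  then show ?thesis using rate_upto_neg rate_upto_ge1 unfolding right_cont01_def by blast
qed

end

section \<open>Total variation as a rate\<close>

definition var_set :: "('a::real_inner \<times> real) set" where
  "var_set = {(u, 0) |u. norm u \<le> 1}"

lemma var_set_0: "(0, 0) \<in> var_set" by (simp add: var_set_def)

text \<open>Duality of the norm: the supremum over the unit ball is attained at
  \<open>sgn v\<close>.\<close>

lemma sup_rate_var_set: "sup_rate var_set v = ennreal (norm v)"
proof (rule antisym)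
  show "sup_rate var_set v \<le> ennreal (norm v)"
    unfolding sup_rate_def
  proof (rule SUP_least)
    fix p :: "'a \<times> real" assume "p \<in> var_set"
    then obtain u where p: "p = (u, 0)" "norm u \<le> 1" by (auto simp: var_set_def)
    have "u \<bullet> v \<le> norm u * norm v" by (rule norm_cauchy_schwarz)
    also have "\<dots> \<le> 1 * norm v" by (rule mult_right_mono) (use p in auto)
    finally show "ennreal (fst p \<bullet> v - snd p) \<le> ennreal (norm v)" using p by (auto intro: ennreal_leI)
  qed
  have "(sgn v, 0) \<in> var_set" by (simp add: var_set_def norm_sgn)
  moreover have "sgn v \<bullet> v = norm v"
    by (cases "v = 0") (simp_all add: sgn_div_norm dot_square_norm power2_eq_square)
  ultimately show "ennreal (norm v) \<le> sup_rate var_set v"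
    unfolding sup_rate_def by (intro SUP_upper2[of "(sgn v, 0)"]) auto
qed

lemma Var_eq: "Var h = (SUP T\<in>partitions. \<integral>\<^sup>+ s\<in>{0..1}. sup_rate var_set (vector_derivative (polygon h T) (at s)) \<partial>lborel)"
  by (simp add: Var_def sup_rate_var_set)

text \<open>Both sides obey the same nonnegative real upper bounds; this settles equality once the
  left side is seen to be finite.\<close>

lemma SUP_polygon_eq_rate_upto:
  fixes h :: "real \<Rightarrow> 'a::euclidean_space"
  assumes "bounded_rate S (extend01 h)"
  shows "(SUP T\<in>partitions. \<integral>\<^sup>+ s\<in>{0..1}. sup_rate S (vector_derivative (polygon h T) (at s)) \<partial>lborel) = ennreal (rate_upto S (extend01 h) 1)"
    (is "?L = _")
proof -
  interpret bounded_rate S "extend01 h" by fact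
  have P0: "0 \<le> rate_upto S (extend01 h) 1" using reach_le_rate_upto[OF reach0] .
  have iff: "?L \<le> ennreal \<alpha> \<longleftrightarrow> rate_upto S (extend01 h) 1 \<le> \<alpha>" if "0 \<le> \<alpha>" for \<alpha>
  proof -
    have "(\<forall>c. reach UNIV S (extend01 h) 1 c \<longrightarrow> c \<le> \<alpha>) \<longleftrightarrow> rate_upto S (extend01 h) 1 \<le> \<alpha>"
      by (blast intro: order_trans reach_le_rate_upto rate_upto_leI)
    then show ?thesis using SUP_polygon_le_iff_reach[OF S0 that rc] by simp
  qed
  have L: "?L \<le> ennreal (rate_upto S (extend01 h) 1)" using iff[OF P0] by simp
  then obtain l where l: "0 \<le> l" "?L = ennreal l" by (cases ?L) (auto simp: top_unique)
  then have "rate_upto S (extend01 h) 1 \<le> l" using iff[OF l(1)] by simp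
  then show ?thesis using L l by (auto intro!: antisym ennreal_leI)
qed

lemma bounded_rateI:
  fixes h :: "real \<Rightarrow> 'a::euclidean_space"
  assumes "(0, 0) \<in> S" "right_cont01 (extend01 h)"
    "(SUP T\<in>partitions. \<integral>\<^sup>+ s\<in>{0..1}. sup_rate S (vector_derivative (polygon h T) (at s)) \<partial>lborel) < \<infinity>" (is "?L < _")
  shows "bounded_rate S (extend01 h)"
proof
  obtain l where l: "0 \<le> l" "?L = ennreal l" using assms(3) by (cases ?L) auto
  have "\<forall>c. reach UNIV S (extend01 h) 1 c \<longrightarrow> c \<le> l"
    using SUP_polygon_le_iff_reach[OF assms(1) l(1) assms(2)] l(2) by simp
  then show "bdd_above {c. reach UNIV S (extend01 h) 1 c}" by (intro bdd_aboveI) auto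
qed fact+

lemma BV01_bounded_rate:
  assumes "h \<in> BV01"
  shows "bounded_rate var_set (extend01 h)"
  using assms by (intro bounded_rateI var_set_0 right_cont01_extend01) (auto simp: BV01_def D01_def Var_eq)

text \<open>Stopping a chain at \<open>t\<close> loses nothing: the stopped function is constant
  afterwards, and elapsed time has no cost because every pair of \<open>var_set\<close> has
  \<open>k = 0\<close>.\<close>

lemma reach_var_set_min:
  assumes t: "0 \<le> t" "t \<le> 1"
  shows "reach UNIV var_set (\<lambda>x. H (min x t)) 1 c \<longleftrightarrow> reach UNIV var_set H t c"
proof
  assume "reach UNIV var_set (\<lambda>x. H (min x t)) 1 c"
  then have "reach UNIV var_set H (min 1 t) c"
  proof (induction rule: reach.induct)
    case (start x)
    then show ?case using t by (auto intro: reach.start simp: min_def)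
  next
    case (step a c b u k)
    have k: "k = 0" using step.hyps by (auto simp: var_set_def)
    show ?case
    proof (cases "a < t")
      case True
      then show ?thesis using k step reach.step[of UNIV var_set H a c "min b t" u k] by auto
    next
      case False
      then show ?thesis using k step by (simp add: min_absorb2)
    qed
  qed
  then show "reach UNIV var_set H t c" using t by (simp add: min_def)
next
  assume r: "reach UNIV var_set H t c"
  have *: "x \<le> t \<Longrightarrow> reach UNIV var_set (\<lambda>x. H (min x t)) x c" if "reach UNIV var_set H x c" for x c
    using that
  proof (induction rule: reach.induct)
    case (start x)
    then show ?case by (auto intro: reach.start)
  next
    case (step a c b u k)
    then show ?case using reach.step[of UNIV var_set "\<lambda>x. H (min x t)" a c b u k] by (auto simp: min_def)
  qed
  show "reach UNIV var_set (\<lambda>x. H (min x t)) 1 c"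
    using *[OF r] t reach.step[of UNIV var_set "\<lambda>x. H (min x t)" t c 1 0 0] var_set_0
    by (cases "t = 1") auto
qed

lemma Vfun_eq_rate_upto:
  assumes "h \<in> BV01" "0 \<le> t" "t \<le> 1"
  shows "Vfun h t = rate_upto var_set (extend01 h) t"
proof -
  let ?g = "\<lambda>s. h (min s t)"
  interpret bounded_rate var_set "extend01 h" by (rule BV01_bounded_rate) fact
  have e: "extend01 ?g = (\<lambda>x. extend01 h (min x t))"
    using assms by (auto simp: extend01_def fun_eq_iff min_def)
  have set_eq: "{c. reach UNIV var_set (extend01 ?g) 1 c} = {c. reach UNIV var_set (extend01 h) t c}"
    unfolding e using reach_var_set_min[OF assms(2,3)] by auto
  have "bounded_rate var_set (extend01 ?g)"
  proof
    show "right_cont01 (extend01 ?g)" unfolding e by (rule right_cont01_min[OF rc assms(2,3)])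
    show "bdd_above {c. reach UNIV var_set (extend01 ?g) 1 c}" unfolding set_eq by (rule bdd_reach)
  qed (rule var_set_0)
  then have "Var ?g = ennreal (rate_upto var_set (extend01 ?g) 1)"
    unfolding Var_eq by (rule SUP_polygon_eq_rate_upto)
  also have "rate_upto var_set (extend01 ?g) 1 = rate_upto var_set (extend01 h) t" unfolding rate_upto_def set_eq ..
  finally show ?thesis
    using reach_le_rate_upto[OF reach0, of t] by (simp add: Vfun_def)
qed

lemma dV_eq:
  assumes "h \<in> BV01"
  shows "dV h = interval_measure (rate_upto var_set (extend01 h))"
proof -
  interpret bounded_rate var_set "extend01 h" by (rule BV01_bounded_rate) fact
  have "(if x < 0 then 0 else Vfun h (min x 1)) = rate_upto var_set (extend01 h) x" for x
    using Vfun_eq_rate_upto[OF assms, of "min x 1"] rate_upto_neg[of x] rate_upto_ge1[of x] by (auto simp: min_def)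
  then show ?thesis by (simp add: dV_def)
qed

lemma var_set_step_le:
  assumes "\<And>a b. a < b \<Longrightarrow> norm (H b - H a) \<le> F b - F a" "a < b" "(u, k) \<in> var_set"
  shows "F a + (u \<bullet> (H b - H a) - k * (clamp01 b - clamp01 a)) \<le> F b"
proof -
  have "u \<bullet> (H b - H a) \<le> norm u * norm (H b - H a)" by (rule norm_cauchy_schwarz)
  also have "\<dots> \<le> 1 * norm (H b - H a)" by (rule mult_right_mono) (use assms in \<open>auto simp: var_set_def\<close>)
  finally show ?thesis using assms(1)[OF assms(2)] assms(3) by (auto simp: var_set_def)
qed

lemma (in bounded_rate) norm_diff_le_rate_upto:
  assumes "S = var_set" "a \<le> b"
  shows "norm (H b - H a) \<le> rate_upto S H b - rate_upto S H a"
proof -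
  let ?v = "H b - H a"
  have "(sgn ?v, 0) \<in> S" using assms by (simp add: var_set_def norm_sgn)
  moreover have "sgn ?v \<bullet> ?v = norm ?v"
    by (cases "?v = 0") (simp_all add: sgn_div_norm dot_square_norm power2_eq_square)
  ultimately show ?thesis using rate_upto_step[OF assms(2), of "sgn ?v" 0] by simp
qed

section \<open>Distribution functions and signed measures\<close>

text \<open>Treats finite measures, signed measures and vector-valued integrals alike; the condition
  concerns Borel sets only.\<close>

definition sigma_additive :: "(real set \<Rightarrow> 'b::real_normed_vector) \<Rightarrow> bool" where
  "sigma_additive \<kappa> \<longleftrightarrow> (\<forall>A. disjoint_family A \<longrightarrow> range A \<subseteq> sets borel \<longrightarrow> (\<lambda>i::nat. \<kappa> (A i)) sums \<kappa> (\<Union>i. A i))"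

lemma sigma_additiveD: "sigma_additive \<kappa> \<Longrightarrow> disjoint_family A \<Longrightarrow> range A \<subseteq> sets borel \<Longrightarrow> (\<lambda>i::nat. \<kappa> (A i)) sums \<kappa> (\<Union>i. A i)"
  unfolding sigma_additive_def by blast

lemma sigma_additive_empty:
  assumes "sigma_additive \<kappa>"
  shows "\<kappa> {} = 0"
proof -
  have "(\<lambda>i::nat. \<kappa> {}) sums \<kappa> {}"
    using sigma_additiveD[OF assms, of "\<lambda>_. {}"] by (simp add: disjoint_family_on_def)
  then have "(\<lambda>i::nat. \<kappa> {}) \<longlonglongrightarrow> 0" by (intro summable_LIMSEQ_zero) (auto simp: summable_def)
  then show ?thesis by (simp add: LIMSEQ_const_iff)
qed

lemma sigma_additive_Un:
  assumes "sigma_additive \<kappa>" "A \<in> sets borel" "B \<in> sets borel" "A \<inter> B = {}"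
  shows "\<kappa> (A \<union> B) = \<kappa> A + \<kappa> B"
proof -
  have "(\<lambda>n. \<kappa> (binaryset A B n)) sums \<kappa> (\<Union>n. binaryset A B n)"
    using assms by (intro sigma_additiveD) (auto simp: disjoint_family_on_def binaryset_def range_binaryset_eq)
  moreover have "(\<lambda>n. \<kappa> (binaryset A B n)) sums (\<kappa> A + \<kappa> B)"
    by (rule binaryset_sums[of \<kappa>, OF sigma_additive_empty[OF assms(1)]])
  ultimately show ?thesis by (simp add: UN_binaryset_eq sums_unique2)
qed

lemma sigma_additive_Diff:
  assumes "sigma_additive \<kappa>" "A \<in> sets borel" "B \<in> sets borel" "B \<subseteq> A"
  shows "\<kappa> (A - B) = \<kappa> A - \<kappa> B"
proof -
  have "\<kappa> (A - B \<union> B) = \<kappa> (A - B) + \<kappa> B" by (rule sigma_additive_Un) (use assms in auto)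
  moreover have "A - B \<union> B = A" using assms(4) by auto
  ultimately show ?thesis by simp
qed

text \<open>Uniqueness from half-lines by the \<pi>-\<lambda> theorem. The whole line is treated
  beforehand, as an increasing union of half-lines, because the step for complements subtracts from
  its value.\<close>

lemma sigma_additive_eq_0:
  assumes c: "sigma_additive \<kappa>" and z: "\<And>x. \<kappa> {..x} = 0" and B: "B \<in> sets borel"
  shows "\<kappa> B = 0"
proof -
  have U: "\<kappa> UNIV = 0"
  proof -
    let ?A = "\<lambda>n::nat. {..real n}"
    have m: "mono ?A" by (auto simp: mono_def)
    have "\<kappa> (disjointed ?A n) = 0" for n
    proof (cases n)
      case (Suc k)
      then show ?thesis
        using sigma_additive_Diff[OF c, of "{..real (Suc k)}" "{..real k}"] by (simp add: disjointed_mono[OF m] z)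
    qed (simp add: z)
    moreover have "(\<lambda>n. \<kappa> (disjointed ?A n)) sums \<kappa> (\<Union>n. disjointed ?A n)"
      by (intro sigma_additiveD[OF c] disjoint_family_disjointed sets.range_disjointed_sets) auto
    moreover have "(\<Union>n. disjointed ?A n) = UNIV"
      unfolding UN_disjointed_eq using real_arch_simple by auto
    ultimately show ?thesis using sums_unique2[OF sums_zero, of "\<kappa> UNIV"] by simp
  qed
  have B': "B \<in> sigma_sets UNIV (range atMost)"
    using B by (simp add: borel_eq_atMost)
  have "Int_stable (range (atMost :: real \<Rightarrow> _))"
    by (auto simp: Int_stable_def)
  moreover have "range (atMost :: real \<Rightarrow> _) \<subseteq> Pow UNIV" by auto
  ultimately show ?thesis using B'
  proof (induction rule: sigma_sets_induct_disjoint)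
    case (basic A)
    then show ?case using z by auto
  next
    case empty
    show ?case by (rule sigma_additive_empty[OF c])
  next
    case (compl A)
    then have "A \<in> sets borel" by (simp add: borel_eq_atMost)
    then show ?case using sigma_additive_Diff[OF c, of UNIV A] compl U by simp
  next
    case (union A)
    then have "range A \<subseteq> sets borel" by (simp add: borel_eq_atMost)
    from sigma_additiveD[OF c union(1) this] union(3) show ?case using sums_unique2[OF sums_zero, of "\<kappa> (\<Union>i. A i)"] by simp
  qed
qed

lemma sigma_additive_diff: "sigma_additive \<kappa> \<Longrightarrow> sigma_additive \<nu> \<Longrightarrow> sigma_additive (\<lambda>B. \<kappa> B - \<nu> B)"
  by (simp add: sigma_additive_def sums_diff)

lemma sigma_additive_add: "sigma_additive \<kappa> \<Longrightarrow> sigma_additive \<nu> \<Longrightarrow> sigma_additive (\<lambda>B. \<kappa> B + \<nu> B)"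
  by (simp add: sigma_additive_def sums_add)

lemma sigma_additive_eqI:
  assumes "sigma_additive \<kappa>" "sigma_additive \<nu>" "\<And>x. \<kappa> {..x} = \<nu> {..x}" "B \<in> sets borel"
  shows "\<kappa> B = \<nu> B"
  using sigma_additive_eq_0[OF sigma_additive_diff[OF assms(1,2)], of B] assms by simp

lemma sigma_additive_set_integral:
  fixes f :: "real \<Rightarrow> 'b::{banach, second_countable_topology}"
  assumes s: "sets M = sets borel" and f: "integrable M f"
  shows "sigma_additive (\<lambda>B. LINT x:B|M. f x)"
  unfolding sigma_additive_def
proof (intro allI impI)
  fix A :: "nat \<Rightarrow> real set" assume A: "disjoint_family A" "range A \<subseteq> sets borel"
  then have Am[measurable]: "A i \<in> sets M" for i using s by auto
  have fm[measurable]: "f \<in> borel_measurable M" using f by auto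
  have int: "set_integrable M B f" if "B \<in> sets M" for B
    unfolding set_integrable_def using that f by (rule integrable_mult_indicator)
  have "(\<lambda>n. LINT x:(\<Union>i<n. A i)|M. f x) \<longlonglongrightarrow> (LINT x:(\<Union>n. \<Union>i<n. A i)|M. f x)"
  proof (rule set_integral_cont_up)
    show "incseq (\<lambda>n. \<Union>i<n. A i)" unfolding incseq_def by (intro allI impI UN_mono) auto
    show "set_integrable M (\<Union>n. \<Union>i<n. A i) f" by (rule int) measurable
  qed measurable
  moreover have "(\<Union>n. \<Union>i<n. A i) = (\<Union>i. A i)" by auto
  moreover have "(LINT x:(\<Union>i<n. A i)|M. f x) = (\<Sum>i<n. LINT x:A i|M. f x)" for n
  proof (induction n)
    case (Suc n)
    have "(\<Union>i<Suc n. A i) = (\<Union>i<n. A i) \<union> A n" by (auto simp: less_Suc_eq)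
    moreover have "(\<Union>i<n. A i) \<inter> A n = {}"
      using disjoint_family_onD[OF A(1), of _ n] by fastforce
    moreover have "set_integrable M (\<Union>i<n. A i) f" "set_integrable M (A n) f"
      by (rule int, measurable)+
    ultimately show ?case using Suc by (simp only: set_integral_Un sum.lessThan_Suc)
  qed (simp add: set_lebesgue_integral_def)
  ultimately show "(\<lambda>i. LINT x:A i|M. f x) sums (LINT x:(\<Union>i. A i)|M. f x)"
    by (simp add: sums_def)
qed

lemma sigma_additive_measure:
  assumes "finite_measure M" "sets M = sets borel"
  shows "sigma_additive (measure M)"
proof -
  interpret finite_measure M by fact
  show ?thesis unfolding sigma_additive_def using assms(2)
    by (auto intro!: finite_measure_UNION)
qed

lemma sigma_additive_Int:
  assumes "sigma_additive \<kappa>" "N \<in> sets borel"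
  shows "sigma_additive (\<lambda>B. \<kappa> (B \<inter> N))"
  unfolding sigma_additive_def
proof (intro allI impI)
  fix A :: "nat \<Rightarrow> real set" assume A: "disjoint_family A" "range A \<subseteq> sets borel"
  have "(\<lambda>i. \<kappa> (A i \<inter> N)) sums \<kappa> (\<Union>i. A i \<inter> N)"
    using A assms(2) by (intro sigma_additiveD[OF assms(1)]) (auto simp: disjoint_family_on_def)
  then show "(\<lambda>i. \<kappa> (A i \<inter> N)) sums \<kappa> ((\<Union>i. A i) \<inter> N)" by simp
qed

section \<open>Stieltjes measures of increasing distribution functions\<close>

locale distr_fun01 =
  fixes F :: "real \<Rightarrow> real"
  assumes rc: "right_cont01 F" and mono: "\<And>x y. x \<le> y \<Longrightarrow> F x \<le> F y"
begin

lemma emeasure_Ioc: "a \<le> b \<Longrightarrow> emeasure (interval_measure F) {a<..b} = ennreal (F b - F a)"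
  by (rule emeasure_interval_measure_Ioc[OF _ mono right_cont01D(3)[OF rc]])

lemma emeasure_le: "emeasure (interval_measure F) {..x} = ennreal (F x)"
proof -
  have "(\<Union>n::nat. {- 1 - real n<..x}) = {..x}"
  proof (intro equalityI subsetI)
    fix y assume "y \<in> {..x}"
    obtain n :: nat where "- 1 - y < real n" using reals_Archimedean2 by blast
    then show "y \<in> (\<Union>n::nat. {- 1 - real n<..x})" using \<open>y \<in> {..x}\<close> by (auto intro!: exI[of _ n])
  qed auto
  moreover have "(\<lambda>n::nat. emeasure (interval_measure F) {- 1 - real n<..x}) \<longlonglongrightarrow> emeasure (interval_measure F) (\<Union>n::nat. {- 1 - real n<..x})"
    by (intro Lim_emeasure_incseq) (auto simp: incseq_def)
  moreover have "emeasure (interval_measure F) {- 1 - real n<..x} = ennreal (F x)" for n :: nat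
  proof (cases "- 1 - real n \<le> x")
    case True
    then show ?thesis by (simp add: emeasure_Ioc right_cont01D(1)[OF rc])
  next
    case False
    then have "x < 0" by auto
    then show ?thesis using False by (simp add: right_cont01D(1)[OF rc])
  qed
  ultimately show ?thesis by (simp add: LIMSEQ_const_iff)
qed

lemma nonneg: "0 \<le> F x"
  using mono[of "min x (-1)" x] right_cont01D(1)[OF rc, of "min x (-1)"] by simp

lemma emeasure_UNIV: "emeasure (interval_measure F) UNIV = ennreal (F 1)"
proof -
  have "(\<Union>n::nat. {..1 + real n}) = UNIV"
  proof (intro equalityI subsetI UNIV_I)
    fix y :: real
    obtain n :: nat where "y < real n" using reals_Archimedean2 by blast
    then show "y \<in> (\<Union>n::nat. {..1 + real n})" by (auto intro!: exI[of _ n])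
  qed
  moreover have "(\<lambda>n::nat. emeasure (interval_measure F) {..1 + real n}) \<longlonglongrightarrow> emeasure (interval_measure F) (\<Union>n::nat. {..1 + real n})"
    by (intro Lim_emeasure_incseq) (auto simp: incseq_def)
  moreover have "F (1 + real n) = F 1" for n using right_cont01D(2)[OF rc, of "1 + real n"] by simp
  ultimately show ?thesis by (simp add: LIMSEQ_const_iff emeasure_le)
qed

lemma finite: "finite_measure (interval_measure F)"
  by (rule finite_measureI) (simp add: emeasure_UNIV)

lemma measure_le: "measure (interval_measure F) {..x} = F x"
  by (simp add: measure_def emeasure_le nonneg)

lemma measure_UNIV: "measure (interval_measure F) UNIV = F 1"
  by (simp add: measure_def emeasure_UNIV nonneg)

lemma measure_Ioc: "a \<le> b \<Longrightarrow> measure (interval_measure F) {a<..b} = F b - F a"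
  by (simp add: measure_def emeasure_Ioc mono)

lemma sigma_additive_im: "sigma_additive (measure (interval_measure F))"
  by (rule sigma_additive_measure[OF finite]) simp

lemma measure_neg: "measure (interval_measure F) {..<0} = 0"
proof -
  have "{..<0::real} = (\<Union>n::nat. {.. - (1 / real (Suc n))})"
  proof (intro equalityI subsetI)
    fix y :: real assume "y \<in> {..<0}"
    then obtain n :: nat where "1 / real (Suc n) < - y" using nat_approx_posE[of "- y"] by auto
    then show "y \<in> (\<Union>n::nat. {.. - (1 / real (Suc n))})" by (auto intro!: exI[of _ n] simp: algebra_simps)
  qed (auto, smt (verit) divide_pos_pos of_nat_0_le_iff)
  moreover have "(\<Union>n::nat. {.. - (1 / real (Suc n))}) \<in> null_sets (interval_measure F)"
    by (intro null_sets_UN null_setsI) (auto simp: emeasure_le right_cont01D(1)[OF rc])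
  ultimately show ?thesis by (simp add: null_sets_def measure_def)
qed

lemma AE_01: "AE x in interval_measure F. x \<in> {0..1}"
proof -
  interpret finite_measure "interval_measure F" by (rule finite)
  have "measure (interval_measure F) {1<..} = 0"
    using sigma_additive_Diff[OF sigma_additive_im, of UNIV "{..1}"] by (simp add: measure_UNIV measure_le Compl_eq_Diff_UNIV[symmetric])
  then have "{1<..} \<in> null_sets (interval_measure F)" by (auto simp: emeasure_eq_measure)
  moreover have "{..<0} \<in> null_sets (interval_measure F)"
    using measure_neg by (auto simp: emeasure_eq_measure)
  ultimately have "{1<..} \<union> {..<0} \<in> null_sets (interval_measure F)" by (rule null_sets.Un)
  then have "AE x in interval_measure F. x \<notin> {1<..} \<union> {..<0}" by (rule AE_not_in)
  then show ?thesis by eventually_elim auto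
qed

text \<open>\<kappa> coincides with the Stieltjes measure of \<open>F\<close>. Applied to
  differences, this turns an inequality between increments into one between set functions on every
  Borel set.\<close>

lemma sigma_additive_nonneg:
  assumes "sigma_additive \<kappa>" "\<And>x. \<kappa> {..x} = F x" "B \<in> sets borel"
  shows "0 \<le> \<kappa> B"
  using sigma_additive_eqI[OF assms(1) sigma_additive_im _ assms(3)] assms(2) by (simp add: measure_le)

end

lemma AE_nonneg_of_set_integral:
  fixes f :: "'b \<Rightarrow> real"
  assumes "integrable M f" "\<And>B. B \<in> sets M \<Longrightarrow> 0 \<le> (LINT x:B|M. f x)"
  shows "AE x in M. 0 \<le> f x"
proof -
  have [measurable]: "f \<in> borel_measurable M" using assms(1) by auto
  let ?B = "{x\<in>space M. f x < 0}"
  have B: "?B \<in> sets M" by measurable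
  have int: "integrable M (\<lambda>x. - (indicator ?B x *\<^sub>R f x))"
    using integrable_mult_indicator[OF B assms(1)] by simp
  have nn: "AE x in M. 0 \<le> - (indicator ?B x *\<^sub>R f x)" by (intro AE_I2) (auto simp: indicator_def)
  have "integral\<^sup>L M (\<lambda>x. - (indicator ?B x *\<^sub>R f x)) \<le> 0"
    using assms(2)[OF B] by (simp add: set_lebesgue_integral_def)
  moreover have "0 \<le> integral\<^sup>L M (\<lambda>x. - (indicator ?B x *\<^sub>R f x))"
    by (rule integral_nonneg_AE[OF nn])
  ultimately have "integral\<^sup>L M (\<lambda>x. - (indicator ?B x *\<^sub>R f x)) = 0" by simp
  then have "AE x in M. - (indicator ?B x *\<^sub>R f x) = 0"
    using integral_nonneg_eq_0_iff_AE[OF int nn] by simp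
  then show ?thesis
    using AE_space by eventually_elim (auto simp: indicator_def split: if_splits)
qed

lemma right_cont01I:
  assumes "\<And>x. x < 0 \<Longrightarrow> H x = 0" "\<And>x. 1 < x \<Longrightarrow> H x = H 1" "\<And>x. continuous (at_right x) H"
  shows "right_cont01 H"
  unfolding right_cont01_def using assms by (metis order_le_less)

lemma right_cont01_add: "right_cont01 f \<Longrightarrow> right_cont01 g \<Longrightarrow> right_cont01 (\<lambda>x. f x + g x)"
  by (rule right_cont01I) (simp_all add: right_cont01D(1) right_cont01D(3) continuous_add right_cont01D(2)[of f, OF _ less_imp_le] right_cont01D(2)[of g, OF _ less_imp_le])

lemma right_cont01_diff: "right_cont01 f \<Longrightarrow> right_cont01 g \<Longrightarrow> right_cont01 (\<lambda>x. f x - g x)"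
  by (rule right_cont01I) (simp_all add: right_cont01D(1) right_cont01D(3) continuous_diff right_cont01D(2)[of f, OF _ less_imp_le] right_cont01D(2)[of g, OF _ less_imp_le])

lemma right_cont01_cmult: "right_cont01 f \<Longrightarrow> right_cont01 (\<lambda>x. c * f x :: real)"
  by (rule right_cont01I) (simp_all add: right_cont01D(1) right_cont01D(3) continuous_mult_left right_cont01D(2)[of f, OF _ less_imp_le])

lemma right_cont01_inner: "right_cont01 H \<Longrightarrow> right_cont01 (\<lambda>x. u \<bullet> H x)"
  by (rule right_cont01I) (simp_all add: right_cont01D(1) right_cont01D(3) continuous_inner right_cont01D(2)[of H, OF _ less_imp_le])

lemma distr_fun01_clamp01: "distr_fun01 clamp01"
proof
  have "continuous (at_right x) clamp01" for x
    unfolding clamp01_def by (intro continuous_intros)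
  then show "right_cont01 clamp01" by (auto simp: right_cont01_def clamp01_def)
qed (auto simp: clamp01_def)

lemma measure_clamp01:
  assumes "B \<in> sets borel"
  shows "measure (interval_measure clamp01) B = measure lborel (B \<inter> {0..1})"
proof (rule sigma_additive_eqI[OF distr_fun01.sigma_additive_im[OF distr_fun01_clamp01] _ _ assms])
  have *: "sigma_additive (\<lambda>B. LINT x:B|lborel. indicator {0..1} x :: real)"
    by (rule sigma_additive_set_integral) auto
  have "(LINT x:B|lborel. indicator {0..1} x :: real) = measure lborel (B \<inter> {0..1})" for B :: "real set"
    unfolding set_lebesgue_integral_def by (simp add: indicator_inter_arith[symmetric])
  with * show "sigma_additive (\<lambda>B. measure lborel (B \<inter> {0..1::real}))" by simp
  show "measure (interval_measure clamp01) {..x} = measure lborel ({..x} \<inter> {0..1})" for x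
  proof -
    consider "x < 0" | "0 \<le> x" "x \<le> 1" | "1 < x" by linarith
    then show ?thesis
    proof cases
      case 1
      then have "{..x} \<inter> {0..1} = {}" by auto
      with 1 show ?thesis by (simp add: distr_fun01.measure_le[OF distr_fun01_clamp01] clamp01_def)
    next
      case 2
      then have "{..x} \<inter> {0..1} = {0..x}" by auto
      with 2 show ?thesis by (simp add: distr_fun01.measure_le[OF distr_fun01_clamp01] clamp01_def)
    next
      case 3
      then have "{..x} \<inter> {0..1} = {0..1}" by auto
      with 3 show ?thesis by (simp add: distr_fun01.measure_le[OF distr_fun01_clamp01] clamp01_def)
    qed
  qed
qed

lemma emeasure_clamp01:
  assumes "B \<in> sets borel"
  shows "emeasure (interval_measure clamp01) B = emeasure lborel (B \<inter> {0..1})"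
proof -
  interpret finite_measure "interval_measure clamp01" by (rule distr_fun01.finite[OF distr_fun01_clamp01])
  have "emeasure lborel (B \<inter> {0..1}) \<le> emeasure lborel {0..1::real}"
    using assms by (intro emeasure_mono) auto
  then have "emeasure lborel (B \<inter> {0..1}) \<noteq> \<infinity>" by (auto simp: top_unique)
  then show ?thesis using assms
    by (simp add: emeasure_eq_measure measure_clamp01 emeasure_eq_ennreal_measure)
qed

text \<open>Comparing \<open>G\<close> with \<open>F\<close> through the nonnegative \<open>F - G\<close> yields absolute continuity without
  any \<open>\<epsilon>\<close>-\<open>\<delta>\<close> argument.\<close>

lemma (in distr_fun01) dominated_density:
  assumes G: "distr_fun01 G" and FG: "\<And>x y. x \<le> y \<Longrightarrow> G y - G x \<le> F y - F x"
  obtains q where "q \<in> borel_measurable borel" "\<And>x. 0 \<le> q x" "interval_measure G = density (interval_measure F) (\<lambda>x. ennreal (q x))"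
proof -
  interpret G: distr_fun01 G by fact
  interpret finite_measure "interval_measure F" by (rule finite)
  interpret Gm: finite_measure "interval_measure G" by (rule G.finite)
  have "distr_fun01 (\<lambda>x. F x - G x)"
    using right_cont01_diff[OF rc G.rc] FG by unfold_locales (auto simp: algebra_simps)
  then interpret D: distr_fun01 "\<lambda>x. F x - G x" .
  have le: "measure (interval_measure G) B \<le> measure (interval_measure F) B" if "B \<in> sets borel" for B
    using D.sigma_additive_nonneg[OF sigma_additive_diff[OF sigma_additive_im G.sigma_additive_im] _ that] by (simp add: measure_le G.measure_le)
  have ac: "absolutely_continuous (interval_measure F) (interval_measure G)"
    unfolding absolutely_continuous_def
  proof
    fix B assume "B \<in> null_sets (interval_measure F)"
    then have B: "B \<in> sets borel" "measure (interval_measure F) B = 0"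
      by (auto simp: null_sets_def measure_def)
    then have "measure (interval_measure G) B = 0" using le[OF B(1)] by (simp add: antisym)
    then show "B \<in> null_sets (interval_measure G)" using B by (auto simp: Gm.emeasure_eq_measure)
  qed
  obtain D where D: "D \<in> borel_measurable (interval_measure F)"
      "AE x in interval_measure F. RN_deriv (interval_measure F) (interval_measure G) x = ennreal (D x)" "\<And>x. 0 \<le> D x"
    by (rule real_RN_deriv[OF G.finite ac]) auto
  have "interval_measure G = density (interval_measure F) (RN_deriv (interval_measure F) (interval_measure G))"
    by (subst density_RN_deriv[OF ac]) auto
  also have "\<dots> = density (interval_measure F) (\<lambda>x. ennreal (D x))"
    using D by (intro density_cong) auto
  finally show thesis using that[of D] D by auto
qed

lemma measurable_im[simp]: "borel_measurable (interval_measure F) = borel_measurable borel"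
  by (rule measurable_cong_sets) auto

lemma (in distr_fun01) integrable_q:
  assumes "distr_fun01 G" "q \<in> borel_measurable borel" "\<And>x. 0 \<le> q x"
    "interval_measure G = density (interval_measure F) (\<lambda>x. ennreal (q x))"
  shows "integrable (interval_measure F) q"
    "B \<in> sets borel \<Longrightarrow> measure (interval_measure G) B = (LINT x:B|interval_measure F. q x)"
proof -
  interpret G: distr_fun01 G by fact
  interpret Gm: finite_measure "interval_measure G" by (rule G.finite)
  have em: "emeasure (interval_measure G) B = (\<integral>\<^sup>+x. ennreal (indicator B x * q x) \<partial>interval_measure F)" if "B \<in> sets borel" for B
    unfolding assms(4) using that assms(2)
    by (subst emeasure_density) (auto intro!: nn_integral_cong split: split_indicator)
  have "(\<integral>\<^sup>+x. ennreal (q x) \<partial>interval_measure F) = emeasure (interval_measure G) UNIV"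
    by (subst em) auto
  then show int: "integrable (interval_measure F) q"
    using assms(2,3) Gm.emeasure_finite[of UNIV] by (intro integrableI_nonneg) (auto simp: less_top[symmetric])
  show "measure (interval_measure G) B = (LINT x:B|interval_measure F. q x)" if B: "B \<in> sets borel"
  proof -
    have "integrable (interval_measure F) (\<lambda>x. indicator B x * q x)"
      using integrable_mult_indicator[OF _ int, of B] B by simp
    then have "(\<integral>\<^sup>+x. ennreal (indicator B x * q x) \<partial>interval_measure F) = ennreal (LINT x:B|interval_measure F. q x)"
      unfolding set_lebesgue_integral_def using assms(3) by (subst nn_integral_eq_integral) auto
    then show ?thesis using em[OF B] assms(3)
      by (simp add: measure_def set_lebesgue_integral_def integral_nonneg_AE)
  qed
qed

section \<open>Densities and Lebesgue decomposition\<close>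

lemma set_integral_const_one: "finite_measure M \<Longrightarrow> B \<in> sets M \<Longrightarrow> (LINT x:B|M. (1::real)) = measure M B"
  by (simp add: set_lebesgue_integral_def finite_measure.emeasure_finite less_top[symmetric])

lemma set_integrable_of_integrable:
  fixes f :: "_ \<Rightarrow> 'b::{banach, second_countable_topology}"
  shows "integrable M f \<Longrightarrow> B \<in> sets M \<Longrightarrow> set_integrable M B f"
  unfolding set_integrable_def by (intro integrable_mult_indicator)

text \<open>For a basis vector \<open>b\<close> the function \<open>(F + b \<bullet> H) / 2\<close>
  is increasing with increments at most those of \<open>F\<close>, so it has a density
  \<open>q b\<close>; then \<open>2 * q b - 1\<close> is the density of
  \<open>b \<bullet> H\<close>. The norm bound comes from the increasing functions
  \<open>norm u * F - u \<bullet> H\<close>.\<close>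

lemma (in distr_fun01) vector_density:
  fixes H :: "real \<Rightarrow> 'a::euclidean_space"
  assumes H: "right_cont01 H" and dom: "\<And>x y. x \<le> y \<Longrightarrow> norm (H y - H x) \<le> F y - F x"
  obtains g where "g \<in> borel_measurable borel" "integrable (interval_measure F) g"
    "\<And>x. (LINT s:{..x}|interval_measure F. g s) = H x" "AE x in interval_measure F. norm (g x) \<le> 1"
proof -
  let ?M = "interval_measure F"
  interpret finite_measure ?M by (rule finite)
  have ip: "\<bar>u \<bullet> H y - u \<bullet> H x\<bar> \<le> norm u * (F y - F x)" if "x \<le> y" for x y u
  proof -
    have "\<bar>u \<bullet> (H y - H x)\<bar> \<le> norm u * norm (H y - H x)" by (rule Cauchy_Schwarz_ineq2)
    also have "\<dots> \<le> norm u * (F y - F x)" by (intro mult_left_mono dom that) auto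
    finally show ?thesis by (simp add: inner_diff_right)
  qed
  have "\<exists>q. q \<in> borel_measurable borel \<and> (\<forall>x. 0 \<le> q x) \<and>
      interval_measure (\<lambda>x. (1/2) * (F x + b \<bullet> H x)) = density ?M (\<lambda>x. ennreal (q x)) \<and>
      distr_fun01 (\<lambda>x. (1/2) * (F x + b \<bullet> H x))"
    if b: "b \<in> Basis" for b
  proof -
    have d: "distr_fun01 (\<lambda>x. (1/2) * (F x + b \<bullet> H x))"
    proof
      show "right_cont01 (\<lambda>x. (1/2) * (F x + b \<bullet> H x))" by (intro right_cont01_cmult right_cont01_add right_cont01_inner rc H)
      show "(1/2) * (F x + b \<bullet> H x) \<le> (1/2) * (F y + b \<bullet> H y)" if "x \<le> y" for x y
        using ip[OF that, of b] b by (simp add: abs_le_iff)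
    qed
    have le: "(1/2) * (F y + b \<bullet> H y) - (1/2) * (F x + b \<bullet> H x) \<le> F y - F x" if "x \<le> y" for x y
      using ip[OF that, of b] b by (simp add: abs_le_iff algebra_simps)
    obtain q where "q \<in> borel_measurable borel" "\<And>x. 0 \<le> q x"
        "interval_measure (\<lambda>x. (1/2) * (F x + b \<bullet> H x)) = density ?M (\<lambda>x. ennreal (q x))"
      using dominated_density[OF d le] by blast
    with d show ?thesis by blast
  qed
  then have "\<forall>b\<in>Basis. \<exists>q. q \<in> borel_measurable borel \<and> (\<forall>x. 0 \<le> q x) \<and>
      interval_measure (\<lambda>x. (1/2) * (F x + b \<bullet> H x)) = density ?M (\<lambda>x. ennreal (q x)) \<and>
      distr_fun01 (\<lambda>x. (1/2) * (F x + b \<bullet> H x))" by blast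
  from bchoice[OF this] obtain q where q': "\<forall>b\<in>Basis. q b \<in> borel_measurable borel \<and> (\<forall>x. 0 \<le> q b x) \<and>
      interval_measure (\<lambda>x. (1/2) * (F x + b \<bullet> H x)) = density ?M (\<lambda>x. ennreal (q b x)) \<and>
      distr_fun01 (\<lambda>x. (1/2) * (F x + b \<bullet> H x))" by blast
  then have q: "\<And>b. b \<in> Basis \<Longrightarrow> q b \<in> borel_measurable borel"
    "\<And>b x. b \<in> Basis \<Longrightarrow> 0 \<le> q b x"
    "\<And>b. b \<in> Basis \<Longrightarrow> interval_measure (\<lambda>x. (1/2) * (F x + b \<bullet> H x)) = density ?M (\<lambda>x. ennreal (q b x))"
    "\<And>b. b \<in> Basis \<Longrightarrow> distr_fun01 (\<lambda>x. (1/2) * (F x + b \<bullet> H x))" by auto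
  have qi: "integrable ?M (q b)" if "b \<in> Basis" for b
    by (rule integrable_q(1)[OF q(4) q(1) q(2) q(3)]) (rule that)+
  have qm: "(LINT s:{..x}|?M. q b s) = (1/2) * (F x + b \<bullet> H x)" if "b \<in> Basis" for b x
    using integrable_q(2)[OF q(4)[OF that] q(1)[OF that] q(2)[OF that] q(3)[OF that], of "{..x}"]
      distr_fun01.measure_le[OF q(4)[OF that], of x] by simp
  define g where "g s = (\<Sum>b\<in>Basis. (2 * q b s - 1) *\<^sub>R b)" for s
  have gb: "g \<in> borel_measurable borel"
    unfolding g_def using q(1) by (intro borel_measurable_sum borel_measurable_scaleR borel_measurable_diff borel_measurable_times) auto
  have gi: "integrable ?M g"
    unfolding g_def using qi by (intro Bochner_Integration.integrable_sum integrable_scaleR_left Bochner_Integration.integrable_diff Bochner_Integration.integrable_mult_right) auto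
  have gH: "(LINT s:{..x}|?M. g s) = H x" for x
  proof (rule euclidean_eqI)
    fix b :: 'a assume b: "b \<in> Basis"
    have si: "integrable ?M (\<lambda>s. indicator {..x} s *\<^sub>R g s)"
      using set_integrable_of_integrable[OF gi, of "{..x}"] by (simp add: set_integrable_def)
    have "(LINT s:{..x}|?M. g s) \<bullet> b = (LINT s|?M. (indicator {..x} s *\<^sub>R g s) \<bullet> b)"
      unfolding set_lebesgue_integral_def by (rule integral_inner_left[symmetric]) (use si in simp)
    also have "\<dots> = (LINT s:{..x}|?M. 2 * q b s - 1)"
      unfolding set_lebesgue_integral_def g_def using b
      by (intro Bochner_Integration.integral_cong) (auto simp: inner_sum_left inner_Basis if_distrib cong: if_cong)
    also have "\<dots> = 2 * (LINT s:{..x}|?M. q b s) - (LINT s:{..x}|?M. 1)"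
      using set_integrable_of_integrable[OF qi[OF b], of "{..x}"]
      by (subst set_integral_diff) (auto simp: set_integrable_of_integrable)
    also have "\<dots> = H x \<bullet> b"
      using qm[OF b, of x] by (simp add: set_integral_const_one[OF finite] measure_le inner_commute)
    finally show "(LINT s:{..x}|?M. g s) \<bullet> b = H x \<bullet> b" .
  qed
  have ub: "AE x in ?M. 0 \<le> norm u - u \<bullet> g x" for u
  proof (rule AE_nonneg_of_set_integral)
    show int: "integrable ?M (\<lambda>x. norm u - u \<bullet> g x)" using gi by auto
    have d: "distr_fun01 (\<lambda>x. norm u * F x - u \<bullet> H x)"
    proof
      show "right_cont01 (\<lambda>x. norm u * F x - u \<bullet> H x)" by (intro right_cont01_cmult right_cont01_diff right_cont01_inner rc H)
      show "norm u * F x - u \<bullet> H x \<le> norm u * F y - u \<bullet> H y" if "x \<le> y" for x y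
        using ip[OF that, of u] by (simp add: abs_le_iff algebra_simps)
    qed
    have "(LINT s:{..x}|?M. norm u - u \<bullet> g s) = norm u * F x - u \<bullet> H x" for x
    proof -
      have si: "integrable ?M (\<lambda>s. indicator {..x} s *\<^sub>R g s)"
        using set_integrable_of_integrable[OF gi, of "{..x}"] by (simp add: set_integrable_def)
      have "(LINT s:{..x}|?M. norm u - u \<bullet> g s) = (LINT s|?M. norm u * indicator {..x} s - u \<bullet> (indicator {..x} s *\<^sub>R g s))"
        unfolding set_lebesgue_integral_def
        by (intro Bochner_Integration.integral_cong) (auto simp: algebra_simps)
      also have "\<dots> = norm u * F x - u \<bullet> (LINT s:{..x}|?M. g s)"
      proof (subst Bochner_Integration.integral_diff)
        show "integrable ?M (\<lambda>s. u \<bullet> (indicator {..x} s *\<^sub>R g s))" by (rule integrable_inner_right) (use si in simp)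
        have "(LINT s|?M. u \<bullet> (indicator {..x} s *\<^sub>R g s)) = u \<bullet> (LINT s:{..x}|?M. g s)"
          unfolding set_lebesgue_integral_def by (rule integral_inner_right) (use si in simp)
        then show "(LINT s|?M. norm u * indicator {..x} s) - (LINT s|?M. u \<bullet> (indicator {..x} s *\<^sub>R g s))
            = norm u * F x - u \<bullet> (LINT s:{..x}|?M. g s)"
          by (simp add: measure_le)
      qed (auto simp: less_top[symmetric])
      finally show ?thesis by (simp add: gH)
    qed
    then show "0 \<le> (LINT s:B|?M. norm u - u \<bullet> g s)" if "B \<in> sets ?M" for B
      using distr_fun01.sigma_additive_nonneg[OF d sigma_additive_set_integral[OF sets_interval_measure int]] that by auto
  qed
  \<comment> \<open>The exceptional null set depends on \<open>u\<close>; a countable dense set of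
    vectors leaves a single null set, and continuity in \<open>u\<close> then permits the choice
    \<open>u = g x\<close>.\<close>
  obtain D :: "'a set" where D: "countable D" "D \<subseteq> UNIV" "UNIV \<subseteq> closure D"
    by (rule separable)
  have "AE x in ?M. \<forall>u\<in>D. 0 \<le> norm u - u \<bullet> g x"
    using D(1) ub by (simp add: AE_ball_countable)
  then have "AE x in ?M. norm (g x) \<le> 1"
  proof eventually_elim
    fix x assume x: "\<forall>u\<in>D. 0 \<le> norm u - u \<bullet> g x"
    have "g x \<in> closure D" using D by auto
    then have "0 \<le> norm (g x) - g x \<bullet> g x"
      by (rule continuous_ge_on_closure[rotated]) (use x in \<open>auto intro!: continuous_intros\<close>)
    then have "norm (g x) * norm (g x) \<le> norm (g x) * 1" by (simp add: dot_square_norm power2_eq_square)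
    then show "norm (g x) \<le> 1" by (cases "g x = 0") auto
  qed
  with gb gi gH show thesis by (rule that)
qed

lemma norm_set_integral_le_measure:
  fixes g :: "real \<Rightarrow> 'a::euclidean_space"
  assumes "finite_measure M" "sets M = sets borel" "integrable M g" "AE x in M. norm (g x) \<le> 1" "B \<in> sets borel"
  shows "norm (LINT s:B|M. g s) \<le> measure M B"
proof -
  interpret finite_measure M by fact
  have [measurable]: "B \<in> sets M" using assms by simp
  have int: "integrable M (\<lambda>s. indicator B s *\<^sub>R g s)" using assms by (intro integrable_mult_indicator) auto
  have "norm (LINT s:B|M. g s) \<le> (LINT s|M. norm (indicator B s *\<^sub>R g s))"
    unfolding set_lebesgue_integral_def by (rule integral_norm_bound)
  also have "\<dots> \<le> (LINT s|M. indicator B s)"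
  proof (rule integral_mono_AE)
    show "integrable M (\<lambda>s. indicator B s :: real)" by (rule integrable_real_indicator) (auto simp: less_top[symmetric])
    show "AE s in M. norm (indicator B s *\<^sub>R g s) \<le> indicator B s"
      using assms(4) by eventually_elim (auto simp: indicator_def)
    show "integrable M (\<lambda>s. norm (indicator B s *\<^sub>R g s))" by (rule integrable_norm[OF int])
  qed
  also have "\<dots> = measure M B" using sets.sets_into_space[OF \<open>B \<in> sets M\<close>] by (simp add: Int_absorb2)
  finally show ?thesis .
qed

lemma (in bounded_rate) distr_fun01_rate_upto: "distr_fun01 (rate_upto S H)"
  using right_cont01_rate_upto rate_upto_mono by unfold_locales

text \<open>Polar decomposition. The integral of \<open>norm g\<close> over \<open>{..x}\<close>
  dominates the increments of \<open>H\<close>, so minimality puts the total variation below the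
  full integral of \<open>norm g\<close>; since \<open>norm g \<le> 1\<close>, equality must hold
  almost everywhere.\<close>

lemma variation_density:
  fixes H :: "real \<Rightarrow> 'a::euclidean_space"
  assumes "bounded_rate var_set H"
  obtains g where "g \<in> borel_measurable borel" "integrable (interval_measure (rate_upto var_set H)) g"
    "\<And>x. (LINT s:{..x}|interval_measure (rate_upto var_set H). g s) = H x"
    "AE x in interval_measure (rate_upto var_set H). norm (g x) = 1"
proof -
  interpret bounded_rate var_set H by fact
  interpret distr_fun01 "rate_upto var_set H" by (rule distr_fun01_rate_upto)
  let ?M = "interval_measure (rate_upto var_set H)"
  interpret finite_measure ?M by (rule finite)
  obtain g where g: "g \<in> borel_measurable borel" "integrable ?M g"
    "\<And>x. (LINT s:{..x}|?M. g s) = H x" "AE x in ?M. norm (g x) \<le> 1"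
    using vector_density[OF bounded_rate.rc[OF assms] norm_diff_le_rate_upto[OF refl]] by blast
  let ?P = "\<lambda>B. LINT s:B|?M. norm (g s)"
  have ng: "integrable ?M (\<lambda>s. norm (g s))" using g(2) by simp
  have cP: "sigma_additive ?P" by (rule sigma_additive_set_integral[OF _ ng]) simp
  have cg: "sigma_additive (\<lambda>B. LINT s:B|?M. g s)" by (rule sigma_additive_set_integral[OF _ g(2)]) simp
  have "rate_upto var_set H 1 \<le> ?P {..1}"
  proof (rule rate_upto_least)
    show "0 \<le> ?P {..x}" for x
      unfolding set_lebesgue_integral_def by (intro integral_nonneg_AE) auto
    fix a b :: real and u :: 'a and k assume ab: "a < b" "(u, k) \<in> var_set"
    show "?P {..a} + (u \<bullet> (H b - H a) - k * (clamp01 b - clamp01 a)) \<le> ?P {..b}"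
    proof (rule var_set_step_le[OF _ ab])
      fix a b :: real assume "a < b"
      then have e: "{..b} - {..a} = {a<..b}" "{..a} \<subseteq> {..b}" by auto
      have "norm (H b - H a) = norm (LINT s:{a<..b}|?M. g s)"
        using sigma_additive_Diff[OF cg, of "{..b}" "{..a}"] e by (simp add: g(3))
      also have "\<dots> \<le> ?P {a<..b}"
        unfolding set_lebesgue_integral_def by (rule order_trans[OF integral_norm_bound]) (simp add: abs_mult)
      also have "\<dots> = ?P {..b} - ?P {..a}"
        using sigma_additive_Diff[OF cP, of "{..b}" "{..a}"] e by simp
      finally show "norm (H b - H a) \<le> ?P {..b} - ?P {..a}" .
    qed
  qed
  also have "?P {..1} \<le> (LINT s|?M. norm (g s))"
    unfolding set_lebesgue_integral_def using ng
    by (intro integral_mono integrable_mult_indicator) (auto simp: indicator_def)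
  finally have le: "(LINT s|?M. 1 - norm (g s)) \<le> 0"
    using ng by (simp add: measure_UNIV)
  have nn: "AE s in ?M. 0 \<le> 1 - norm (g s)" using g(4) by eventually_elim simp
  have "(LINT s|?M. 1 - norm (g s)) = 0" using le integral_nonneg_AE[OF nn] by linarith
  then have "AE s in ?M. 1 - norm (g s) = 0"
    by (subst (asm) integral_nonneg_eq_0_iff_AE[OF _ nn]) (use ng in auto)
  then have "AE s in ?M. norm (g s) = 1" by eventually_elim simp
  with g(1-3) show thesis by (rule that)
qed

lemma interval_measure_clamp01: "interval_measure clamp01 = density lborel (\<lambda>x. ennreal (indicator {0..1} x))"
proof (rule measure_eqI)
  fix A assume "A \<in> sets (interval_measure clamp01)"
  then have A[measurable]: "A \<in> sets borel" by simp
  have "emeasure (density lborel (\<lambda>x. ennreal (indicator {0..1} x))) A = (\<integral>\<^sup>+x. indicator (A \<inter> {0..1}) x \<partial>lborel)"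
    by (subst emeasure_density) (auto intro!: nn_integral_cong simp del: nn_integral_indicator split: split_indicator)
  then show "emeasure (interval_measure clamp01) A = emeasure (density lborel (\<lambda>x. ennreal (indicator {0..1} x))) A"
    by (simp add: emeasure_clamp01)
qed simp

text \<open>The measure of \<open>F\<close> and Lebesgue measure on \<open>[0, 1]\<close> have
  densities \<open>p\<close> and \<open>q\<close> with respect to their sum. The singular part sits
  where \<open>q\<close> vanishes; elsewhere the density is \<open>p / q\<close>.\<close>

lemma (in distr_fun01) lebesgue_decomposition:
  obtains N \<phi> where "N \<in> sets borel" "emeasure lborel N = 0" "\<phi> \<in> borel_measurable borel" "\<And>x. 0 \<le> \<phi> x" "\<And>x. x \<notin> {0..1} \<Longrightarrow> \<phi> x = 0"
    "density (interval_measure F) (\<lambda>x. ennreal (indicator (- N) x)) = density lborel (\<lambda>x. ennreal (\<phi> x))"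
proof -
  define G where "G x = F x + clamp01 x" for x
  interpret T: distr_fun01 clamp01 by (rule distr_fun01_clamp01)
  interpret G: distr_fun01 G
    unfolding G_def using right_cont01_add[OF rc T.rc] by unfold_locales (auto intro: add_mono mono T.mono)
  obtain p where p: "p \<in> borel_measurable borel" "\<And>x. 0 \<le> p x" "interval_measure F = density (interval_measure G) (\<lambda>x. ennreal (p x))"
    by (rule G.dominated_density[OF distr_fun01_axioms]) (auto simp: G_def T.mono)
  obtain q where q: "q \<in> borel_measurable borel" "\<And>x. 0 \<le> q x" "interval_measure clamp01 = density (interval_measure G) (\<lambda>x. ennreal (q x))"
    by (rule G.dominated_density[OF distr_fun01_clamp01]) (auto simp: G_def mono)
  note [measurable] = p(1) q(1)
  define N0 where "N0 = {x. q x = 0}"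
  have N0[measurable]: "N0 \<in> sets borel" unfolding N0_def by measurable
  have "emeasure (interval_measure clamp01) N0 = 0"
    unfolding q(3) by (subst emeasure_density) (auto simp: N0_def nn_integral_0_iff_AE indicator_def)
  \<comment> \<open>Only the part of the zero set of \<open>q\<close> inside \<open>[0, 1]\<close>
    is known to be Lebesgue null; outside, \<open>F\<close> carries no mass, so intersecting loses
    nothing.\<close>
  then have N: "emeasure lborel (N0 \<inter> {0..1}) = 0" by (simp add: emeasure_clamp01)
  define \<phi> where "\<phi> x = indicator {0..1} x * (p x / q x)" for x
  have "density (interval_measure F) (\<lambda>x. ennreal (indicator (- (N0 \<inter> {0..1})) x))
      = density (interval_measure F) (\<lambda>x. ennreal (indicator (- N0) x))"
  proof (intro density_cong)
    show "AE x in interval_measure F. ennreal (indicator (- (N0 \<inter> {0..1})) x) = ennreal (indicator (- N0) x)"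
      using AE_01 by eventually_elim (auto simp: indicator_def)
  qed auto
  also have "\<dots> = density (interval_measure G) (\<lambda>x. ennreal (p x) * ennreal (indicator (- N0) x))"
    unfolding p(3) by (rule density_density_eq) auto
  also have "\<dots> = density (interval_measure G) (\<lambda>x. ennreal (q x) * ennreal (p x / q x))"
  proof (intro density_cong)
    show "AE x in interval_measure G. ennreal (p x) * ennreal (indicator (- N0) x) = ennreal (q x) * ennreal (p x / q x)"
      using p(2) q(2) by (intro AE_I2) (auto simp: N0_def indicator_def ennreal_mult'[symmetric])
  qed auto
  also have "\<dots> = density (interval_measure clamp01) (\<lambda>x. ennreal (p x / q x))"
    unfolding q(3) by (rule density_density_eq[symmetric]) auto
  also have "\<dots> = density lborel (\<lambda>x. ennreal (indicator {0..1} x) * ennreal (p x / q x))"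
    unfolding interval_measure_clamp01 by (rule density_density_eq) auto
  also have "\<dots> = density lborel (\<lambda>x. ennreal (\<phi> x))"
    by (simp add: \<phi>_def ennreal_mult'[symmetric])
  finally have "density (interval_measure F) (\<lambda>x. ennreal (indicator (- (N0 \<inter> {0..1})) x)) = density lborel (\<lambda>x. ennreal (\<phi> x))" .
  moreover have "\<phi> \<in> borel_measurable borel" unfolding \<phi>_def by measurable
  ultimately show thesis
    by (intro that[of "N0 \<inter> {0..1}" \<phi>]) (use N p(2) q(2) in \<open>auto simp: \<phi>_def\<close>)
qed

section \<open>Differentiation almost everywhere\<close>

text \<open>By outer regularity some open \<open>U\<close> containing \<open>A\<close> has small
  \<nu>-measure. Vitali's theorem covers almost all of the exceptional set by disjoint intervals
  inside \<open>U\<close> whose lengths are at most \<open>2 / c\<close> times their \<nu>-measures,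
  so their total length is small.\<close>

lemma negligible_large_density:
  fixes \<nu> :: "real measure"
  assumes fin: "finite_measure \<nu>" and sets: "sets \<nu> = sets borel" and A: "A \<in> sets borel" "emeasure \<nu> A = 0" and c: "0 < c"
  shows "negligible {x\<in>A. \<forall>d>0. \<exists>r. 0 < r \<and> r < d \<and> c * r < measure \<nu> (cball x r)}" (is "negligible ?E")
  unfolding negligible_outer_le
proof (intro allI impI)
  fix e :: real assume e: "0 < e"
  define E where "E = ?E"
  interpret finite_measure \<nu> by fact
  have cb: "cball x r \<in> sets \<nu>" "cball x r \<in> sets borel" for x r :: real using sets by auto
  \<comment> \<open>The factor \<open>2 / c\<close> between length and \<nu>-measure turns this into
    the bound \<open>e\<close>.\<close>
  define \<epsilon> where "\<epsilon> = ennreal (e * c / 2)"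
  have \<epsilon>: "0 < \<epsilon>" using e c by (simp add: \<epsilon>_def)
  have "emeasure \<nu> (space \<nu>) \<noteq> \<infinity>" by simp
  from outer_regular[OF sets this A(1)]
  have "(INF U\<in>{U. A \<subseteq> U \<and> open U}. emeasure \<nu> U) < \<epsilon>"
    using A(2) \<epsilon> by simp
  then obtain U where U: "A \<subseteq> U" "open U" "emeasure \<nu> U < \<epsilon>"
    unfolding INF_less_iff by blast
  have Us: "U \<in> sets \<nu>" using U sets by auto
  define K where "K = {(x, r). 0 < r \<and> cball x r \<subseteq> U \<and> c * r < measure \<nu> (cball x r)}"
  have vit: "\<exists>i. i \<in> K \<and> x \<in> cball (fst i) (snd i) \<and> snd i < d" if "x \<in> E" "0 < d" for x d
  proof -
    have xE: "x \<in> A" "\<forall>d>0. \<exists>r. 0 < r \<and> r < d \<and> c * r < measure \<nu> (cball x r)"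
      using that(1) by (simp_all add: E_def)
    then have "x \<in> U" using U(1) by auto
    then obtain d' where d': "0 < d'" "cball x d' \<subseteq> U" using U(2) unfolding open_contains_cball by auto
    have "0 < min d d'" using that(2) d'(1) by simp
    then obtain r where r: "0 < r" "r < min d d'" "c * r < measure \<nu> (cball x r)"
      using xE(2)[rule_format, of "min d d'"] by auto
    have "cball x r \<subseteq> cball x d'" using r(2) by (intro subset_cball) simp
    then have "cball x r \<subseteq> U" using d'(2) by (rule order_trans)
    then show ?thesis using r by (intro exI[of _ "(x, r)"]) (simp add: K_def)
  qed
  obtain C where C: "countable C" "C \<subseteq> K" "pairwise (\<lambda>i j. disjnt (cball (fst i) (snd i)) (cball (fst j) (snd j))) C"
     "negligible (E - (\<Union>i\<in>C. cball (fst i) (snd i)))"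
  proof (rule Vitali_covering_theorem_cballs[of K snd E fst, OF _ vit])
    show "0 < snd i" if "i \<in> K" for i using that by (auto simp: K_def)
  qed
  let ?B = "\<lambda>i. cball (fst i) (snd i)"
  have dis: "disjoint_family_on ?B C"
    using C(3) by (auto simp: disjoint_family_on_def pairwise_def disjnt_def)
  have "emeasure lborel (\<Union>i\<in>C. ?B i) = (\<integral>\<^sup>+i. emeasure lborel (?B i) \<partial>count_space C)"
    using C(1) dis by (intro emeasure_UN_countable) auto
  also have "\<dots> \<le> (\<integral>\<^sup>+i. ennreal (2 / c) * emeasure \<nu> (?B i) \<partial>count_space C)"
  proof (rule nn_integral_mono)
    fix i assume "i \<in> space (count_space C)"
    then have i: "0 < snd i" "c * snd i < measure \<nu> (?B i)" using C(2) by (auto simp: K_def)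
    have "emeasure lborel (?B i) = ennreal (2 * snd i)"
      using i by (simp add: cball_eq_atLeastAtMost)
    also have "\<dots> \<le> ennreal (2 / c * measure \<nu> (?B i))"
      using i c by (intro ennreal_leI) (simp add: field_simps)
    also have "\<dots> = ennreal (2 / c) * emeasure \<nu> (?B i)"
      unfolding emeasure_eq_measure using c by (intro ennreal_mult) auto
    finally show "emeasure lborel (?B i) \<le> ennreal (2 / c) * emeasure \<nu> (?B i)" .
  qed
  also have "\<dots> = ennreal (2 / c) * emeasure \<nu> (\<Union>i\<in>C. ?B i)"
    using C(1) dis cb by (simp add: nn_integral_cmult emeasure_UN_countable)
  also have "\<dots> \<le> ennreal (2 / c) * emeasure \<nu> U"
  proof (intro mult_left_mono emeasure_mono Us UN_least)
    show "?B i \<subseteq> U" if "i \<in> C" for i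
    proof -
      have "i \<in> K" using that C(2) by blast
      then show ?thesis by (simp add: K_def split_beta)
    qed
  qed simp
  also have "\<dots> \<le> ennreal (2 / c) * \<epsilon>"
    using U(3) by (intro mult_left_mono) auto
  also have "\<dots> = ennreal e"
    using e c by (simp add: \<epsilon>_def ennreal_mult'[symmetric])
  finally have le: "emeasure lborel (\<Union>i\<in>C. ?B i) \<le> ennreal e" .
  let ?Z = "E - (\<Union>i\<in>C. ?B i)"
  have B: "(\<Union>i\<in>C. ?B i) \<in> sets borel" using C(1) by (intro sets.countable_UN') auto
  then have eB: "emeasure lebesgue (\<Union>i\<in>C. ?B i) = emeasure lborel (\<Union>i\<in>C. ?B i)" by simp
  have lm: "(\<Union>i\<in>C. ?B i) \<in> lmeasurable"
  proof (rule fmeasurableI)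
    show "emeasure lebesgue (\<Union>i\<in>C. ?B i) < \<infinity>" unfolding eB using le by (auto simp: less_top[symmetric] top_unique)
  qed (use B in auto)
  have Z: "?Z \<in> lmeasurable" "measure lebesgue ?Z = 0" using C(4) by (auto simp: negligible_iff_measure)
  have "measure lebesgue (?Z \<union> (\<Union>i\<in>C. ?B i)) \<le> measure lebesgue ?Z + measure lebesgue (\<Union>i\<in>C. ?B i)"
    using Z lm by (intro measure_Un_le) auto
  also have "\<dots> \<le> e"
    using Z(2) le e unfolding measure_def eB by (simp add: enn2real_leI)
  finally show "\<exists>T. ?E \<subseteq> T \<and> T \<in> lmeasurable \<and> measure lebesgue T \<le> e"
    unfolding E_def[symmetric] using fmeasurable.Un[OF Z(1) lm]
    by (intro exI[of _ "?Z \<union> (\<Union>i\<in>C. ?B i)"] conjI) blast+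
qed


lemma AE_lborel_of_negligible:
  assumes "negligible {x. \<not> P x}"
  shows "AE x in lborel. P x"
proof -
  have "AE x in lebesgue. x \<notin> {x. \<not> P x}"
    using assms by (intro AE_not_in) (simp add: negligible_iff_null_sets)
  then show ?thesis by (simp add: AE_completion_iff)
qed

text \<open>The exceptional null set depends on \<open>c\<close>, so the countably many values
  \<open>1 / real (Suc n)\<close> are treated first.\<close>

lemma AE_singular_density_zero:
  fixes \<nu> :: "real measure"
  assumes fin: "finite_measure \<nu>" and sets: "sets \<nu> = sets borel"
    and N: "N \<in> sets borel" "emeasure lborel N = 0" "emeasure \<nu> (- N) = 0"
  shows "AE x in lborel. \<forall>c>0. \<exists>d>0. \<forall>r. 0 < r \<longrightarrow> r < d \<longrightarrow> measure \<nu> (cball x r) \<le> c * r"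
proof -
  define E where "E c = {x\<in>-N. \<forall>d>0. \<exists>r. 0 < r \<and> r < d \<and> c * r < measure \<nu> (cball x r)}" for c
  have "AE x in lborel. x \<notin> E (1 / real (Suc n))" for n
  proof (rule AE_lborel_of_negligible)
    have "negligible (E (1 / real (Suc n)))"
      unfolding E_def by (rule negligible_large_density[OF fin sets]) (use N in auto)
    then show "negligible {x. \<not> x \<notin> E (1 / real (Suc n))}" by simp
  qed
  then have "AE x in lborel. \<forall>n. x \<notin> E (1 / real (Suc n))" by (simp only: AE_all_countable) blast
  moreover have "AE x in lborel. x \<notin> N" by (rule AE_not_in) (use N in \<open>auto simp: null_sets_def\<close>)
  ultimately show ?thesis
  proof eventually_elim
    fix x assume x: "\<forall>n. x \<notin> E (1 / real (Suc n))" "x \<notin> N"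
    show "\<forall>c>0. \<exists>d>0. \<forall>r. 0 < r \<longrightarrow> r < d \<longrightarrow> measure \<nu> (cball x r) \<le> c * r"
    proof (intro allI impI)
      fix c :: real assume "0 < c"
      then obtain n where n: "1 / real (Suc n) < c" using nat_approx_posE by blast
      have "x \<notin> E (1 / real (Suc n))" using x(1) by blast
      then obtain d where d: "0 < d" "\<forall>r. \<not> (0 < r \<and> r < d \<and> 1 / real (Suc n) * r < measure \<nu> (cball x r))"
        using x(2) unfolding E_def by blast
      have "measure \<nu> (cball x r) \<le> c * r" if "0 < r" "r < d" for r
        using d(2)[rule_format, of r] mult_right_mono[OF less_imp_le[OF n], of r] that by linarith
      then show "\<exists>d>0. \<forall>r. 0 < r \<longrightarrow> r < d \<longrightarrow> measure \<nu> (cball x r) \<le> c * r" using d(1) by blast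
    qed
  qed
qed

lemma has_vector_derivative_at_alt:
  fixes f :: "real \<Rightarrow> 'a::real_normed_vector"
  shows "(f has_vector_derivative D) (at x) \<longleftrightarrow>
    (\<forall>e>0. \<exists>d>0. \<forall>y. \<bar>y - x\<bar> < d \<longrightarrow> norm (f y - f x - (y - x) *\<^sub>R D) \<le> e * \<bar>y - x\<bar>)"
  unfolding has_vector_derivative_def has_derivative_at_alt
  by (simp add: bounded_linear_scaleR_left)

text \<open>An increment over an interval ending or starting at \<open>x\<close> is at most the
  \<nu>-measure of a closed ball around \<open>x\<close>, which for almost every \<open>x\<close> is
  small compared with its radius.\<close>

lemma AE_singular_derivative_zero:
  fixes H :: "real \<Rightarrow> 'a::real_normed_vector"
  assumes fin: "finite_measure \<nu>" and sets: "sets \<nu> = sets borel"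
    and N: "N \<in> sets borel" "emeasure lborel N = 0" "emeasure \<nu> (- N) = 0"
    and H: "\<And>a b. a \<le> b \<Longrightarrow> norm (H b - H a) \<le> measure \<nu> {a<..b}"
  shows "AE x in lborel. (H has_vector_derivative 0) (at x)"
  using AE_singular_density_zero[OF fin sets N]
proof eventually_elim
  fix x assume x: "\<forall>c>0. \<exists>d>0. \<forall>r. 0 < r \<longrightarrow> r < d \<longrightarrow> measure \<nu> (cball x r) \<le> c * r"
  interpret finite_measure \<nu> by fact
  have le: "norm (H y - H x) \<le> measure \<nu> (cball x \<bar>y - x\<bar>)" for y
  proof (cases "x \<le> y")
    case True
    have "measure \<nu> {x<..y} \<le> measure \<nu> (cball x \<bar>y - x\<bar>)"
      using sets True by (intro finite_measure_mono) (auto simp: dist_real_def)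
    then show ?thesis using H[OF True] by linarith
  next
    case False
    have "measure \<nu> {y<..x} \<le> measure \<nu> (cball x \<bar>y - x\<bar>)"
      using sets False by (intro finite_measure_mono) (auto simp: dist_real_def)
    then show ?thesis using H[of y x] False by (simp add: norm_minus_commute)
  qed
  show "(H has_vector_derivative 0) (at x)"
    unfolding has_vector_derivative_at_alt
  proof (intro allI impI)
    fix e :: real assume "0 < e"
    then obtain d where d: "0 < d" "\<forall>r. 0 < r \<longrightarrow> r < d \<longrightarrow> measure \<nu> (cball x r) \<le> e * r"
      using x by blast
    have "norm (H y - H x - (y - x) *\<^sub>R 0) \<le> e * \<bar>y - x\<bar>" if "\<bar>y - x\<bar> < d" for y
      using le[of y] d(2)[rule_format, of "\<bar>y - x\<bar>"] that by (cases "y = x") auto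
    then show "\<exists>d>0. \<forall>y. \<bar>y - x\<bar> < d \<longrightarrow> norm (H y - H x - (y - x) *\<^sub>R 0) \<le> e * \<bar>y - x\<bar>"
      using d(1) by blast
  qed
qed

section \<open>Lebesgue differentiation and measurability of the pointwise derivative\<close>

lemma set_integral_atMost_diff:
  fixes f :: "real \<Rightarrow> 'a::euclidean_space"
  assumes f: "integrable lborel f" and ab: "a \<le> b"
  shows "(LINT s:{..b}|lborel. f s) - (LINT s:{..a}|lborel. f s) = integral {a..b} f"
proof -
  have c: "sigma_additive (\<lambda>B. LINT x:B|lborel. f x)" by (rule sigma_additive_set_integral[OF _ f]) simp
  have "{..b} - {..a} = {a<..b}" by auto
  then have "(LINT s:{..b}|lborel. f s) - (LINT s:{..a}|lborel. f s) = (LINT s:{a<..b}|lborel. f s)"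
    using sigma_additive_Diff[OF c, of "{..b}" "{..a}"] ab by simp
  also have "\<dots> = (LINT s:{a..b}|lborel. f s)"
    unfolding set_lebesgue_integral_def
  proof (rule integral_cong_AE)
    have "AE s in lborel. s \<noteq> a" by (rule AE_lborel_singleton)
    then show "AE s in lborel. indicator {a<..b} s *\<^sub>R f s = indicator {a..b} s *\<^sub>R f s"
      by eventually_elim (auto simp: indicator_def)
  qed (use f in auto)
  also have "\<dots> = integral {a..b} f"
    by (intro set_borel_integral_eq_integral set_integrable_of_integrable f) auto
  finally show ?thesis .
qed

text \<open>The differentiation theorem for boxes with lower corner at \<open>x\<close> yields the
  right derivative; the left one is the right derivative for the reflected function.\<close>

lemma AE_lebesgue_differentiation:
  fixes f :: "real \<Rightarrow> 'a::euclidean_space"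
  assumes f: "integrable lborel f"
  shows "AE x in lborel. ((\<lambda>x. LINT s:{..x}|lborel. f s) has_vector_derivative f x) (at x)"
proof -
  define A where "A x = (LINT s:{..x}|lborel. f s)" for x
  let ?f' = "\<lambda>x. f (- x)"
  have int: "f integrable_on cbox a b" for a b
    using set_borel_integral_eq_integral(1)[OF set_integrable_of_integrable[OF f, of "cbox a b"]] by simp
  have int': "?f' integrable_on cbox a b" for a b
    using int[of "- b" "- a"] Henstock_Kurzweil_Integration.integrable_reflect_real[where f = f and a = "- b" and b = "- a"] by simp
  obtain N1 where N1: "negligible N1" and N1': "\<And>x e. \<lbrakk>x \<notin> N1; 0 < e\<rbrakk> \<Longrightarrow>
      \<exists>d>0. \<forall>h. 0 < h \<and> h < d \<longrightarrow> norm (integral (cbox x (x + h *\<^sub>R One)) f /\<^sub>R h ^ DIM(real) - f x) < e"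
    by (rule integrable_ccontinuous_explicit[OF int], rule that, assumption, blast)
  obtain N2 where N2: "negligible N2" and N2': "\<And>x e. \<lbrakk>x \<notin> N2; 0 < e\<rbrakk> \<Longrightarrow>
      \<exists>d>0. \<forall>h. 0 < h \<and> h < d \<longrightarrow> norm (integral (cbox x (x + h *\<^sub>R One)) ?f' /\<^sub>R h ^ DIM(real) - ?f' x) < e"
    by (rule integrable_ccontinuous_explicit[OF int'], rule that, assumption, blast)
  have "negligible (uminus ` N2)"
  proof (rule negligible_locally_Lipschitz_image[OF order_refl N2])
    show "\<exists>T B. open T \<and> x \<in> T \<and> (\<forall>y\<in>N2 \<inter> T. norm (- y - - x) \<le> B * norm (y - x))" for x :: real
      by (intro exI[of _ UNIV] exI[of _ 1]) auto
  qed
  with N1 have neg: "negligible (N1 \<union> uminus ` N2)" by (rule negligible_Un)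
  have nr: "norm (v - h *\<^sub>R w) \<le> e * h" if "norm (v /\<^sub>R h - w) < e" "0 < h" for v w :: 'a and e h
  proof -
    have "norm (v - h *\<^sub>R w) = norm (h *\<^sub>R (v /\<^sub>R h - w))"
      using that by (simp add: scaleR_diff_right)
    also have "\<dots> = h * norm (v /\<^sub>R h - w)" using that(2) by simp
    also have "\<dots> \<le> h * e" using that by (intro mult_left_mono) auto
    finally show ?thesis by (simp add: mult.commute)
  qed
  have AA: "A b - A a = integral {a..b} f" if "a \<le> b" for a b
    unfolding A_def by (rule set_integral_atMost_diff[OF f that])
  have "(A has_vector_derivative f x) (at x)" if x: "x \<notin> N1 \<union> uminus ` N2" for x
    unfolding has_vector_derivative_at_alt
  proof (intro allI impI)
    fix e :: real assume e: "0 < e"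
    have "- x \<notin> N2"
    proof
      assume "- x \<in> N2"
      then have "- (- x) \<in> uminus ` N2" by (rule imageI)
      with x show False by simp
    qed
    from N2'[OF this e] obtain d2 where d2: "0 < d2"
      "\<forall>h. 0 < h \<and> h < d2 \<longrightarrow> norm (integral {-x..-x + h} ?f' /\<^sub>R h - f x) < e"
      by (auto simp: cbox_interval)
    from x have "x \<notin> N1" by simp
    from N1'[OF this e] obtain d1 where d1: "0 < d1"
      "\<forall>h. 0 < h \<and> h < d1 \<longrightarrow> norm (integral {x..x + h} f /\<^sub>R h - f x) < e"
      by (auto simp: cbox_interval)
    have "norm (A y - A x - (y - x) *\<^sub>R f x) \<le> e * \<bar>y - x\<bar>" if y: "\<bar>y - x\<bar> < min d1 d2" for y
    proof -
      consider "y = x" | "x < y" | "y < x" by linarith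
      then show ?thesis
      proof cases
        case 2
        have "norm (integral {x..x + (y - x)} f /\<^sub>R (y - x) - f x) < e"
          using 2 y by (intro d1(2)[rule_format]) auto
        from nr[OF this] 2 have "norm (integral {x..y} f - (y - x) *\<^sub>R f x) \<le> e * (y - x)" by simp
        then show ?thesis using 2 by (simp add: AA)
      next
        case 3
        have "norm (integral {-x..-x + (x - y)} ?f' /\<^sub>R (x - y) - f x) < e"
          using 3 y by (intro d2(2)[rule_format]) auto
        moreover have "integral {-x..-y} ?f' = integral {y..x} f" by (rule Henstock_Kurzweil_Integration.integral_reflect_real)
        ultimately have "norm (integral {y..x} f /\<^sub>R (x - y) - f x) < e" by simp
        from nr[OF this] 3 have *: "norm (integral {y..x} f - (x - y) *\<^sub>R f x) \<le> e * (x - y)" by simp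
        have "A y - A x - (y - x) *\<^sub>R f x = - (integral {y..x} f - (x - y) *\<^sub>R f x)"
          using AA[of y x] 3 by (simp add: algebra_simps)
        then have "norm (A y - A x - (y - x) *\<^sub>R f x) = norm (integral {y..x} f - (x - y) *\<^sub>R f x)"
          by (simp only: norm_minus_cancel)
        with * 3 show ?thesis by simp
      qed simp
    qed
    then show "\<exists>d>0. \<forall>y. \<bar>y - x\<bar> < d \<longrightarrow> norm (A y - A x - (y - x) *\<^sub>R f x) \<le> e * \<bar>y - x\<bar>"
      using d1(1) d2(1) by (intro exI[of _ "min d1 d2"]) auto
  qed
  then have "{x. \<not> (A has_vector_derivative f x) (at x)} \<subseteq> N1 \<union> uminus ` N2" by blast
  then have "AE x in lborel. (A has_vector_derivative f x) (at x)"
    using neg by (intro AE_lborel_of_negligible) (rule negligible_subset)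
  then show ?thesis unfolding A_def .
qed

lemma rational_at_right:
  fixes r :: real
  assumes "\<forall>\<^sub>F y in at_right r. P y"
  shows "\<exists>s::rat. r < of_rat s \<and> P (of_rat s)"
proof -
  obtain b where b: "r < b" "\<forall>y. r < y \<longrightarrow> y < b \<longrightarrow> P y"
    using assms unfolding eventually_at_right_field by auto
  obtain s :: rat where "r < of_rat s" "of_rat s < b" using of_rat_dense[OF b(1)] by auto
  with b(2) show ?thesis by blast
qed

text \<open>Differentiability at \<open>t\<close> is the Cauchy property of the difference quotients
  as the increment tends to 0. Right-continuity lets rational increments decide it, so the condition
  is a countable combination of measurable ones.\<close>

lemma borel_measurable_vector_derivative:
  fixes f :: "real \<Rightarrow> 'a::euclidean_space"
  assumes [measurable]: "f \<in> borel_measurable borel" and rc: "\<And>x. continuous (at_right x) f"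
  shows "(\<lambda>t. vector_derivative f (at t)) \<in> borel_measurable borel"
proof -
  define q where "q t r = (1 / r) *\<^sub>R (f (t + r) - f t)" for t r
  have qm[measurable]: "(\<lambda>t. q t r) \<in> borel_measurable borel" for r
    unfolding q_def by measurable
  define C where "C t n m \<longleftrightarrow> (\<forall>r s :: rat. (r \<noteq> 0 \<and> s \<noteq> 0 \<and> \<bar>of_rat r\<bar> < 1 / real (Suc m) \<and> \<bar>of_rat s\<bar> < 1 / real (Suc m))
    \<longrightarrow> norm (q t (of_rat r) - q t (of_rat s)) \<le> 1 / real (Suc n))" for t n m
  define D where "D t \<longleftrightarrow> (\<forall>n. \<exists>m. C t n m)" for t
  have Dm[measurable]: "Measurable.pred borel D"
    unfolding D_def C_def by measurable
  have qd: "norm (f y - f t - (y - t) *\<^sub>R v) = \<bar>y - t\<bar> * norm (q t (y - t) - v)" if "y \<noteq> t" for y t v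
  proof -
    have "f y - f t - (y - t) *\<^sub>R v = (y - t) *\<^sub>R (q t (y - t) - v)"
      using that by (simp add: q_def scaleR_diff_right)
    then show ?thesis by simp
  qed
  have qr: "(q t \<longlongrightarrow> q t r) (at_right r)" if "r \<noteq> 0" for t r
  proof -
    have "(f \<longlongrightarrow> f (t + r)) (at_right (t + r))" using rc[of "t + r"] by (simp add: continuous_within)
    then have "((\<lambda>x. f (t + x)) \<longlongrightarrow> f (t + r)) (at_right r)"
      unfolding filterlim_at_right_to_0[of _ _ "t + r"] filterlim_at_right_to_0[of _ _ r] by (simp add: ac_simps)
    then show ?thesis unfolding q_def using that by (intro tendsto_intros) (auto simp: add.commute)
  qed
  \<comment> \<open>The estimate passes from rational to real increments by moving each increment to
    a rational slightly to its right; a negative one must stay negative meanwhile, which explains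
    the bound 0 in \<open>near\<close>.\<close>
  have Cr: "norm (q t r - q t s) \<le> 1 / real (Suc n)"
    if C: "C t n m" and r: "r \<noteq> 0" "\<bar>r\<bar> < 1 / real (Suc m)" and s: "s \<noteq> 0" "\<bar>s\<bar> < 1 / real (Suc m)" for t n m r s
  proof (rule ccontr)
    assume "\<not> ?thesis"
    then have gt: "1 / real (Suc n) < norm (q t r - q t s)" by simp
    have near: "\<forall>\<^sub>F y in at_right r. y \<noteq> 0 \<and> \<bar>y\<bar> < 1 / real (Suc m)" if "r \<noteq> 0" "\<bar>r\<bar> < 1 / real (Suc m)" for r
      unfolding eventually_at_right_field using that
      by (intro exI[of _ "if r < 0 then 0 else 1 / real (Suc m)"]) auto
    have "((\<lambda>y. norm (q t y - q t s)) \<longlongrightarrow> norm (q t r - q t s)) (at_right r)"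
      by (intro tendsto_intros qr r)
    then have "\<forall>\<^sub>F y in at_right r. 1 / real (Suc n) < norm (q t y - q t s)"
      using gt by (rule order_tendstoD)
    then obtain r' :: rat where r': "1 / real (Suc n) < norm (q t (of_rat r') - q t s)"
        "of_rat r' \<noteq> (0::real)" "\<bar>of_rat r'\<bar> < 1 / real (Suc m)"
      using rational_at_right[OF eventually_conj[OF _ near[OF r]]] by blast
    have "((\<lambda>y. norm (q t (of_rat r') - q t y)) \<longlongrightarrow> norm (q t (of_rat r') - q t s)) (at_right s)"
      by (intro tendsto_intros qr s)
    then have "\<forall>\<^sub>F y in at_right s. 1 / real (Suc n) < norm (q t (of_rat r') - q t y)"
      using r'(1) by (rule order_tendstoD)
    then obtain s' :: rat where s': "1 / real (Suc n) < norm (q t (of_rat r') - q t (of_rat s'))"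
        "of_rat s' \<noteq> (0::real)" "\<bar>of_rat s'\<bar> < 1 / real (Suc m)"
      using rational_at_right[OF eventually_conj[OF _ near[OF s]]] by blast
    show False
      using C r' s' unfolding C_def by (metis not_less of_rat_0)
  qed
  let ?h = "\<lambda>k. 1 / real (Suc k)"
  have h0: "?h \<longlonglongrightarrow> 0" by real_asymp
  have D_imp: "\<exists>v. (f has_vector_derivative v) (at t)" if Dt: "D t" for t
  proof -
    have small: "\<exists>k0. \<forall>k\<ge>k0. ?h k < ?h m" for m
      by (intro exI[of _ "Suc m"]) (auto simp: divide_simps)
    have "Cauchy (\<lambda>k. q t (?h k))"
    proof (rule CauchyI)
      fix e :: real assume "0 < e"
      then obtain n where n: "?h n < e" using nat_approx_posE by blast
      obtain m where m: "C t n m" using Dt by (auto simp: D_def)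
      obtain k0 where k0: "\<And>k. k \<ge> k0 \<Longrightarrow> ?h k < ?h m" using small[of m] by blast
      have "norm (q t (?h i) - q t (?h j)) < e" if "k0 \<le> i" "k0 \<le> j" for i j
        using Cr[OF m, of "?h i" "?h j"] k0[OF that(1)] k0[OF that(2)] n by simp
      then show "\<exists>M. \<forall>i\<ge>M. \<forall>j\<ge>M. norm (q t (?h i) - q t (?h j)) < e" by blast
    qed
    then obtain v where v: "(\<lambda>k. q t (?h k)) \<longlonglongrightarrow> v" by (auto simp: Cauchy_convergent_iff convergent_def)
    have "(f has_vector_derivative v) (at t)"
      unfolding has_vector_derivative_at_alt
    proof (intro allI impI)
      fix e :: real assume "0 < e"
      then obtain n where n: "?h n < e" using nat_approx_posE by blast
      obtain m where m: "C t n m" using Dt by (auto simp: D_def)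
      obtain k0 where k0: "\<And>k. k \<ge> k0 \<Longrightarrow> ?h k < ?h m" using small[of m] by blast
      have lim: "norm (q t r - v) \<le> ?h n" if "r \<noteq> 0" "\<bar>r\<bar> < ?h m" for r
      proof (rule LIMSEQ_le_const2)
        show "(\<lambda>k. norm (q t r - q t (?h k))) \<longlonglongrightarrow> norm (q t r - v)" by (intro tendsto_intros v)
        show "\<exists>N. \<forall>k\<ge>N. norm (q t r - q t (?h k)) \<le> ?h n"
          using Cr[OF m that] k0 by (intro exI[of _ k0]) auto
      qed
      have "norm (f y - f t - (y - t) *\<^sub>R v) \<le> e * \<bar>y - t\<bar>" if "\<bar>y - t\<bar> < ?h m" for y
      proof (cases "y = t")
        case False
        have "norm (q t (y - t) - v) \<le> e" using lim[of "y - t"] that False n by simp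
        then have "norm (q t (y - t) - v) * \<bar>y - t\<bar> \<le> e * \<bar>y - t\<bar>" by (rule mult_right_mono) simp
        then show ?thesis unfolding qd[OF False] by (simp add: mult.commute)
      qed simp
      then show "\<exists>d>0. \<forall>y. \<bar>y - t\<bar> < d \<longrightarrow> norm (f y - f t - (y - t) *\<^sub>R v) \<le> e * \<bar>y - t\<bar>"
        by (intro exI[of _ "?h m"]) auto
    qed
    then show ?thesis by blast
  qed
  have der: "D t \<and> (\<lambda>k. q t (?h k)) \<longlonglongrightarrow> v" if v: "(f has_vector_derivative v) (at t)" for t v
  proof -
    have ex: "\<exists>d>0. \<forall>r. r \<noteq> 0 \<longrightarrow> \<bar>r\<bar> < d \<longrightarrow> norm (q t r - v) \<le> e" if "0 < e" for e
    proof -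
      obtain d where d: "0 < d" "\<And>y. \<bar>y - t\<bar> < d \<Longrightarrow> norm (f y - f t - (y - t) *\<^sub>R v) \<le> e * \<bar>y - t\<bar>"
        using v \<open>0 < e\<close> unfolding has_vector_derivative_at_alt by blast
      have "norm (q t r - v) \<le> e" if "r \<noteq> 0" "\<bar>r\<bar> < d" for r
        using d(2)[of "t + r"] qd[of "t + r" t v] that by (simp add: mult.commute)
      with d(1) show ?thesis by blast
    qed
    have "D t"
      unfolding D_def
    proof
      fix n
      obtain d where d: "0 < d" "\<And>r. r \<noteq> 0 \<Longrightarrow> \<bar>r\<bar> < d \<Longrightarrow> norm (q t r - v) \<le> ?h n / 2"
        using ex[of "?h n / 2"] by auto
      obtain m where m: "?h m < d" using d(1) nat_approx_posE by blast
      have "norm (q t r - q t s) \<le> ?h n" if "r \<noteq> 0" "s \<noteq> 0" "\<bar>r\<bar> < ?h m" "\<bar>s\<bar> < ?h m" for r s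
      proof -
        have "norm (q t r - v) \<le> ?h n / 2" "norm (q t s - v) \<le> ?h n / 2"
          using that m by (intro d(2); linarith)+
        moreover have "norm (q t r - q t s) \<le> norm (q t r - v) + norm (q t s - v)"
          using norm_triangle_ineq4[of "q t r - v" "q t s - v"] by simp
        ultimately show ?thesis by linarith
      qed
      then have "C t n m" unfolding C_def by auto
      then show "\<exists>m. C t n m" ..
    qed
    moreover have "(\<lambda>k. q t (?h k)) \<longlonglongrightarrow> v"
    proof (rule LIMSEQ_I)
      fix e :: real assume "0 < e"
      then obtain d where d: "0 < d" "\<And>r. r \<noteq> 0 \<Longrightarrow> \<bar>r\<bar> < d \<Longrightarrow> norm (q t r - v) \<le> e / 2"
        using ex[of "e / 2"] by auto
      obtain k0 where k0: "?h k0 < d" using d(1) nat_approx_posE by blast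
      have "norm (q t (?h k) - v) < e" if "k0 \<le> k" for k
      proof -
        have "?h k \<le> ?h k0" using that by (simp add: divide_simps)
        then show ?thesis using d(2)[of "?h k"] k0 \<open>0 < e\<close> by simp
      qed
      then show "\<exists>no. \<forall>k\<ge>no. norm (q t (?h k) - v) < e" by blast
    qed
    ultimately show ?thesis by blast
  qed
  \<comment> \<open>\<open>vector_derivative\<close> is defined by choice; without a derivative the
    predicate is constantly false, so the same fixed value is returned for all such
    \<open>t\<close>.\<close>
  have "vector_derivative f (at t) = (if D t then lim (\<lambda>k. q t (?h k)) else (SOME x. False))" for t
  proof (cases "D t")
    case True
    then obtain v where v: "(f has_vector_derivative v) (at t)" using D_imp by blast
    then show ?thesis using der[OF v] True by (simp add: vector_derivative_at limI)
  next
    case False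
    then have "(\<lambda>v. (f has_vector_derivative v) (at t)) = (\<lambda>_. False)" using der by auto
    then show ?thesis using False by (simp add: vector_derivative_def)
  qed
  then have "(\<lambda>t. vector_derivative f (at t)) = (\<lambda>t. if D t then lim (\<lambda>k. q t (?h k)) else (SOME x. False))" by blast
  then show ?thesis by (simp only:) measurable
qed

lemma set_integral_atMost_continuous:
  fixes f :: "real \<Rightarrow> 'a::euclidean_space"
  assumes f: "integrable lborel f"
  shows "isCont (\<lambda>x. LINT s:{..x}|lborel. f s) x"
proof -
  let ?A = "\<lambda>x. LINT s:{..x}|lborel. f s"
  have "f integrable_on {x - 1..x + 1}"
    by (intro set_borel_integral_eq_integral(1) set_integrable_of_integrable f) auto
  then have "continuous_on {x - 1..x + 1} (\<lambda>y. ?A (x - 1) + integral {x - 1..y} f)"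
    by (intro continuous_intros indefinite_integral_continuous_1)
  moreover have "?A (x - 1) + integral {x - 1..y} f = ?A y" if "y \<in> {x - 1..x + 1}" for y
    using set_integral_atMost_diff[OF f, of "x - 1" y] that by (simp add: algebra_simps)
  ultimately have "continuous_on {x - 1..x + 1} ?A" by (rule continuous_on_eq)
  then show ?thesis by (rule continuous_on_interior) simp
qed

lemma right_cont01_set_integral:
  fixes f :: "real \<Rightarrow> 'a::euclidean_space"
  assumes f: "integrable lborel f" and z: "\<And>x. x \<notin> {0..1} \<Longrightarrow> f x = 0"
  shows "right_cont01 (\<lambda>x. LINT s:{..x}|lborel. f s)"
proof (rule right_cont01I)
  show "(LINT s:{..x}|lborel. f s) = 0" if "x < 0" for x
    unfolding set_lebesgue_integral_def using that z
    by (intro integral_eq_zero_AE AE_I2) (auto simp: indicator_def)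
  show "(LINT s:{..x}|lborel. f s) = (LINT s:{..1}|lborel. f s)" if "1 < x" for x
    unfolding set_lebesgue_integral_def using that z
    by (intro Bochner_Integration.integral_cong) (auto simp: indicator_def)
  show "continuous (at_right x) (\<lambda>x. LINT s:{..x}|lborel. f s)" for x
    using set_integral_atMost_continuous[OF f, of x] by (rule continuous_at_imp_continuous_at_within)
qed

text \<open>Minimality localised to \<open>[a, b]\<close>: the competitor follows
  \<open>rate_upto\<close> up to \<open>a\<close> and \<open>G\<close> afterwards.\<close>

lemma (in bounded_rate) rate_upto_diff_le:
  assumes S: "S = var_set" and G: "\<And>a b. a \<le> b \<Longrightarrow> norm (H b - H a) \<le> G b - G a" and ab: "a \<le> b"
  shows "rate_upto S H b - rate_upto S H a \<le> G b - G a"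
proof -
  let ?\<Psi> = "\<lambda>y. if y \<le> a then rate_upto S H y else rate_upto S H a + (G y - G a)"
  have "rate_upto S H b \<le> ?\<Psi> b"
  proof (rule rate_upto_least)
    have G0: "G a \<le> G y" if "a \<le> y" for y using order_trans[OF norm_ge_zero G[OF that]] by simp
    show "0 \<le> ?\<Psi> y" for y
      using reach_le_rate_upto[OF reach0] G0[of y] by (auto intro!: add_nonneg_nonneg)
    fix x y :: real and u k assume xy: "x < y" and uk: "(u, k) \<in> S"
    show "?\<Psi> x + (u \<bullet> (H y - H x) - k * (clamp01 y - clamp01 x)) \<le> ?\<Psi> y"
    proof (rule var_set_step_le[OF _ xy uk[unfolded S]])
      fix x y :: real assume xy: "x < y"
      consider "y \<le> a" | "x \<le> a" "a < y" | "a < x" using xy by linarith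
      then show "norm (H y - H x) \<le> ?\<Psi> y - ?\<Psi> x"
      proof cases
        case 1
        then show ?thesis using norm_diff_le_rate_upto[OF S, of x y] xy by simp
      next
        case 2
        then show ?thesis
          using norm_diff_le_rate_upto[OF S, of x a] G[of a y] norm_triangle_ineq[of "H y - H a" "H a - H x"] by simp
      next
        case 3
        then show ?thesis using G[of x y] xy by simp
      qed
    qed
  qed
  then show ?thesis using ab by (cases "b = a") auto
qed

section \<open>Decomposition of functions of bounded variation\<close>

lemma interval_measure_eq:
  assumes "distr_fun01 G" "sigma_additive \<kappa>" "\<And>x. \<kappa> {..x} = G x" "B \<in> sets borel"
  shows "measure (interval_measure G) B = \<kappa> B"
proof (rule sigma_additive_eqI[OF distr_fun01.sigma_additive_im[OF assms(1)] assms(2) _ assms(4)])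
  show "measure (interval_measure G) {..x} = \<kappa> {..x}" for x
    unfolding distr_fun01.measure_le[OF assms(1)] by (rule assms(3)[symmetric])
qed

lemma borel_measurable_cong_borel: "sets M = sets borel \<Longrightarrow> borel_measurable M = borel_measurable borel"
  by (rule measurable_cong_sets) auto

text \<open>Off \<open>N\<close> the measure \<open>M\<close> can be exchanged for Lebesgue measure
  with density \<phi>, which leaves the integral over \<open>N\<close> as the singular part.\<close>

lemma set_integral_density_eq:
  fixes M :: "real measure" and g :: "real \<Rightarrow> 'a::euclidean_space"
  assumes sets: "sets M = sets borel" and g: "integrable M g" and N: "N \<in> sets borel"
    and \<phi>: "\<phi> \<in> borel_measurable borel" "\<And>x. 0 \<le> \<phi> x"
    and d: "density M (\<lambda>x. ennreal (indicator (- N) x)) = density lborel (\<lambda>x. ennreal (\<phi> x))"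
    and B: "B \<in> sets borel"
  shows "integrable lborel (\<lambda>x. \<phi> x *\<^sub>R g x)"
    "(LINT s:B|M. g s) = (LINT s:B|lborel. \<phi> s *\<^sub>R g s) + (LINT s:B \<inter> N|M. g s)"
proof -
  note mM = borel_measurable_cong_borel[OF sets]
  have g_m[measurable]: "g \<in> borel_measurable borel" using g unfolding mM[symmetric] by (rule borel_measurable_integrable)
  have iN: "(\<lambda>x. indicator (- N) x :: real) \<in> borel_measurable M" unfolding mM using N by measurable
  have Ng: "integrable M (\<lambda>x. indicator (- N) x *\<^sub>R g x)"
    using N sets by (intro integrable_mult_indicator g) simp
  have "integrable (density M (\<lambda>x. ennreal (indicator (- N) x))) g"
    by (subst integrable_density[OF _ iN]) (simp_all add: mM Ng g_m)
  then have "integrable (density lborel (\<lambda>x. ennreal (\<phi> x))) g" unfolding d .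
  then show "integrable lborel (\<lambda>x. \<phi> x *\<^sub>R g x)"
    by (subst (asm) integrable_density) (simp_all add: \<phi>)
  have gB: "(\<lambda>x. indicator B x *\<^sub>R g x) \<in> borel_measurable borel" using B by measurable
  have "(LINT x|M. indicator (- N) x *\<^sub>R (indicator B x *\<^sub>R g x)) = (LINT x|density M (\<lambda>x. ennreal (indicator (- N) x)). indicator B x *\<^sub>R g x)"
    by (rule integral_density[symmetric]) (use iN gB in \<open>simp_all add: mM\<close>)
  also have "\<dots> = (LINT x|density lborel (\<lambda>x. ennreal (\<phi> x)). indicator B x *\<^sub>R g x)"
    unfolding d ..
  also have "\<dots> = (LINT x|lborel. \<phi> x *\<^sub>R (indicator B x *\<^sub>R g x))"
    by (rule integral_density) (use \<phi> gB in simp_all)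
  also have "\<dots> = (LINT s:B|lborel. \<phi> s *\<^sub>R g s)"
    unfolding set_lebesgue_integral_def by (simp add: mult.commute)
  finally have 1: "(LINT x:B \<inter> - N|M. g x) = (LINT s:B|lborel. \<phi> s *\<^sub>R g s)"
    by (simp add: set_lebesgue_integral_def indicator_inter_arith mult.commute)
  have "B = (B \<inter> - N) \<union> (B \<inter> N)" by auto
  then have "(LINT s:B|M. g s) = (LINT s:(B \<inter> - N) \<union> (B \<inter> N)|M. g s)" by simp
  also have "\<dots> = (LINT s:B \<inter> - N|M. g s) + (LINT s:B \<inter> N|M. g s)"
    using B N g sets by (intro set_integral_Un set_integrable_of_integrable) auto
  finally show "(LINT s:B|M. g s) = (LINT s:B|lborel. \<phi> s *\<^sub>R g s) + (LINT s:B \<inter> N|M. g s)"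
    by (simp add: 1)
qed

lemma measure_density_eq:
  fixes M :: "real measure"
  assumes fin: "finite_measure M" and sets: "sets M = sets borel" and N: "N \<in> sets borel"
    and \<phi>: "\<phi> \<in> borel_measurable borel" "\<And>x. 0 \<le> \<phi> x"
    and d: "density M (\<lambda>x. ennreal (indicator (- N) x)) = density lborel (\<lambda>x. ennreal (\<phi> x))"
    and B: "B \<in> sets borel"
  shows "integrable lborel \<phi>" "measure M B = (LINT s:B|lborel. \<phi> s) + measure M (B \<inter> N)"
proof -
  interpret finite_measure M by fact
  have i: "integrable M (\<lambda>_. 1::real)" by simp
  show "integrable lborel \<phi>"
    using set_integral_density_eq(1)[OF sets i N \<phi> d B] by simp
  show "measure M B = (LINT s:B|lborel. \<phi> s) + measure M (B \<inter> N)"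
    using set_integral_density_eq(2)[OF sets i N \<phi> d B] B N sets
    by (simp add: set_integral_const_one[OF fin])
qed

text \<open>Write \<open>H\<close> as the integral of its polar density \<open>g\<close> against the
  variation. Off \<open>N\<close> this is integration of \<open>w = \<phi> g\<close> against
  Lebesgue measure; on \<open>N\<close> it defines \<open>Z\<close>. The variation mass on
  \<open>N\<close> is singular and dominates \<open>Z\<close>, so \<open>Z\<close> has derivative 0
  almost everywhere and \<open>w\<close> is the derivative of \<open>H\<close>.\<close>

lemma bv_decomposition:
  fixes H :: "real \<Rightarrow> 'a::euclidean_space"
  assumes bH: "bounded_rate var_set H"
  obtains N w Z G where "N \<in> sets borel" "emeasure lborel N = 0"
    "integrable lborel w" "\<And>x. x \<notin> {0..1} \<Longrightarrow> w x = 0"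
    "AE t in lborel. (H has_vector_derivative w t) (at t)"
    "\<And>x. H x = (LINT s:{..x}|lborel. w s) + Z x" "right_cont01 Z"
    "distr_fun01 G" "emeasure (interval_measure G) (- N) = 0" "\<And>a b. a \<le> b \<Longrightarrow> norm (Z b - Z a) \<le> G b - G a"
proof -
  interpret bounded_rate var_set H by fact
  define F where "F = rate_upto var_set H"
  interpret F: distr_fun01 F unfolding F_def by (rule distr_fun01_rate_upto)
  let ?M = "interval_measure F"
  interpret fm: finite_measure ?M by (rule F.finite)
  obtain g where g: "g \<in> borel_measurable borel" "integrable ?M g"
    "\<And>x. (LINT s:{..x}|?M. g s) = H x" "AE x in ?M. norm (g x) = 1"
    using variation_density[OF bH] unfolding F_def by blast
  have g1: "AE x in ?M. norm (g x) \<le> 1" using g(4) by eventually_elim simp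
  obtain N \<phi> where N: "N \<in> sets borel" "emeasure lborel N = 0"
    and \<phi>: "\<phi> \<in> borel_measurable borel" "\<And>x. 0 \<le> \<phi> x" "\<And>x. x \<notin> {0..1} \<Longrightarrow> \<phi> x = 0"
    and d: "density ?M (\<lambda>x. ennreal (indicator (- N) x)) = density lborel (\<lambda>x. ennreal (\<phi> x))"
    using F.lebesgue_decomposition by blast
  note m_eq = measure_density_eq[OF F.finite sets_interval_measure N(1) \<phi>(1,2) d]
  note i_eq = set_integral_density_eq[OF sets_interval_measure g(2) N(1) \<phi>(1,2) d]
  have \<phi>i: "integrable lborel \<phi>" by (rule m_eq(1)[of UNIV]) simp
  define w where "w x = \<phi> x *\<^sub>R g x" for x
  have wi: "integrable lborel w" unfolding w_def by (rule i_eq(1)[of UNIV]) simp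
  have w0: "w x = 0" if "x \<notin> {0..1}" for x using \<phi>(3)[OF that] by (simp add: w_def)
  define Z where "Z x = (LINT s:{..x} \<inter> N|?M. g s)" for x
  have HZ: "H x = (LINT s:{..x}|lborel. w s) + Z x" for x
    using i_eq(2)[of "{..x}"] by (simp add: g(3) w_def Z_def)
  have "Z = (\<lambda>x. H x - (LINT s:{..x}|lborel. w s))" using HZ by (auto simp: fun_eq_iff)
  then have Zrc: "right_cont01 Z" using right_cont01_diff[OF rc right_cont01_set_integral[OF wi w0]] by simp
  define G where "G x = measure ?M ({..x} \<inter> N)" for x
  have "G = (\<lambda>x. F x - (LINT s:{..x}|lborel. \<phi> s))"
    using m_eq(2)[of "{..x}" for x] by (auto simp: fun_eq_iff G_def F.measure_le)
  then have Grc: "right_cont01 G" using right_cont01_diff[OF F.rc right_cont01_set_integral[OF \<phi>i \<phi>(3)]] by simp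
  have Gdf: "distr_fun01 G"
  proof
    show "G x \<le> G y" if "x \<le> y" for x y
      unfolding G_def using that N(1) by (intro fm.finite_measure_mono) auto
  qed (rule Grc)
  have cN: "sigma_additive (\<lambda>B. measure ?M (B \<inter> N))" by (rule sigma_additive_Int[OF F.sigma_additive_im N(1)])
  have Gm: "measure (interval_measure G) B = measure ?M (B \<inter> N)" if "B \<in> sets borel" for B
    by (rule interval_measure_eq[OF Gdf cN _ that]) (simp add: G_def)
  interpret gm: finite_measure "interval_measure G" by (rule distr_fun01.finite[OF Gdf])
  have GN: "emeasure (interval_measure G) (- N) = 0"
    using Gm[of "- N"] N(1) by (simp add: gm.emeasure_eq_measure)
  have c2: "sigma_additive (\<lambda>B. LINT s:B \<inter> N|?M. g s)"
    by (rule sigma_additive_Int[OF sigma_additive_set_integral[OF sets_interval_measure g(2)] N(1)])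
  have ZG: "norm (Z b - Z a) \<le> G b - G a" if "a \<le> b" for a b
  proof -
    have e: "{..b} - {..a} = {a<..b}" "{..a} \<subseteq> {..b}" using that by auto
    have "norm (Z b - Z a) = norm (LINT s:{a<..b} \<inter> N|?M. g s)"
      using sigma_additive_Diff[OF c2, of "{..b}" "{..a}"] e by (simp add: Z_def)
    also have "\<dots> \<le> measure ?M ({a<..b} \<inter> N)"
      using N(1) by (intro norm_set_integral_le_measure[OF F.finite _ g(2) g1]) auto
    also have "\<dots> = G b - G a"
      using sigma_additive_Diff[OF cN, of "{..b}" "{..a}"] e by (simp add: G_def)
    finally show ?thesis .
  qed
  have "AE t in lborel. (Z has_vector_derivative 0) (at t)"
    using ZG distr_fun01.measure_Ioc[OF Gdf]
    by (intro AE_singular_derivative_zero[OF gm.finite_measure_axioms _ N GN]) auto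
  moreover have "AE t in lborel. ((\<lambda>x. LINT s:{..x}|lborel. w s) has_vector_derivative w t) (at t)"
    by (rule AE_lebesgue_differentiation[OF wi])
  ultimately have der: "AE t in lborel. (H has_vector_derivative w t) (at t)"
  proof eventually_elim
    fix t assume "(Z has_vector_derivative 0) (at t)"
      "((\<lambda>x. LINT s:{..x}|lborel. w s) has_vector_derivative w t) (at t)"
    then have "((\<lambda>x. (LINT s:{..x}|lborel. w s) + Z x) has_vector_derivative w t + 0) (at t)"
      by (intro has_vector_derivative_add)
    then show "(H has_vector_derivative w t) (at t)" unfolding HZ[symmetric] by simp
  qed
  show thesis by (rule that[OF N wi w0 der HZ Zrc Gdf GN ZG])
qed

lemma bounded_rate_of_dominated:
  assumes H: "right_cont01 H" and G: "\<And>a b. a \<le> b \<Longrightarrow> norm (H b - H a) \<le> G b - G a" "\<And>x. x < 0 \<Longrightarrow> 0 \<le> G x"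
  shows "bounded_rate var_set H"
proof
  show "bdd_above {c. reach UNIV var_set H 1 c}"
  proof (rule bdd_aboveI[of _ "G 1"])
    fix c assume "c \<in> {c. reach UNIV var_set H 1 c}"
    then have "reach UNIV var_set H 1 c" by simp
    from reach_least[OF G(2) var_set_step_le[of H G] this] show "c \<le> G 1" using G(1) by auto
  qed
qed (fact H var_set_0)+

lemma BV01_iff:
  assumes "h \<in> D01"
  shows "h \<in> BV01 \<longleftrightarrow> bounded_rate var_set (extend01 h)"
proof
  assume "bounded_rate var_set (extend01 h)"
  from SUP_polygon_eq_rate_upto[OF this] have "Var h < \<infinity>" unfolding Var_eq by simp
  then show "h \<in> BV01" using assms by (simp add: BV01_def)
qed (rule BV01_bounded_rate)

text \<open>\<open>h\<close> and \<open>extend01 h\<close> agree near every point of the open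
  interval but possibly not near its endpoints, so these two points are discarded.\<close>

lemma AE_dern_eq:
  assumes "AE t in lborel. (extend01 h has_vector_derivative w t) (at t)"
  shows "AE t in lborel. t \<in> {0..1} \<longrightarrow> dern h t = w t"
proof -
  have "AE t in lborel. t \<notin> {0, 1}"
    by (rule AE_not_in) (auto intro: finite_imp_null_set_lborel)
  with assms show ?thesis
  proof eventually_elim
    fix t assume t: "(extend01 h has_vector_derivative w t) (at t)" "t \<notin> {0, 1}"
    show "t \<in> {0..1} \<longrightarrow> dern h t = w t"
    proof
      assume "t \<in> {0..1}"
      then have "t \<in> {0<..<1}" using t(2) by auto
      have "(h has_vector_derivative w t) (at t)"
        by (rule has_vector_derivative_transform_within_open[OF t(1) _ \<open>t \<in> {0<..<1}\<close>]) (auto simp: extend01_def)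
      then show "dern h t = w t" unfolding dern_def by (rule vector_derivative_at)
    qed
  qed
qed

text \<open>Each coordinate is a difference of two increasing functions, one of them the
  variation.\<close>

lemma borel_measurable_extend01:
  fixes h :: "real \<Rightarrow> 'a::euclidean_space"
  assumes "bounded_rate var_set (extend01 h)"
  shows "extend01 h \<in> borel_measurable borel"
proof -
  interpret bounded_rate var_set "extend01 h" by fact
  have "(\<lambda>x. extend01 h x \<bullet> b) \<in> borel_measurable borel" if b: "b \<in> Basis" for b
  proof -
    have "mono (\<lambda>x. rate_upto var_set (extend01 h) x + extend01 h x \<bullet> b)"
    proof (rule monoI)
      fix x y :: real assume "x \<le> y"
      from norm_diff_le_rate_upto[OF refl this] Basis_le_norm[OF b, of "extend01 h y - extend01 h x"]
      show "rate_upto var_set (extend01 h) x + extend01 h x \<bullet> b \<le> rate_upto var_set (extend01 h) y + extend01 h y \<bullet> b"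
        by (simp add: inner_diff_left)
    qed
    then have "(\<lambda>x. rate_upto var_set (extend01 h) x + extend01 h x \<bullet> b) \<in> borel_measurable borel" by (rule borel_measurable_mono)
    moreover have "rate_upto var_set (extend01 h) \<in> borel_measurable borel"
      by (rule borel_measurable_mono) (auto intro!: monoI rate_upto_mono)
    ultimately have "(\<lambda>x. (rate_upto var_set (extend01 h) x + extend01 h x \<bullet> b) - rate_upto var_set (extend01 h) x) \<in> borel_measurable borel"
      by (rule borel_measurable_diff)
    then show ?thesis by simp
  qed
  then show ?thesis by (subst borel_measurable_euclidean_space) auto
qed

lemma borel_measurable_dern:
  assumes "bounded_rate var_set (extend01 h)"
  shows "(\<lambda>t. indicator {0<..<1} t *\<^sub>R dern h t) \<in> borel_measurable borel"
proof -
  interpret bounded_rate var_set "extend01 h" by fact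
  have "(\<lambda>t. vector_derivative (extend01 h) (at t)) \<in> borel_measurable borel"
    by (rule borel_measurable_vector_derivative[OF borel_measurable_extend01[OF assms] right_cont01D(3)[OF rc]])
  then have *: "(\<lambda>t. indicator {0<..<1} t *\<^sub>R vector_derivative (extend01 h) (at t)) \<in> borel_measurable borel"
    by measurable
  have "indicator {0<..<1} t *\<^sub>R dern h t = indicator {0<..<1} t *\<^sub>R vector_derivative (extend01 h) (at t)" for t
  proof (cases "t \<in> {0<..<1}")
    case True
    \<comment> \<open>The equivalence holds for every \<open>D\<close>, so the choices made by
      \<open>vector_derivative\<close> agree even where no derivative exists.\<close>
    have "(h has_vector_derivative D) (at t) \<longleftrightarrow> (extend01 h has_vector_derivative D) (at t)" for D
      by (auto intro: has_vector_derivative_transform_within_open[OF _ _ True] simp: extend01_def)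
    then show ?thesis by (simp add: dern_def vector_derivative_def)
  qed simp
  then have "(\<lambda>t. indicator {0<..<1} t *\<^sub>R dern h t) = (\<lambda>t. indicator {0<..<1} t *\<^sub>R vector_derivative (extend01 h) (at t))"
    by (rule ext)
  with * show ?thesis by simp
qed

lemma hac_eq:
  fixes h :: "real \<Rightarrow> 'a::euclidean_space"
  assumes b: "bounded_rate var_set (extend01 h)" and w: "integrable lborel w" "\<And>x. x \<notin> {0..1} \<Longrightarrow> w x = 0"
    and d: "AE t in lborel. (extend01 h has_vector_derivative w t) (at t)" and t: "t \<in> {0..1}"
  shows "hac h t = (LINT s:{..t}|lborel. w s)"
proof -
  let ?d = "\<lambda>s. indicator {0<..<1} s *\<^sub>R dern h s"
  have m: "?d \<in> borel_measurable borel" by (rule borel_measurable_dern[OF b])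
  have 01: "AE s in lborel. s \<notin> {0, 1::real}"
    by (rule AE_not_in) (auto intro: finite_imp_null_set_lborel)
  \<comment> \<open>The endpoints are split off: \<open>borel_measurable_dern\<close> speaks of the
    open interval, and a function supported on two points is measurable anyway.\<close>
  have e: "indicator {0..t} s *\<^sub>R dern h s = indicator {0<..<1} s *\<^sub>R (indicator {0..t} s *\<^sub>R dern h s)
     + indicator {0, 1} s *\<^sub>R (indicator {0..t} s *\<^sub>R dern h s)" for s
    using t by (auto simp: indicator_def)
  have f: "indicator {0, 1} s *\<^sub>R (indicator {0..t} s *\<^sub>R dern h s)
     = indicator {0} s *\<^sub>R (indicator {0..t} 0 *\<^sub>R dern h 0) + indicator {1} s *\<^sub>R (indicator {0..t} 1 *\<^sub>R dern h 1)" for s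
    by (auto simp: indicator_def)
  have "(\<lambda>s. indicator {0..t} s *\<^sub>R ?d s + (indicator {0} s *\<^sub>R (indicator {0..t} 0 *\<^sub>R dern h 0)
      + indicator {1} s *\<^sub>R (indicator {0..t} 1 *\<^sub>R dern h 1))) \<in> borel_measurable borel"
    using m by measurable
  then have m': "(\<lambda>s. indicator {0..t} s *\<^sub>R dern h s) \<in> borel_measurable borel"
    by (subst e, subst f) (simp add: mult.commute)
  have "(LINT s:{0..t}|lborel. dern h s) = (LINT s:{..t}|lborel. w s)"
    unfolding set_lebesgue_integral_def
  proof (rule integral_cong_AE)
    show "AE s in lborel. indicator {0..t} s *\<^sub>R dern h s = indicator {..t} s *\<^sub>R w s"
      using AE_dern_eq[OF d]
    proof eventually_elim
      fix s assume "s \<in> {0..1} \<longrightarrow> dern h s = w s"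
      then show "indicator {0..t} s *\<^sub>R dern h s = indicator {..t} s *\<^sub>R w s"
        using t w(2)[of s] by (auto simp: indicator_def)
    qed
  qed (use m' w(1) in auto)
  then show ?thesis using t by (simp add: hac_def)
qed

lemma (in distr_fun01) set_integral_01:
  fixes g :: "real \<Rightarrow> 'a::euclidean_space"
  assumes "g \<in> borel_measurable borel"
  shows "x \<in> {0..1} \<Longrightarrow> (LINT s:{..x}|interval_measure F. g s) = (LINT s:{0..x}|interval_measure F. g s)"
    "x < 0 \<Longrightarrow> (LINT s:{..x}|interval_measure F. g s) = 0"
    "1 \<le> x \<Longrightarrow> (LINT s:{..x}|interval_measure F. g s) = (LINT s:{0..1}|interval_measure F. g s)"
proof -
  have m: "(\<lambda>s. indicator B s *\<^sub>R g s) \<in> borel_measurable (interval_measure F)" if "B \<in> sets borel" for B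
    using assms that by simp
  show "(LINT s:{..x}|interval_measure F. g s) = (LINT s:{0..x}|interval_measure F. g s)" if "x \<in> {0..1}"
    unfolding set_lebesgue_integral_def
  proof (rule integral_cong_AE[OF m m])
    show "AE s in interval_measure F. indicator {..x} s *\<^sub>R g s = indicator {0..x} s *\<^sub>R g s"
      using AE_01 by eventually_elim (auto simp: indicator_def)
  qed auto
  show "(LINT s:{..x}|interval_measure F. g s) = (LINT s:{0..1}|interval_measure F. g s)" if "1 \<le> x"
    unfolding set_lebesgue_integral_def
  proof (rule integral_cong_AE[OF m m])
    show "AE s in interval_measure F. indicator {..x} s *\<^sub>R g s = indicator {0..1} s *\<^sub>R g s"
      using AE_01 by eventually_elim (use that in \<open>auto simp: indicator_def\<close>)
  qed auto
  show "(LINT s:{..x}|interval_measure F. g s) = 0" if "x < 0"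
    unfolding set_lebesgue_integral_def
  proof (rule integral_eq_zero_AE)
    show "AE s in interval_measure F. indicator {..x} s *\<^sub>R g s = 0"
      using AE_01 by eventually_elim (use that in \<open>auto simp: indicator_def\<close>)
  qed
qed

text \<open>\<open>hdot\<close> is defined by choice; the density from
  \<open>variation_density\<close> witnesses its defining property. As the measure is carried by
  \<open>[0, 1]\<close>, the identity extends from there to all half-lines.\<close>

lemma hdot_spec:
  fixes h :: "real \<Rightarrow> 'a::euclidean_space"
  assumes h: "h \<in> BV01"
  shows "hdot h \<in> borel_measurable borel" "integrable (dV h) (hdot h)" "AE x in dV h. norm (hdot h x) = 1"
    "(LINT s:{..x}|dV h. hdot h s) = extend01 h x"
proof -
  let ?F = "rate_upto var_set (extend01 h)"
  have b: "bounded_rate var_set (extend01 h)" by (rule BV01_bounded_rate[OF h])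
  interpret bounded_rate var_set "extend01 h" by (rule b)
  interpret F: distr_fun01 ?F by (rule distr_fun01_rate_upto)
  note dV = dV_eq[OF h]
  let ?P = "\<lambda>g. g \<in> borel_measurable borel \<and> (AE x in dV h. norm (g x) = 1) \<and>
     (\<forall>x\<in>{0..1}. set_integrable (dV h) {0..x} g \<and> (LINT s:{0..x}|dV h. g s) = h x)"
  obtain g where g: "g \<in> borel_measurable borel" "integrable (interval_measure ?F) g"
    "\<And>x. (LINT s:{..x}|interval_measure ?F. g s) = extend01 h x" "AE x in interval_measure ?F. norm (g x) = 1"
    using variation_density[OF b] by blast
  have "?P g"
    unfolding dV
  proof (intro conjI ballI)
    fix x :: real assume x: "x \<in> {0..1}"
    show "set_integrable (interval_measure ?F) {0..x} g"
      by (rule set_integrable_of_integrable[OF g(2)]) simp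
    show "(LINT s:{0..x}|interval_measure ?F. g s) = h x"
      using F.set_integral_01(1)[OF g(1) x] g(3)[of x] x by (simp add: extend01_def)
  qed (use g in auto)
  then have P: "?P (hdot h)" unfolding hdot_def by (rule someI[of ?P])
  then show m: "hdot h \<in> borel_measurable borel" and n: "AE x in dV h. norm (hdot h x) = 1" by auto
  interpret fm: finite_measure "dV h" unfolding dV by (rule F.finite)
  show "integrable (dV h) (hdot h)"
  proof (rule fm.integrable_const_bound[of _ 1])
    show "AE x in dV h. norm (hdot h x) \<le> 1" using n by eventually_elim simp
  qed (use m in \<open>simp add: dV\<close>)
  have eq: "(LINT s:{0..x}|interval_measure ?F. hdot h s) = h x" if "x \<in> {0..1}" for x
    using P that unfolding dV by blast
  show "(LINT s:{..x}|dV h. hdot h s) = extend01 h x"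
  proof -
    consider "x < 0" | "x \<in> {0..1}" | "1 < x" by fastforce
    then show ?thesis
    proof cases
      case 1
      then show ?thesis using F.set_integral_01(2)[OF m, of x] by (simp add: dV extend01_def)
    next
      case 2
      then show ?thesis using F.set_integral_01(1)[OF m, of x] eq[of x] by (simp add: dV extend01_def)
    next
      case 3
      then show ?thesis using F.set_integral_01(3)[OF m, of x] eq[of 1] by (simp add: dV extend01_def)
    qed
  qed
qed

text \<open>The function \<open>Z\<close> of \<open>bv_decomposition\<close> is the extension of
  \<open>hsing h\<close>. By localised minimality its variation has increments at most those of
  \<open>G\<close>, so it is carried by \<open>N\<close> as well.\<close>

lemma hsing_decomposition:
  fixes h :: "real \<Rightarrow> 'a::euclidean_space"
  assumes h: "h \<in> BV01"
  obtains N w where "N \<in> sets borel" "emeasure lborel N = 0"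
    "integrable lborel w" "\<And>x. x \<notin> {0..1} \<Longrightarrow> w x = 0"
    "AE t in lborel. t \<in> {0..1} \<longrightarrow> dern h t = w t"
    "hsing h \<in> BV01" "emeasure (dV (hsing h)) (- N) = 0"
    "\<And>x. extend01 h x = (LINT s:{..x}|lborel. w s) + (LINT s:{..x}|dV (hsing h). hdot (hsing h) s)"
proof -
  have b: "bounded_rate var_set (extend01 h)" by (rule BV01_bounded_rate[OF h])
  obtain N w Z G where N: "N \<in> sets borel" "emeasure lborel N = 0"
    and w: "integrable lborel w" "\<And>x. x \<notin> {0..1} \<Longrightarrow> w x = 0"
    and der: "AE t in lborel. (extend01 h has_vector_derivative w t) (at t)"
    and HZ: "\<And>x. extend01 h x = (LINT s:{..x}|lborel. w s) + Z x" and Z: "right_cont01 Z"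
    and G: "distr_fun01 G" "emeasure (interval_measure G) (- N) = 0" "\<And>a b. a \<le> b \<Longrightarrow> norm (Z b - Z a) \<le> G b - G a"
    using bv_decomposition[OF b] by blast
  let ?A = "\<lambda>x. LINT s:{..x}|lborel. w s"
  have hsA: "hsing h x = h x - ?A x" if "x \<in> {0..1}" for x
    using hac_eq[OF b w der that] by (simp add: hsing_def)
  have hsZ: "hsing h x = Z x" if "x \<in> {0..1}" for x
    using hsA[OF that] HZ[of x] that by (auto simp: extend01_def)
  have ext: "extend01 (hsing h) = Z"
  proof
    fix x show "extend01 (hsing h) x = Z x"
    proof (cases "x < 0")
      case False
      then show ?thesis using hsZ[of "min x 1"] right_cont01D(2)[OF Z, of x] by (auto simp: extend01_def min_def)
    qed (use right_cont01D(1)[OF Z] in \<open>simp add: extend01_def\<close>)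
  qed
  have hD: "cadlag h" "\<And>t. t \<notin> {0..1} \<Longrightarrow> h t = 0" using h by (auto simp: BV01_def D01_def)
  have "cadlag (hsing h)"
    unfolding cadlag_def
  proof (intro conjI ballI)
    fix t :: real assume t: "t \<in> {0..<1}"
    show "continuous (at_right t) (hsing h)"
      by (rule continuous_at_right_cong[of t 1 Z]) (use t hsZ right_cont01D(3)[OF Z] in auto)
  next
    fix t :: real assume t: "t \<in> {0<..1}"
    then obtain l where l: "(h \<longlongrightarrow> l) (at_left t)" using hD(1) unfolding cadlag_def by blast
    have "(?A \<longlongrightarrow> ?A t) (at_left t)"
      using set_integral_atMost_continuous[OF w(1), of t] continuous_at_imp_continuous_at_within
      by (metis continuous_within)
    with l have "((\<lambda>x. h x - ?A x) \<longlongrightarrow> l - ?A t) (at_left t)" by (rule tendsto_diff)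
    moreover have "\<forall>\<^sub>F x in at_left t. h x - ?A x = hsing h x"
      unfolding eventually_at_left_field using t hsA by (intro exI[of _ 0]) auto
    ultimately have "(hsing h \<longlongrightarrow> l - ?A t) (at_left t)" by (rule Lim_transform_eventually)
    then show "\<exists>l. (hsing h \<longlongrightarrow> l) (at_left t)" ..
  qed
  then have "hsing h \<in> D01"
    using hD(2) by (auto simp: D01_def hsing_def hac_def)
  moreover have bZ: "bounded_rate var_set Z"
    by (rule bounded_rate_of_dominated[OF Z G(3)]) (use distr_fun01.nonneg[OF G(1)] in auto)
  ultimately have BV: "hsing h \<in> BV01" by (simp add: BV01_iff ext)
  interpret bz: bounded_rate var_set Z by (rule bZ)
  interpret F: distr_fun01 "rate_upto var_set Z" by (rule bz.distr_fun01_rate_upto)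
  interpret G: distr_fun01 G by (rule G)
  interpret D: distr_fun01 "\<lambda>x. G x - rate_upto var_set Z x"
    using right_cont01_diff[OF G.rc F.rc] bz.rate_upto_diff_le[OF refl G(3)] by unfold_locales (auto simp: algebra_simps)
  interpret fm: finite_measure "interval_measure (rate_upto var_set Z)" by (rule F.finite)
  interpret gm: finite_measure "interval_measure G" by (rule G.finite)
  have "0 \<le> measure (interval_measure G) (- N) - measure (interval_measure (rate_upto var_set Z)) (- N)"
    by (rule D.sigma_additive_nonneg[OF sigma_additive_diff[OF G.sigma_additive_im F.sigma_additive_im]]) (use N(1) in \<open>auto simp: G.measure_le F.measure_le\<close>)
  moreover have "measure (interval_measure G) (- N) = 0" using G(2) by (simp add: measure_def)
  moreover have "0 \<le> measure (interval_measure (rate_upto var_set Z)) (- N)" by simp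
  ultimately have "measure (interval_measure (rate_upto var_set Z)) (- N) = 0" by linarith
  then have null: "emeasure (dV (hsing h)) (- N) = 0"
    by (simp add: dV_eq[OF BV] ext fm.emeasure_eq_measure)
  show thesis
    by (rule that[OF N w AE_dern_eq[OF der] BV null]) (simp_all add: HZ hdot_spec(4)[OF BV] ext)
qed

section \<open>From single pairs to suprema over countably many pairs\<close>

lemma Max_image_Suc: "Max ((\<lambda>i. f i) ` {..Suc n}) = max (Max (f ` {..n})) (f (Suc n) :: real)"
proof -
  have "f ` {..Suc n} = insert (f (Suc n)) (f ` {..n})" by (simp add: atMost_Suc)
  then show ?thesis by (simp add: max.commute)
qed

text \<open>Since \<open>M\<^sub>1\<close> and \<open>M\<^sub>2\<close> are mutually singular, the set where the new function wins can be
  chosen simultaneously for both; splitting along it passes the bound on to finite maxima.\<close>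

lemma max_set_integral_le:
  fixes a p :: "nat \<Rightarrow> real \<Rightarrow> real"
  assumes sets: "sets M1 = sets borel" "sets M2 = sets borel"
    and a: "\<And>n. integrable M1 (a n)" and p: "\<And>n. integrable M2 (p n)"
    and N: "N \<in> sets borel" "emeasure M1 N = 0" "emeasure M2 (- N) = 0"
    and c: "sigma_additive \<nu>"
    and le: "\<And>n B. B \<in> sets borel \<Longrightarrow> (LINT x:B|M1. a n x) + (LINT x:B|M2. p n x) \<le> \<nu> B"
    and B: "B \<in> sets borel"
  shows "(LINT x:B|M1. Max ((\<lambda>i. a i x) ` {..n})) + (LINT x:B|M2. Max ((\<lambda>i. p i x) ` {..n})) \<le> \<nu> B"
    "integrable M1 (\<lambda>x. Max ((\<lambda>i. a i x) ` {..n}))" "integrable M2 (\<lambda>x. Max ((\<lambda>i. p i x) ` {..n}))"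
proof -
  define A where "A n x = Max ((\<lambda>i. a i x) ` {..n})" for n x
  define P where "P n x = Max ((\<lambda>i. p i x) ` {..n})" for n x
  have A0: "A 0 = a 0" and P0: "P 0 = p 0" by (auto simp: A_def P_def fun_eq_iff)
  have AS: "A (Suc n) = (\<lambda>x. max (A n x) (a (Suc n) x))" and PS: "P (Suc n) = (\<lambda>x. max (P n x) (p (Suc n) x))" for n
    unfolding A_def P_def Max_image_Suc by (rule refl)+
  have Ai: "integrable M1 (A n)" for n by (induction n) (auto simp: A0 AS a)
  have Pi: "integrable M2 (P n)" for n by (induction n) (auto simp: P0 PS p)
  have AE1: "AE x in M1. x \<notin> N" by (rule AE_not_in) (use N sets in \<open>auto simp: null_sets_def\<close>)
  have AE2: "AE x in M2. x \<notin> - N" by (rule AE_not_in) (use N sets in \<open>auto simp: null_sets_def\<close>)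
  note b1 = borel_measurable_cong_borel[OF sets(1)] and b2 = borel_measurable_cong_borel[OF sets(2)]
  have m[measurable]: "A n \<in> borel_measurable borel" "a n \<in> borel_measurable borel" for n
    using borel_measurable_integrable[OF Ai[of n]] borel_measurable_integrable[OF a[of n]] unfolding b1 by auto
  have m'[measurable]: "P n \<in> borel_measurable borel" "p n \<in> borel_measurable borel" for n
    using borel_measurable_integrable[OF Pi[of n]] borel_measurable_integrable[OF p[of n]] unfolding b2 by auto
  have main: "B \<in> sets borel \<Longrightarrow> (LINT x:B|M1. A n x) + (LINT x:B|M2. P n x) \<le> \<nu> B" for n B
  proof (induction n arbitrary: B)
    case 0
    then show ?case using le[of B 0] by (simp add: A0 P0)
  next
    case (Suc n)
    define Z where "Z = (- N \<inter> {x. A n x < a (Suc n) x}) \<union> (N \<inter> {x. P n x < p (Suc n) x})"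
    have Z: "Z \<in> sets borel" unfolding Z_def using N(1) by measurable
    have BZ: "B \<inter> Z \<in> sets borel" "B - Z \<in> sets borel" using Z Suc.prems by auto
    have split: "(LINT x:B|M. max (f x) (g x)) = (LINT x:B \<inter> Z|M. g x) + (LINT x:B - Z|M. f x)"
      if s: "sets M = sets borel" and fg: "integrable M f" "integrable M g"
        and ae: "AE x in M. (x \<in> Z) = (f x < g x)" for M and f g :: "real \<Rightarrow> real"
    proof -
      have i: "integrable M (\<lambda>x. indicator (B \<inter> Z) x *\<^sub>R g x)" "integrable M (\<lambda>x. indicator (B - Z) x *\<^sub>R f x)"
        using BZ s by (intro integrable_mult_indicator fg; simp)+
      have mx: "integrable M (\<lambda>x. indicator B x *\<^sub>R max (f x) (g x))"
        using Suc.prems s fg by (intro integrable_mult_indicator) auto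
      have "(LINT x:B|M. max (f x) (g x)) = (LINT x|M. indicator (B \<inter> Z) x *\<^sub>R g x + indicator (B - Z) x *\<^sub>R f x)"
        unfolding set_lebesgue_integral_def
      proof (rule integral_cong_AE)
        show "AE x in M. indicator B x *\<^sub>R max (f x) (g x) = indicator (B \<inter> Z) x *\<^sub>R g x + indicator (B - Z) x *\<^sub>R f x"
          using ae by eventually_elim (auto simp: indicator_def)
      qed (use i mx in auto)
      also have "\<dots> = (LINT x:B \<inter> Z|M. g x) + (LINT x:B - Z|M. f x)"
        unfolding set_lebesgue_integral_def by (rule Bochner_Integration.integral_add[OF i])
      finally show ?thesis .
    qed
    have "AE x in M1. (x \<in> Z) = (A n x < a (Suc n) x)" using AE1 by eventually_elim (auto simp: Z_def)
    note 1 = split[OF sets(1) Ai a this]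
    have "AE x in M2. (x \<in> Z) = (P n x < p (Suc n) x)" using AE2 by eventually_elim (auto simp: Z_def)
    note 2 = split[OF sets(2) Pi p this]
    have "\<nu> ((B \<inter> Z) \<union> (B - Z)) = \<nu> (B \<inter> Z) + \<nu> (B - Z)" by (rule sigma_additive_Un[OF c BZ]) auto
    moreover have "(B \<inter> Z) \<union> (B - Z) = B" by auto
    ultimately show ?case
      using Suc.IH[OF BZ(2)] le[OF BZ(1), of "Suc n"] unfolding AS PS 1 2 by simp
  qed
  show "(LINT x:B|M1. Max ((\<lambda>i. a i x) ` {..n})) + (LINT x:B|M2. Max ((\<lambda>i. p i x) ` {..n})) \<le> \<nu> B"
    using main[OF B, of n] by (simp add: A_def P_def)
  show "integrable M1 (\<lambda>x. Max ((\<lambda>i. a i x) ` {..n}))" "integrable M2 (\<lambda>x. Max ((\<lambda>i. p i x) ` {..n}))"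
    using Ai[of n] Pi[of n] by (simp_all add: A_def[abs_def] P_def[abs_def])
qed

lemma SUP_ennreal_Max:
  fixes f :: "nat \<Rightarrow> real"
  shows "(SUP n. ennreal (Max ((\<lambda>i. f i) ` {..n}))) = (SUP n. ennreal (f n))"
proof (rule antisym; rule SUP_least)
  fix n :: nat
  have "Max (f ` {..n}) \<in> f ` {..n}" by (rule Max_in) auto
  then obtain i where "Max (f ` {..n}) = f i" by blast
  then show "ennreal (Max (f ` {..n})) \<le> (SUP n. ennreal (f n))" by (auto intro: SUP_upper)
  have "f n \<le> Max (f ` {..n})" by (rule Max_ge) auto
  then show "ennreal (f n) \<le> (SUP n. ennreal (Max (f ` {..n})))"
    by (intro SUP_upper2[of n] ennreal_leI) auto
qed

text \<open>Monotone convergence along finite maxima. The zero functions at index 0 make the maxima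
  nonnegative, so their Bochner integrals and nonnegative integrals agree.\<close>

lemma nn_integral_SUP_le:
  fixes a p :: "nat \<Rightarrow> real \<Rightarrow> real"
  assumes sets: "sets M1 = sets borel" "sets M2 = sets borel"
    and a: "\<And>n. integrable M1 (a n)" and p: "\<And>n. integrable M2 (p n)"
    and N: "N \<in> sets borel" "emeasure M1 N = 0" "emeasure M2 (- N) = 0"
    and c: "sigma_additive \<nu>"
    and le: "\<And>n B. B \<in> sets borel \<Longrightarrow> (LINT x:B|M1. a n x) + (LINT x:B|M2. p n x) \<le> \<nu> B"
    and z: "\<And>x. a 0 x = 0" "\<And>x. p 0 x = 0"
  shows "(\<integral>\<^sup>+x. (SUP n. ennreal (a n x)) \<partial>M1) + (\<integral>\<^sup>+x. (SUP n. ennreal (p n x)) \<partial>M2) \<le> ennreal (\<nu> UNIV)"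
proof -
  define A where "A n x = Max ((\<lambda>i. a i x) ` {..n})" for n x
  define P where "P n x = Max ((\<lambda>i. p i x) ` {..n})" for n x
  note max_le = max_set_integral_le[where a = a and p = p, OF sets a p N c le, of UNIV, folded A_def P_def, simplified]
  have nn: "0 \<le> A n x" "0 \<le> P n x" for n x
  proof -
    have "a 0 x \<le> A n x" "p 0 x \<le> P n x" unfolding A_def P_def by (rule Max_ge; auto)+
    then show "0 \<le> A n x" "0 \<le> P n x" by (simp_all add: z)
  qed
  have inc: "incseq (\<lambda>n x. ennreal (A n x))" "incseq (\<lambda>n x. ennreal (P n x))"
    unfolding A_def P_def by (auto intro!: incseq_SucI le_funI ennreal_leI simp: Max_image_Suc)
  have mA: "(\<lambda>x. ennreal (A n x)) \<in> borel_measurable M1" "(\<lambda>x. ennreal (P n x)) \<in> borel_measurable M2" for n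
    using max_le(2)[where n = n] max_le(3)[where n = n] by auto
  have "(\<integral>\<^sup>+x. (SUP n. ennreal (a n x)) \<partial>M1) + (\<integral>\<^sup>+x. (SUP n. ennreal (p n x)) \<partial>M2)
      = (SUP n. \<integral>\<^sup>+x. ennreal (A n x) \<partial>M1) + (SUP n. \<integral>\<^sup>+x. ennreal (P n x) \<partial>M2)"
    unfolding SUP_ennreal_Max[symmetric, of "\<lambda>i. a i _"] SUP_ennreal_Max[symmetric, of "\<lambda>i. p i _"]
    unfolding A_def[symmetric] P_def[symmetric]
    using mA inc by (simp add: nn_integral_monotone_convergence_SUP)
  also have "\<dots> = (SUP n. (\<integral>\<^sup>+x. ennreal (A n x) \<partial>M1) + (\<integral>\<^sup>+x. ennreal (P n x) \<partial>M2))"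
    using inc by (intro ennreal_SUP_add[symmetric]) (auto simp: incseq_def le_fun_def intro!: nn_integral_mono)
  also have "\<dots> \<le> ennreal (\<nu> UNIV)"
  proof (rule SUP_least)
    fix n
    have "(\<integral>\<^sup>+x. ennreal (A n x) \<partial>M1) + (\<integral>\<^sup>+x. ennreal (P n x) \<partial>M2) = ennreal ((LINT x|M1. A n x) + (LINT x|M2. P n x))"
      using max_le(2)[where n = n] max_le(3)[where n = n] nn by (simp add: nn_integral_eq_integral integral_nonneg_AE)
    also have "\<dots> \<le> ennreal (\<nu> UNIV)"
      using max_le(1)[where n = n] by (intro ennreal_leI) (simp add: set_lebesgue_integral_def)
    finally show "(\<integral>\<^sup>+x. ennreal (A n x) \<partial>M1) + (\<integral>\<^sup>+x. ennreal (P n x) \<partial>M2) \<le> ennreal (\<nu> UNIV)" .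
  qed
  finally show ?thesis .
qed

section \<open>The integral formula\<close>

text \<open>Separability is applied to \<open>S\<close> inside the product space, where both rates
  are suprema of functions continuous in the pair; one sequence therefore serves both rates and all
  \<open>v\<close>. The pair \<open>(0, 0)\<close> at index 0 supplies the zero functions for the
  maxima.\<close>

lemma countable_rate_reduction:
  fixes S :: "('a::euclidean_space \<times> real) set"
  assumes S0: "(0, 0) \<in> S"
  shows "\<exists>c :: nat \<Rightarrow> 'a \<times> real. c 0 = (0, 0) \<and> (\<forall>n. c n \<in> S) \<and>
    (\<forall>v. sup_rate S v = (SUP n. ennreal (fst (c n) \<bullet> v - snd (c n)))) \<and>
    (\<forall>v. recession_rate S v = (SUP n. ennreal (fst (c n) \<bullet> v)))"
proof -
  obtain T where T: "countable T" "T \<subseteq> S" "S \<subseteq> closure T" by (rule separable)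
  have T': "T \<noteq> {}" using T(3) S0 by auto
  define c where "c n = (case n of 0 \<Rightarrow> (0, 0) | Suc m \<Rightarrow> from_nat_into T m)" for n
  have cS: "c n \<in> S" for n
    using S0 T(2) from_nat_into[OF T'] by (auto simp: c_def split: nat.split)
  have Tc: "\<exists>n. c n = p" if "p \<in> T" for p
    using from_nat_into_surj[OF T(1) that] by (auto simp: c_def intro: exI[of _ "Suc _"])
  have dense: "(SUP p\<in>S. ennreal (f p)) = (SUP n. ennreal (f (c n)))" if f: "continuous_on UNIV f" for f :: "_ \<Rightarrow> real"
  proof (rule antisym)
    have "closed {p. ennreal (f p) \<le> (SUP n. ennreal (f (c n)))}"
      by (rule closed_Collect_le[OF continuous_on_ennreal[OF f] continuous_on_const])
    moreover have "T \<subseteq> {p. ennreal (f p) \<le> (SUP n. ennreal (f (c n)))}"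
    proof
      fix p assume "p \<in> T"
      then obtain n where n: "c n = p" using Tc by blast
      have "ennreal (f (c n)) \<le> (SUP n. ennreal (f (c n)))" by (rule SUP_upper) simp
      then show "p \<in> {p. ennreal (f p) \<le> (SUP n. ennreal (f (c n)))}" by (simp add: n)
    qed
    ultimately have "closure T \<subseteq> {p. ennreal (f p) \<le> (SUP n. ennreal (f (c n)))}" by (intro closure_minimal)
    then have "ennreal (f p) \<le> (SUP n. ennreal (f (c n)))" if "p \<in> S" for p using T(3) that by blast
    then show "(SUP p\<in>S. ennreal (f p)) \<le> (SUP n. ennreal (f (c n)))" by (rule SUP_least)
    show "(SUP n. ennreal (f (c n))) \<le> (SUP p\<in>S. ennreal (f p))"
    proof (rule SUP_least)
      show "ennreal (f (c n)) \<le> (SUP p\<in>S. ennreal (f p))" for n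
        by (rule SUP_upper2[OF cS[of n]]) simp
    qed
  qed
  show ?thesis
  proof (intro exI[of _ c] conjI allI)
    show "sup_rate S v = (SUP n. ennreal (fst (c n) \<bullet> v - snd (c n)))" for v
      unfolding sup_rate_def by (rule dense) (intro continuous_intros)
    show "recession_rate S v = (SUP n. ennreal (fst (c n) \<bullet> v))" for v
      unfolding recession_rate_def by (rule dense) (intro continuous_intros)
    show "c 0 = (0, 0)" by (simp add: c_def)
  qed (rule cS)
qed

lemma borel_measurable_sup_rate:
  fixes S :: "('a::euclidean_space \<times> real) set"
  assumes "(0, 0) \<in> S"
  shows "sup_rate S \<in> borel_measurable borel" "recession_rate S \<in> borel_measurable borel"
proof -
  obtain c :: "nat \<Rightarrow> 'a \<times> real" where c:
    "\<forall>v. sup_rate S v = (SUP n. ennreal (fst (c n) \<bullet> v - snd (c n)))"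
    "\<forall>v. recession_rate S v = (SUP n. ennreal (fst (c n) \<bullet> v))"
    using countable_rate_reduction[OF assms] by (elim exE conjE)
  have "(\<lambda>v. SUP n. ennreal (fst (c n) \<bullet> v - snd (c n))) \<in> borel_measurable borel"
    "(\<lambda>v. SUP n. ennreal (fst (c n) \<bullet> v)) \<in> borel_measurable borel"
    by measurable
  moreover have "sup_rate S = (\<lambda>v. SUP n. ennreal (fst (c n) \<bullet> v - snd (c n)))"
    "recession_rate S = (\<lambda>v. SUP n. ennreal (fst (c n) \<bullet> v))"
    by (rule ext, rule c[THEN spec])+
  ultimately show "sup_rate S \<in> borel_measurable borel" "recession_rate S \<in> borel_measurable borel"
    by (simp_all only:)
qed

lemma ennreal_integral_le_nn_integral:
  assumes "integrable M f"
  shows "ennreal (integral\<^sup>L M f) \<le> (\<integral>\<^sup>+x. ennreal (f x) \<partial>M)"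
proof -
  have "integral\<^sup>L M f \<le> (LINT x|M. max 0 (f x))"
    using assms by (intro integral_mono) auto
  then have "ennreal (integral\<^sup>L M f) \<le> ennreal (LINT x|M. max 0 (f x))" by (rule ennreal_leI)
  also have "\<dots> = (\<integral>\<^sup>+x. ennreal (max 0 (f x)) \<partial>M)"
    using assms by (intro nn_integral_eq_integral[symmetric]) auto
  also have "\<dots> = (\<integral>\<^sup>+x. ennreal (f x) \<partial>M)"
    by (intro nn_integral_cong) (simp add: max_def ennreal_neg)
  finally show ?thesis .
qed

lemma SUP_polygon_formula:
  fixes h :: "real \<Rightarrow> 'a::euclidean_space"
  assumes S0: "(0, 0) \<in> S" and h: "h \<in> BV01"
  shows "(SUP T\<in>partitions. \<integral>\<^sup>+ s\<in>{0..1}. sup_rate S (vector_derivative (polygon h T) (at s)) \<partial>lborel)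
    = (\<integral>\<^sup>+ t\<in>{0..1}. sup_rate S (dern h t) \<partial>lborel) + (\<integral>\<^sup>+ t. recession_rate S (hdot (hsing h) t) \<partial>dV (hsing h))"
    (is "?L = ?R1 + ?R2")
proof -
  let ?H = "extend01 h"
  have bV: "bounded_rate var_set ?H" by (rule BV01_bounded_rate[OF h])
  have rcH: "right_cont01 ?H" by (rule bounded_rate.rc[OF bV])
  obtain N w where N: "N \<in> sets borel" "emeasure lborel N = 0"
    and w: "integrable lborel w" "\<And>x. x \<notin> {0..1} \<Longrightarrow> w x = 0"
    and dern: "AE t in lborel. t \<in> {0..1} \<longrightarrow> dern h t = w t"
    and hs: "hsing h \<in> BV01" and null: "emeasure (dV (hsing h)) (- N) = 0"
    and dec: "\<And>x. ?H x = (LINT s:{..x}|lborel. w s) + (LINT s:{..x}|dV (hsing h). hdot (hsing h) s)"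
    using hsing_decomposition[OF h] by blast
  define g where "g = hdot (hsing h)"
  define \<mu> where "\<mu> = dV (hsing h)"
  have g: "g \<in> borel_measurable borel" "integrable \<mu> g"
    using hdot_spec[OF hs] by (auto simp: g_def \<mu>_def)
  have s\<mu>: "sets \<mu> = sets borel" by (simp add: \<mu>_def dV_eq[OF hs])
  note mR = borel_measurable_sup_rate[OF S0]
  have wm: "w \<in> borel_measurable borel" using w(1) borel_measurable_integrable by fastforce
  have R1: "?R1 = (\<integral>\<^sup>+ t. sup_rate S (w t) * indicator {0..1} t \<partial>lborel)"
  proof (rule nn_integral_cong_AE)
    show "AE t in lborel. sup_rate S (dern h t) * indicator {0..1} t = sup_rate S (w t) * indicator {0..1} t"
      using dern by eventually_elim (auto simp: indicator_def)
  qed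
  define al where "al p t = indicator {0..1} t * (fst p \<bullet> w t - snd p)" for p :: "'a \<times> real" and t
  have al_i: "integrable lborel (al p)" for p
  proof -
    have "integrable lborel (\<lambda>t. indicator {0..1} t *\<^sub>R (fst p \<bullet> w t) - snd p * indicator {0..1} t)"
      using w(1) by (intro Bochner_Integration.integrable_diff integrable_mult_indicator) auto
    then show ?thesis by (simp add: al_def[abs_def] algebra_simps)
  qed
  have be_i: "integrable \<mu> (\<lambda>t. fst p \<bullet> g t)" for p :: "'a \<times> real" using g(2) by simp
  \<comment> \<open>The signed measure \<open>u \<bullet> dh - k dt\<close> for
    \<open>p = (u, k)\<close>, written as its Lebesgue part plus its singular part.\<close>
  define m where "m p B = (LINT t:B|lborel. al p t) + (LINT t:B|\<mu>. fst p \<bullet> g t)" for p B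
  have m_c: "sigma_additive (m p)" for p
    unfolding m_def by (intro sigma_additive_add sigma_additive_set_integral al_i be_i s\<mu>) simp
  have m_x: "m p {..x} = fst p \<bullet> ?H x - snd p * clamp01 x" for p x
  proof -
    have i: "integrable lborel (\<lambda>t. indicator {..x} t *\<^sub>R w t)" "integrable \<mu> (\<lambda>t. indicator {..x} t *\<^sub>R g t)"
      using w(1) g(2) s\<mu> by (auto intro: integrable_mult_indicator)
    have "(LINT t:{..x}|lborel. al p t) = (LINT t|lborel. fst p \<bullet> (indicator {..x} t *\<^sub>R w t) - snd p * indicator ({..x} \<inter> {0..1}) t)"
      unfolding set_lebesgue_integral_def al_def using w(2)
      by (intro Bochner_Integration.integral_cong) (auto simp: indicator_def)
    also have "\<dots> = (LINT t|lborel. fst p \<bullet> (indicator {..x} t *\<^sub>R w t)) - (LINT t|lborel. snd p * indicator ({..x} \<inter> {0..1}) t)"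
    proof (rule Bochner_Integration.integral_diff)
      have "emeasure lborel ({..x} \<inter> {0..1}) \<le> emeasure lborel {0..1::real}" by (intro emeasure_mono) auto
      then have "emeasure lborel ({..x} \<inter> {0..1}) < \<infinity>" by (auto intro: le_less_trans)
      then show "integrable lborel (\<lambda>t. snd p * indicator ({..x} \<inter> {0..1}) t)" by (intro integrable_mult_right integrable_real_indicator) auto
    qed (use i(1) in \<open>intro integrable_inner_right, simp\<close>)
    also have "(LINT t|lborel. fst p \<bullet> (indicator {..x} t *\<^sub>R w t)) = fst p \<bullet> (LINT t|lborel. indicator {..x} t *\<^sub>R w t)"
      by (rule integral_inner_right) (use i in simp)
    also have "(LINT t|lborel. snd p * indicator ({..x} \<inter> {0..1}) t) = snd p * clamp01 x"
      using measure_clamp01[of "{..x}"] by (simp add: distr_fun01.measure_le[OF distr_fun01_clamp01])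
    finally have 1: "(LINT t:{..x}|lborel. al p t) = fst p \<bullet> (LINT t:{..x}|lborel. w t) - snd p * clamp01 x"
      by (simp add: set_lebesgue_integral_def)
    have "(LINT t:{..x}|\<mu>. fst p \<bullet> g t) = (LINT t|\<mu>. fst p \<bullet> (indicator {..x} t *\<^sub>R g t))"
      by (simp add: set_lebesgue_integral_def)
    also have "\<dots> = fst p \<bullet> (LINT t:{..x}|\<mu>. g t)"
      unfolding set_lebesgue_integral_def by (rule integral_inner_right) (use i in simp)
    finally have 2: "(LINT t:{..x}|\<mu>. fst p \<bullet> g t) = fst p \<bullet> (LINT t:{..x}|\<mu>. g t)" .
    show ?thesis
      unfolding m_def 1 2 dec[of x] by (simp add: g_def \<mu>_def inner_add_right)
  qed
  \<comment> \<open>The right-hand side restricted to \<open>B\<close>; when it is finite, its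
    distribution function is the competitor for the upper bound.\<close>
  define U where "U B = (\<integral>\<^sup>+ t. sup_rate S (w t) * indicator {0..1} t * indicator B t \<partial>lborel) + (\<integral>\<^sup>+ t. recession_rate S (g t) * indicator B t \<partial>\<mu>)" for B
  have mw: "(\<lambda>t. sup_rate S (w t) * indicator {0..1} t) \<in> borel_measurable lborel"
    using mR wm by simp
  have mg: "(\<lambda>t. recession_rate S (g t)) \<in> borel_measurable \<mu>"
    unfolding borel_measurable_cong_borel[OF s\<mu>] using mR g by simp
  have U_UNIV: "U UNIV = ?R1 + ?R2" by (simp add: U_def R1 g_def \<mu>_def)
  have mU: "ennreal (m p B) \<le> U B" if p: "p \<in> S" and B: "B \<in> sets borel" for p B
  proof -
    have "ennreal (m p B) \<le> ennreal (LINT t:B|lborel. al p t) + ennreal (LINT t:B|\<mu>. fst p \<bullet> g t)"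
      unfolding m_def by (rule ennreal_add_le)
    also have "\<dots> \<le> (\<integral>\<^sup>+ t. ennreal (indicator B t *\<^sub>R al p t) \<partial>lborel) + (\<integral>\<^sup>+ t. ennreal (indicator B t *\<^sub>R (fst p \<bullet> g t)) \<partial>\<mu>)"
      unfolding set_lebesgue_integral_def using B s\<mu>
      by (intro add_mono ennreal_integral_le_nn_integral integrable_mult_indicator al_i be_i) auto
    also have "\<dots> \<le> U B"
      unfolding U_def al_def sup_rate_def recession_rate_def using p
      by (intro add_mono nn_integral_mono) (auto simp: indicator_def intro: SUP_upper)
    finally show ?thesis .
  qed
  have upper: "?L \<le> U UNIV"
  proof (cases "U UNIV = \<infinity>")
    case False
    have Ufin: "U B \<noteq> \<infinity>" for B
    proof -
      have "U B \<le> U UNIV" unfolding U_def by (intro add_mono nn_integral_mono) (auto simp: indicator_def)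
      then show ?thesis using False by (auto simp: top_unique)
    qed
    define \<Psi> where "\<Psi> x = enn2real (U {..x})" for x
    have U_add: "U {..b} = U {..a} + U {a<..b}" if "a < b" for a b
    proof -
      have e: "{..b} = {..a} \<union> {a<..b}" "{..a} \<inter> {a<..b} = {}" using that by auto
      have 1: "(\<integral>\<^sup>+ t. f t * indicator {..b} t \<partial>M) = (\<integral>\<^sup>+ t. f t * indicator {..a} t \<partial>M) + (\<integral>\<^sup>+ t. f t * indicator {a<..b} t \<partial>M)"
        if "f \<in> borel_measurable M" "sets M = sets borel" for f M
        unfolding e(1) by (rule nn_integral_disjoint_pair[OF that(1) _ _ e(2)]) (simp_all add: that(2))
      show ?thesis
        unfolding U_def 1[OF mw sets_lborel] 1[OF mg s\<mu>] by (simp add: ac_simps)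
    qed
    have "c \<le> \<Psi> 1" if "reach UNIV S ?H 1 c" for c
    proof (rule reach_least[OF _ _ that])
      show "0 \<le> \<Psi> x" for x by (simp add: \<Psi>_def)
      fix a b :: real and u k assume ab: "a < b" and uk: "(u, k) \<in> S"
      have "{..b} - {..a} = {a<..b}" "{..a} \<subseteq> {..b}" using ab by auto
      then have "m (u, k) {a<..b} = u \<bullet> (?H b - ?H a) - k * (clamp01 b - clamp01 a)"
        using sigma_additive_Diff[OF m_c[of "(u, k)"], of "{..b}" "{..a}"] by (simp add: m_x algebra_simps)
      with mU[OF uk, of "{a<..b}"] have "ennreal (u \<bullet> (?H b - ?H a) - k * (clamp01 b - clamp01 a)) \<le> U {a<..b}" by simp
      then have "u \<bullet> (?H b - ?H a) - k * (clamp01 b - clamp01 a) \<le> enn2real (U {a<..b})"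
        using Ufin[of "{a<..b}"] by (cases "U {a<..b}") (auto simp: ennreal_le_iff2)
      moreover have "\<Psi> b = \<Psi> a + enn2real (U {a<..b})"
        unfolding \<Psi>_def U_add[OF ab] using Ufin by (intro enn2real_plus) (auto simp: less_top[symmetric])
      ultimately show "\<Psi> a + (u \<bullet> (?H b - ?H a) - k * (clamp01 b - clamp01 a)) \<le> \<Psi> b" by simp
    qed
    then have "?L \<le> ennreal (\<Psi> 1)"
      using SUP_polygon_le_iff_reach[OF S0 _ rcH, of "\<Psi> 1"] by (auto simp: \<Psi>_def)
    also have "\<dots> = U {..1}" using Ufin[of "{..1}"] by (simp add: \<Psi>_def less_top[symmetric])
    also have "\<dots> \<le> U UNIV" unfolding U_def by (intro add_mono nn_integral_mono) (auto simp: indicator_def)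
    finally show ?thesis .
  qed simp
  have lower: "?R1 + ?R2 \<le> ?L"
  proof (cases "?L = \<infinity>")
    case False
    then have "?L < \<infinity>" by (simp add: less_top[symmetric])
    then have b: "bounded_rate S ?H" by (rule bounded_rateI[OF S0 rcH])
    interpret bounded_rate S ?H by (rule b)
    interpret P: distr_fun01 "rate_upto S ?H" by (rule distr_fun01_rate_upto)
    let ?\<nu> = "measure (interval_measure (rate_upto S ?H))"
    \<comment> \<open>Subtracting \<open>u \<bullet> H - k * clamp01\<close> from
      \<open>rate_upto\<close> leaves an increasing distribution function, so the inequality between
      increments passes to Borel sets.\<close>
    have le: "m p B \<le> ?\<nu> B" if p: "p \<in> S" and B: "B \<in> sets borel" for p B
    proof -
      have "distr_fun01 (\<lambda>x. rate_upto S ?H x - (fst p \<bullet> ?H x - snd p * clamp01 x))"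
      proof
        show "right_cont01 (\<lambda>x. rate_upto S ?H x - (fst p \<bullet> ?H x - snd p * clamp01 x))"
          by (intro right_cont01_diff right_cont01_inner right_cont01_cmult right_cont01_rate_upto rc distr_fun01.rc[OF distr_fun01_clamp01])
        show "rate_upto S ?H x - (fst p \<bullet> ?H x - snd p * clamp01 x) \<le> rate_upto S ?H y - (fst p \<bullet> ?H y - snd p * clamp01 y)" if "x \<le> y" for x y
          using rate_upto_step[OF that, of "fst p" "snd p"] p by (simp add: algebra_simps)
      qed
      from distr_fun01.sigma_additive_nonneg[OF this sigma_additive_diff[OF P.sigma_additive_im m_c[of p]] _ B]
      show ?thesis by (simp add: m_x P.measure_le)
    qed
    obtain c :: "nat \<Rightarrow> 'a \<times> real" where c': "c 0 = (0, 0)" "\<forall>n. c n \<in> S"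
      "\<forall>v. sup_rate S v = (SUP n. ennreal (fst (c n) \<bullet> v - snd (c n)))"
      "\<forall>v. recession_rate S v = (SUP n. ennreal (fst (c n) \<bullet> v))"
      using countable_rate_reduction[OF S0] by (elim exE conjE)
    note c = c'(1) c'(2-4)[THEN spec]
    have "(\<integral>\<^sup>+x. (SUP n. ennreal (al (c n) x)) \<partial>lborel) + (\<integral>\<^sup>+x. (SUP n. ennreal (fst (c n) \<bullet> g x)) \<partial>\<mu>) \<le> ennreal (?\<nu> UNIV)"
    \<comment> \<open>\<open>N\<close> separates the two measures: Lebesgue measure vanishes on it
      and \<mu> off it.\<close>
    proof (rule nn_integral_SUP_le[where a = "\<lambda>n. al (c n)" and p = "\<lambda>n t. fst (c n) \<bullet> g t", OF sets_lborel s\<mu> al_i be_i N null[folded \<mu>_def] P.sigma_additive_im])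
      show "(LINT x:B|lborel. al (c n) x) + (LINT x:B|\<mu>. fst (c n) \<bullet> g x) \<le> ?\<nu> B" if "B \<in> sets borel" for n B
        using le[OF c(2) that, of n] by (simp only: m_def)
      show "al (c 0) x = 0" "fst (c 0) \<bullet> g x = 0" for x by (simp_all add: al_def c(1))
    qed
    moreover have "(SUP n. ennreal (al (c n) x)) = sup_rate S (w x) * indicator {0..1} x" for x
      by (cases "x \<in> {0..1}") (simp_all add: al_def c(3))
    moreover have "?R2 = (\<integral>\<^sup>+x. (SUP n. ennreal (fst (c n) \<bullet> g x)) \<partial>\<mu>)"
      unfolding g_def[symmetric] \<mu>_def[symmetric] c(4) ..
    ultimately have "?R1 + ?R2 \<le> ennreal (?\<nu> UNIV)"
      unfolding R1 by simp
    also have "?\<nu> UNIV = rate_upto S ?H 1" by (rule P.measure_UNIV)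
    finally show ?thesis unfolding SUP_polygon_eq_rate_upto[OF b] .
  next
    case True
    show ?thesis unfolding True by simp
  qed
  have "?L \<le> ?R1 + ?R2" using upper by (simp only: U_UNIV)
  from order_antisym[OF this lower] show ?thesis .
qed

section \<open>The rate function of a random vector\<close>

text \<open>The graph of \<open>K\<close> over its effective domain, where \<open>K\<close> is
  real.\<close>

definition rate_set :: "'w measure \<Rightarrow> ('w \<Rightarrow> 'a::euclidean_space) \<Rightarrow> ('a \<times> real) set" where
  "rate_set M X = {(u, ln (enn2real (Lfun M X u))) |u. u \<in> DL M X}"

lemma e2ennreal_ereal: "e2ennreal (ereal x) = ennreal x"
  by (cases "0 \<le> x") (simp_all add: ennreal_neg e2ennreal_neg)

text \<open>\<open>e2ennreal\<close> is the lower adjoint of the embedding \<open>enn2ereal\<close>,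
  hence commutes with all suprema, the empty one included.\<close>

lemma e2ennreal_SUP: "e2ennreal (SUP a\<in>A. f a) = (SUP a\<in>A. e2ennreal (f a))"
proof (rule order_antisym)
  have "f a \<le> enn2ereal (SUP a\<in>A. e2ennreal (f a))" if "a \<in> A" for a
  proof -
    have "e2ennreal (f a) \<le> (SUP a\<in>A. e2ennreal (f a))" by (rule SUP_upper[OF that])
    then have "enn2ereal (e2ennreal (f a)) \<le> enn2ereal (SUP a\<in>A. e2ennreal (f a))" by (simp add: less_eq_ennreal.rep_eq)
    moreover have "f a \<le> enn2ereal (e2ennreal (f a))" by (cases "0 \<le> f a") (auto simp: enn2ereal_e2ennreal intro: order_trans[of _ 0])
    ultimately show ?thesis by (rule order_trans[rotated])
  qed
  then have "(SUP a\<in>A. f a) \<le> enn2ereal (SUP a\<in>A. e2ennreal (f a))" by (rule SUP_least)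
  then have "e2ennreal (SUP a\<in>A. f a) \<le> e2ennreal (enn2ereal (SUP a\<in>A. e2ennreal (f a)))" by (rule e2ennreal_mono)
  then show "e2ennreal (SUP a\<in>A. f a) \<le> (SUP a\<in>A. e2ennreal (f a))" by simp
  show "(SUP a\<in>A. e2ennreal (f a)) \<le> e2ennreal (SUP a\<in>A. f a)"
    by (intro SUP_least e2ennreal_mono SUP_upper)
qed

lemma Iinf_eq_recession_rate: "e2ennreal (Iinf M X v) = recession_rate (rate_set M X) v"
proof -
  have "rate_set M X = (\<lambda>u. (u, ln (enn2real (Lfun M X u)))) ` DL M X" by (auto simp: rate_set_def)
  then show ?thesis by (simp add: Iinf_def recession_rate_def e2ennreal_SUP e2ennreal_ereal image_image)
qed

text \<open>Where \<open>K\<close> is infinite, the term of the supremum is minus infinity, and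
  \<open>e2ennreal\<close> sends it to the least element 0.\<close>

lemma Irate_eq_sup_rate:
  fixes X :: "'w \<Rightarrow> 'a::euclidean_space"
  shows "e2ennreal (Irate M X v) = sup_rate (rate_set M X) v"
proof -
  have e: "rate_set M X = (\<lambda>u. (u, ln (enn2real (Lfun M X u)))) ` DL M X" by (auto simp: rate_set_def)
  have r: "sup_rate (rate_set M X) v = (SUP u\<in>DL M X. ennreal (u \<bullet> v - ln (enn2real (Lfun M X u))))"
    by (simp add: e sup_rate_def image_image)
  have t: "e2ennreal (ereal (u \<bullet> v) - Kfun M X u) = (if u \<in> DL M X then ennreal (u \<bullet> v - ln (enn2real (Lfun M X u))) else 0)" for u
    by (simp add: Kfun_def DL_def e2ennreal_ereal e2ennreal_neg)
  have "e2ennreal (Irate M X v) = (SUP u. if u \<in> DL M X then ennreal (u \<bullet> v - ln (enn2real (Lfun M X u))) else 0)"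
    by (simp add: Irate_def e2ennreal_SUP t)
  also have "\<dots> = (SUP u\<in>DL M X. ennreal (u \<bullet> v - ln (enn2real (Lfun M X u))))"
  proof (rule order_antisym; rule SUP_least)
    fix u :: 'a
    show "(if u \<in> DL M X then ennreal (u \<bullet> v - ln (enn2real (Lfun M X u))) else 0) \<le> (SUP u\<in>DL M X. ennreal (u \<bullet> v - ln (enn2real (Lfun M X u))))"
      by (auto intro: SUP_upper)
  next
    fix u assume "u \<in> DL M X"
    then show "ennreal (u \<bullet> v - ln (enn2real (Lfun M X u))) \<le> (SUP u. if u \<in> DL M X then ennreal (u \<bullet> v - ln (enn2real (Lfun M X u))) else 0)"
      by (intro SUP_upper2[of u]) auto
  qed
  finally show ?thesis by (simp add: r)
qed

lemma ID_eq: "ID M X h = (SUP T\<in>partitions. \<integral>\<^sup>+ s\<in>{0..1}. sup_rate (rate_set M X) (vector_derivative (polygon h T) (at s)) \<partial>lborel)"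
  by (simp add: ID_def Irate_eq_sup_rate)

lemma rate_set_0:
  assumes "prob_space M"
  shows "(0, 0) \<in> rate_set M X"
proof -
  interpret prob_space M by fact
  have "Lfun M X 0 = 1" by (simp add: Lfun_def emeasure_space_1)
  then have "0 \<in> DL M X" "ln (enn2real (Lfun M X 0)) = 0" by (auto simp: DL_def)
  then show ?thesis unfolding rate_set_def by (metis (mono_tags, lifting) mem_Collect_eq)
qed

text \<open>Some coordinate carries at least the share \<open>1 / DIM('a)\<close> of the norm of
  \<open>x\<close>, which explains the bound on \<open>u\<close>; the two signs of that coordinate
  account for the two exponentials.\<close>

lemma exp_inner_le_sum:
  fixes x u :: "'a::euclidean_space"
  assumes u: "norm u \<le> t / DIM('a)" and t: "0 < t"
  shows "exp (u \<bullet> x) \<le> (\<Sum>b\<in>Basis. exp ((t *\<^sub>R b) \<bullet> x) + exp ((- t *\<^sub>R b) \<bullet> x))"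
proof -
  have "\<exists>b\<in>Basis. norm x \<le> DIM('a) * \<bar>x \<bullet> b\<bar>"
  proof (rule ccontr)
    assume "\<not> ?thesis"
    then have *: "\<And>b. b \<in> Basis \<Longrightarrow> \<bar>x \<bullet> b\<bar> < norm x / DIM('a)" by (auto simp: field_simps not_le)
    have "norm x \<le> (\<Sum>b\<in>Basis. \<bar>x \<bullet> b\<bar>)" by (rule norm_le_l1)
    also have "\<dots> < (\<Sum>b\<in>(Basis::'a set). norm x / DIM('a))" by (rule sum_strict_mono) (use * in auto)
    also have "\<dots> = norm x" by simp
    finally show False by simp
  qed
  then obtain b where b: "b \<in> Basis" "norm x \<le> DIM('a) * \<bar>x \<bullet> b\<bar>" by blast
  have "u \<bullet> x \<le> norm u * norm x" by (rule norm_cauchy_schwarz)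
  also have "\<dots> \<le> (t / DIM('a)) * (DIM('a) * \<bar>x \<bullet> b\<bar>)" using u b t by (intro mult_mono) auto
  also have "\<dots> = t * \<bar>x \<bullet> b\<bar>" by simp
  finally have ux: "u \<bullet> x \<le> t * \<bar>x \<bullet> b\<bar>" .
  have "exp (u \<bullet> x) \<le> exp ((t *\<^sub>R b) \<bullet> x) + exp ((- t *\<^sub>R b) \<bullet> x)"
  proof (cases "0 \<le> x \<bullet> b")
    case True
    then have "exp (u \<bullet> x) \<le> exp ((t *\<^sub>R b) \<bullet> x)" using ux by (simp add: inner_commute)
    then show ?thesis by (rule order_trans) simp
  next
    case False
    then have "exp (u \<bullet> x) \<le> exp ((- t *\<^sub>R b) \<bullet> x)" using ux by (simp add: inner_commute)
    then show ?thesis by (rule order_trans) simp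
  qed
  also have "\<dots> \<le> (\<Sum>b\<in>Basis. exp ((t *\<^sub>R b) \<bullet> x) + exp ((- t *\<^sub>R b) \<bullet> x))"
    by (rule member_le_sum[OF b(1)]) auto
  finally show ?thesis .
qed

text \<open>\<open>exp_inner_le_sum\<close> bounds \<open>Lfun\<close> near 0 by the sum of its
  values at the finitely many vectors \<open>t b\<close> and \<open>- t b\<close>, which lie in the
  domain for small \<open>t\<close>.\<close>

lemma rate_set_near_0:
  fixes X :: "'w \<Rightarrow> 'a::euclidean_space"
  assumes "prob_space M" and X[measurable]: "X \<in> borel_measurable M" and int: "0 \<in> interior (DL M X)"
  obtains r C where "0 < r" "0 \<le> C" "\<And>u. norm u \<le> r \<Longrightarrow> \<exists>k\<le>C. (u, k) \<in> rate_set M X"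
proof -
  interpret prob_space M by fact
  obtain e where e: "0 < e" "ball 0 e \<subseteq> DL M X" using int by (auto simp: mem_interior)
  define t where "t = e / 2"
  have t: "0 < t" "t < e" using e by (auto simp: t_def)
  define B where "B = (\<Sum>b\<in>(Basis::'a set). Lfun M X (t *\<^sub>R b) + Lfun M X (- t *\<^sub>R b))"
  have "Lfun M X (t *\<^sub>R b) < \<infinity>" "Lfun M X (- t *\<^sub>R b) < \<infinity>" if "b \<in> Basis" for b :: 'a
  proof -
    have "t *\<^sub>R b \<in> ball 0 e" "- t *\<^sub>R b \<in> ball 0 e" using that t by simp_all
    then have "t *\<^sub>R b \<in> DL M X" "- t *\<^sub>R b \<in> DL M X" using e(2) by blast+
    then show "Lfun M X (t *\<^sub>R b) < \<infinity>" "Lfun M X (- t *\<^sub>R b) < \<infinity>" unfolding DL_def by auto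
  qed
  then have Bfin: "B < \<infinity>" unfolding B_def by simp
  have le: "Lfun M X u \<le> B" if u: "norm u \<le> t / DIM('a)" for u
  proof -
    have "Lfun M X u \<le> (\<integral>\<^sup>+\<omega>. (\<Sum>b\<in>(Basis::'a set). ennreal (exp ((t *\<^sub>R b) \<bullet> X \<omega>)) + ennreal (exp ((- t *\<^sub>R b) \<bullet> X \<omega>))) \<partial>M)"
      unfolding Lfun_def
    proof (rule nn_integral_mono)
      fix \<omega>
      have "ennreal (exp (u \<bullet> X \<omega>)) \<le> ennreal (\<Sum>b\<in>(Basis::'a set). exp ((t *\<^sub>R b) \<bullet> X \<omega>) + exp ((- t *\<^sub>R b) \<bullet> X \<omega>))"
        by (rule ennreal_leI[OF exp_inner_le_sum[OF u t(1)]])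
      also have "\<dots> = (\<Sum>b\<in>(Basis::'a set). ennreal (exp ((t *\<^sub>R b) \<bullet> X \<omega>)) + ennreal (exp ((- t *\<^sub>R b) \<bullet> X \<omega>)))"
        by (subst sum_ennreal[symmetric]) (auto intro: add_nonneg_nonneg)
      finally show "ennreal (exp (u \<bullet> X \<omega>)) \<le> \<dots>" .
    qed
    also have "\<dots> = B"
      unfolding B_def Lfun_def by (subst nn_integral_sum) (simp_all add: nn_integral_add)
    finally show ?thesis .
  qed
  \<comment> \<open>Positivity is required for \<open>ln\<close> to be monotone on the values of
    \<open>Lfun\<close>.\<close>
  have pos: "0 < Lfun M X u" for u
  proof -
    have "Lfun M X u \<noteq> 0"
    proof
      assume "Lfun M X u = 0"
      then have "AE \<omega> in M. ennreal (exp (u \<bullet> X \<omega>)) = 0"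
        unfolding Lfun_def by (subst (asm) nn_integral_0_iff_AE) auto
      then have "AE \<omega> in M. False" by eventually_elim simp
      then show False by simp
    qed
    then show ?thesis by (simp add: zero_less_iff_neq_zero)
  qed
  define C where "C = max 0 (ln (enn2real B))"
  have "\<exists>k\<le>C. (u, k) \<in> rate_set M X" if u: "norm u \<le> t / DIM('a)" for u
  proof (intro exI conjI)
    have fin: "Lfun M X u < \<infinity>" using le[OF u] Bfin by (rule le_less_trans)
    then show "(u, ln (enn2real (Lfun M X u))) \<in> rate_set M X" by (auto simp: rate_set_def DL_def)
    have "0 < enn2real (Lfun M X u)" using pos fin by (simp add: enn2real_positive_iff)
    moreover have "enn2real (Lfun M X u) \<le> enn2real B" using le[OF u] Bfin by (intro enn2real_mono) auto
    ultimately show "ln (enn2real (Lfun M X u)) \<le> C" by (simp add: C_def le_max_iff_disj)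
  qed
  then show thesis by (intro that[of "t / DIM('a)" C]) (use t in \<open>auto simp: C_def\<close>)
qed

text \<open>Coercivity: replacing \<open>(u, 0)\<close> by a pair \<open>(r *\<^sub>R u, k')\<close>
  with \<open>k' \<le> C\<close> scales the increment term by \<open>r\<close> and costs at most
  \<open>C\<close> per unit of time.\<close>

lemma reach_var_set_imp_reach:
  assumes r: "0 < r" and near: "\<And>u. norm u \<le> r \<Longrightarrow> \<exists>k\<le>C. (u, k) \<in> S"
    and reach: "reach Q var_set H x c"
  shows "\<exists>c'. reach Q S H x c' \<and> r * c - C * clamp01 x \<le> c'"
  using reach
proof (induction rule: reach.induct)
  case (start x)
  then show ?case by (intro exI[of _ 0]) (auto intro: reach.start simp: clamp01_def)
next
  case (step a c b u k)
  then obtain c' where c': "reach Q S H a c'" "r * c - C * clamp01 a \<le> c'" by blast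
  have u: "norm u \<le> 1" "k = 0" using step.hyps by (auto simp: var_set_def)
  have "norm (r *\<^sub>R u) \<le> r" using u r by (simp add: mult_left_le)
  from near[OF this] obtain k' where k': "k' \<le> C" "(r *\<^sub>R u, k') \<in> S" by blast
  have "reach Q S H b (c' + ((r *\<^sub>R u) \<bullet> (H b - H a) - k' * (clamp01 b - clamp01 a)))"
    by (rule reach.step[OF c'(1) step.hyps(2,3) k'(2)])
  moreover have "k' * (clamp01 b - clamp01 a) \<le> C * (clamp01 b - clamp01 a)"
    using k' clamp01_lipschitz[of a b] step.hyps by (intro mult_right_mono) auto
  ultimately show ?case
    using c'(2) u by (intro exI[of _ "c' + ((r *\<^sub>R u) \<bullet> (H b - H a) - k' * (clamp01 b - clamp01 a))"]) (simp add: algebra_simps)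
qed

section \<open>Compactness\<close>

lemma rho_star_extend01: "rho_star g h = (LINT s:{0..1}|lborel. norm (extend01 g s - extend01 h s)) + norm (extend01 g 1 - extend01 h 1)"
proof -
  have "(LINT s:{0..1}|lborel. norm (g s - h s)) = (LINT s:{0..1}|lborel. norm (extend01 g s - extend01 h s))"
    unfolding set_lebesgue_integral_def
    by (intro Bochner_Integration.integral_cong) (auto simp: indicator_def extend01_def min_def)
  then show ?thesis by (simp add: rho_star_def extend01_def)
qed

text \<open>The increment is taken from a negative time, where \<open>H\<close> and
  \<open>rate_upto\<close> both vanish.\<close>

lemma (in bounded_rate) norm_le_rate_upto:
  assumes "S = var_set"
  shows "norm (H x) \<le> rate_upto S H 1"
proof -
  have "norm (H x - H (min x (-1))) \<le> rate_upto S H x - rate_upto S H (min x (-1))"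
    by (rule norm_diff_le_rate_upto[OF assms]) simp
  then have "norm (H x) \<le> rate_upto S H x" by (simp add: right_cont01D(1)[OF rc] rate_upto_neg)
  also have "\<dots> \<le> rate_upto S H (max x 1)" by (rule rate_upto_mono) simp
  also have "\<dots> = rate_upto S H 1" by (rule rate_upto_ge1) simp
  finally show ?thesis .
qed

lemma integrable_bounded_01:
  fixes f :: "real \<Rightarrow> 'a::euclidean_space"
  assumes "f \<in> borel_measurable borel" "\<And>x. norm (f x) \<le> B"
  shows "set_integrable lborel {0..1} f"
proof -
  have 1: "integrable lborel (\<lambda>x::real. B * indicator {0..1} x)"
    by (intro integrable_mult_right integrable_real_indicator) auto
  have 2: "(\<lambda>x. indicator {0..1} x *\<^sub>R f x) \<in> borel_measurable lborel" using assms(1) by simp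
  have 0: "0 \<le> B" using order_trans[OF norm_ge_zero assms(2)] .
  show ?thesis
    unfolding set_integrable_def
    by (rule Bochner_Integration.integrable_bound[OF 1 2]) (auto simp: indicator_def assms(2) 0)
qed

lemma set_integrable_norm_diff:
  fixes g h :: "real \<Rightarrow> 'a::euclidean_space"
  assumes "g \<in> BV01" "h \<in> BV01"
  shows "set_integrable lborel {0..1} (\<lambda>s. norm (extend01 g s - extend01 h s))"
proof (rule integrable_bounded_01)
  have bg: "bounded_rate var_set (extend01 g)" and bh: "bounded_rate var_set (extend01 h)" using assms by (auto intro: BV01_bounded_rate)
  show "(\<lambda>s. norm (extend01 g s - extend01 h s)) \<in> borel_measurable borel"
    using borel_measurable_extend01[OF bg] borel_measurable_extend01[OF bh] by measurable
  show "norm (norm (extend01 g s - extend01 h s)) \<le> rate_upto var_set (extend01 g) 1 + rate_upto var_set (extend01 h) 1" for s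
    using bounded_rate.norm_le_rate_upto[OF bg refl, of s] bounded_rate.norm_le_rate_upto[OF bh refl, of s]
      norm_triangle_ineq4[of "extend01 g s" "extend01 h s"] by simp
qed

text \<open>By right-continuity a nonzero difference at \<open>t < 1\<close> persists on an interval
  to the right of \<open>t\<close>, against equality almost everywhere; the point 1 is covered by
  the second summand of \<open>rho_star\<close>.\<close>

lemma rho_star_zero_imp_eq:
  fixes g h :: "real \<Rightarrow> 'a::euclidean_space"
  assumes g: "g \<in> BV01" and h: "h \<in> BV01" and z: "rho_star g h = 0"
  shows "g = h"
proof -
  let ?D = "\<lambda>s. extend01 g s - extend01 h s"
  let ?f = "\<lambda>s. indicator {0..1} s *\<^sub>R norm (?D s)"
  have int: "integrable lborel ?f" using set_integrable_norm_diff[OF g h] by (simp add: set_integrable_def)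
  have nn: "AE s in lborel. 0 \<le> ?f s" by (intro AE_I2) (simp add: indicator_def)
  have i0: "0 \<le> integral\<^sup>L lborel ?f" by (rule integral_nonneg_AE[OF nn])
  have sum0: "integral\<^sup>L lborel ?f + norm (?D 1) = 0" using z unfolding rho_star_extend01 set_lebesgue_integral_def .
  have "integral\<^sup>L lborel ?f = 0" and D1: "?D 1 = 0"
    using i0 sum0 norm_ge_zero[of "?D 1"] by (linarith, simp add: add_nonneg_eq_0_iff)
  then have ae: "AE s in lborel. ?f s = 0" by (subst (asm) integral_nonneg_eq_0_iff_AE[OF int nn])
  have rc: "right_cont01 ?D"
    using right_cont01_diff bounded_rate.rc[OF BV01_bounded_rate[OF g]] bounded_rate.rc[OF BV01_bounded_rate[OF h]] by blast
  have D: "?D t = 0" if t: "0 \<le> t" "t < 1" for t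
  proof (rule ccontr)
    assume ne: "?D t \<noteq> 0"
    have "(?D \<longlongrightarrow> ?D t) (at_right t)" using right_cont01D(3)[OF rc, of t] by (simp add: continuous_within)
    then have "\<forall>\<^sub>F s in at_right t. ?D s \<noteq> 0" using ne by (rule tendsto_imp_eventually_ne)
    then obtain b where b: "t < b" "\<forall>s>t. s < b \<longrightarrow> ?D s \<noteq> 0" unfolding eventually_at_right_field by blast
    have "AE s in lborel. s \<notin> {t<..<min b 1}"
      using ae by eventually_elim (use t b in \<open>auto simp: indicator_def\<close>)
    then have "emeasure lborel {t<..<min b 1} = 0"
      by (subst (asm) AE_iff_measurable[of "{t<..<min b 1}"]) auto
    then show False using t b by simp
  qed
  show "g = h"
  proof
    fix t :: real
    consider "t < 0 \<or> 1 < t" | "t = 1" | "0 \<le> t" "t < 1" by linarith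
    then show "g t = h t"
    proof cases
      case 1
      then have "t \<notin> {0..1}" by auto
      then show ?thesis using g h by (simp add: BV01_def D01_def)
    next
      case 2
      then show ?thesis using D1 by (simp add: extend01_def)
    next
      case 3
      then show ?thesis using D[of t] by (simp add: extend01_def)
    qed
  qed
qed

lemma Metric_space_BV01: "Metric_space (BV01 :: (real \<Rightarrow> 'a::euclidean_space) set) rho_star"
proof
  fix x y z :: "real \<Rightarrow> 'a"
  show "0 \<le> rho_star x y"
    unfolding rho_star_def set_lebesgue_integral_def by (intro add_nonneg_nonneg integral_nonneg_AE) auto
  show "rho_star x y = rho_star y x" by (simp add: rho_star_def norm_minus_commute)
  show "rho_star x y = 0 \<longleftrightarrow> x = y" if "x \<in> BV01" "y \<in> BV01"
    using rho_star_zero_imp_eq[OF that] by (auto simp: rho_star_def set_lebesgue_integral_def)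
  assume x: "x \<in> BV01" and y: "y \<in> BV01" and z: "z \<in> BV01"
  have "(LINT s:{0..1}|lborel. norm (extend01 x s - extend01 z s))
      \<le> (LINT s:{0..1}|lborel. norm (extend01 x s - extend01 y s) + norm (extend01 y s - extend01 z s))"
  proof (intro set_integral_mono set_integral_add set_integrable_norm_diff x y z)
    show "norm (extend01 x s - extend01 z s) \<le> norm (extend01 x s - extend01 y s) + norm (extend01 y s - extend01 z s)" for s
      using norm_triangle_ineq[of "extend01 x s - extend01 y s" "extend01 y s - extend01 z s"] by simp
  qed
  also have "\<dots> = (LINT s:{0..1}|lborel. norm (extend01 x s - extend01 y s)) + (LINT s:{0..1}|lborel. norm (extend01 y s - extend01 z s))"
    by (intro set_integral_add set_integrable_norm_diff x y z)
  finally show "rho_star x z \<le> rho_star x y + rho_star y z"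
    unfolding rho_star_extend01 using norm_triangle_ineq[of "extend01 x 1 - extend01 y 1" "extend01 y 1 - extend01 z 1"] by simp
qed

section \<open>Helly selection for vector-valued functions of bounded variation\<close>

lemma Helly_selection_finite:
  fixes f :: "'i \<Rightarrow> nat \<Rightarrow> real \<Rightarrow> real"
  assumes "finite A" "\<And>i n x. i \<in> A \<Longrightarrow> continuous (at_right x) (f i n)" "\<And>i n. i \<in> A \<Longrightarrow> mono (f i n)"
    "\<And>i n x. i \<in> A \<Longrightarrow> \<bar>f i n x\<bar> \<le> M"
  shows "\<exists>s F. strict_mono (s :: nat \<Rightarrow> nat) \<and> (\<forall>i\<in>A. (\<forall>x. continuous (at_right x) (F i)) \<and> mono (F i) \<and>
    (\<forall>x. isCont (F i) x \<longrightarrow> (\<lambda>n. f i (s n) x) \<longlonglongrightarrow> F i x))"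
  using assms
proof (induction A rule: finite_induct)
  case empty
  show ?case by (intro exI[of _ id]) (simp add: strict_mono_def)
next
  case (insert j A)
  then obtain s F where s: "strict_mono (s :: nat \<Rightarrow> nat)" and F: "\<forall>i\<in>A. (\<forall>x. continuous (at_right x) (F i)) \<and> mono (F i) \<and>
    (\<forall>x. isCont (F i) x \<longrightarrow> (\<lambda>n. f i (s n) x) \<longlonglongrightarrow> F i x)" by auto
  obtain s' G where s': "strict_mono (s' :: nat \<Rightarrow> nat)" and G: "\<forall>x. continuous (at_right x) G" "mono G"
    "\<forall>x. isCont G x \<longrightarrow> (\<lambda>n. f j (s (s' n)) x) \<longlonglongrightarrow> G x"
    using Helly_selection[of "\<lambda>n. f j (s n)" M] insert.prems by auto
  have "(\<lambda>n. f i ((s \<circ> s') n) x) \<longlonglongrightarrow> F i x" if "i \<in> A" "isCont (F i) x" for i x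
  proof -
    have "(\<lambda>n. f i (s n) x) \<longlonglongrightarrow> F i x" using F that by blast
    from LIMSEQ_subseq_LIMSEQ[OF this s'] show ?thesis by (simp add: o_def)
  qed
  moreover have "strict_mono (s \<circ> s')" by (rule strict_mono_o[OF s s'])
  ultimately show ?case
    using F G insert.hyps(2) by (intro exI[of _ "s \<circ> s'"] exI[of _ "F(j := G)"]) (auto simp: o_def)
qed

lemma countable_exists_between:
  fixes a b :: real
  assumes "countable C" "a < b"
  shows "\<exists>x. a < x \<and> x < b \<and> x \<notin> C"
proof (rule ccontr)
  assume "\<not> ?thesis"
  then have "{a<..<b} \<subseteq> C" by auto
  then have "countable {a<..<b}" using assms(1) by (rule countable_subset)
  then show False using uncountable_open_interval[of a b] assms(2) by simp
qed

text \<open>Helly's theorem only gives convergence at continuity points of the limit; since the functions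
  are constant on \<open>[1, \<infinity>)\<close>, convergence at \<open>1\<close> itself comes for free.\<close>

lemma right_cont01_limit:
  assumes f: "\<And>n. right_cont01 (f n)" and F: "\<And>x. continuous (at_right x) F" "mono F"
    and lim: "\<And>x. isCont F x \<Longrightarrow> (\<lambda>n. f n x) \<longlonglongrightarrow> (F x :: real)"
  shows "right_cont01 F" "(\<lambda>n. f n 1) \<longlonglongrightarrow> F 1"
proof -
  have C: "\<exists>y. a < y \<and> y < b \<and> isCont F y" if "a < b" for a b
    using countable_exists_between[OF mono_ctble_discont[OF F(2)] that] by auto
  have le: "F x \<le> F y" if "x \<le> y" for x y using F(2) that by (rule monoD)
  have neg: "F y = 0" if "y < 0" "isCont F y" for y
    using lim[OF that(2)] right_cont01D(1)[OF f that(1)] by (simp add: LIMSEQ_const_iff)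
  have F0: "F x = 0" if "x < 0" for x
  proof -
    obtain y where "x - 1 < y" "y < x" "isCont F y" using C[of "x - 1" x] by auto
    moreover obtain z where "x < z" "z < 0" "isCont F z" using C[of x 0] \<open>x < 0\<close> by auto
    ultimately show ?thesis using neg[of y] neg[of z] le[of y x] le[of x z] that by simp
  qed
  have big: "(\<lambda>n. f n 1) \<longlonglongrightarrow> F y" if "1 < y" "isCont F y" for y
  proof -
    have "f n y = f n 1" for n by (rule right_cont01D(2)[OF f]) (use that in simp)
    with lim[OF that(2)] show ?thesis by simp
  qed
  obtain y0 where y0: "1 < y0" "isCont F y0" using C[of 1 2] by auto
  have eq: "F y = F y0" if "1 < y" for y
  proof -
    obtain u where u: "1 < u" "u < y" "isCont F u" using C[of 1 y] \<open>1 < y\<close> by auto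
    obtain v where v: "y < v" "v < y + 1" "isCont F v" using C[of y "y + 1"] by auto
    have "F u = F y0" by (rule LIMSEQ_unique[OF big[OF u(1,3)] big[OF y0]])
    moreover have "F v = F y0" by (rule LIMSEQ_unique[OF big[OF _ v(3)] big[OF y0]]) (use that v in simp)
    ultimately show ?thesis using le[of u y] le[of y v] u v by simp
  qed
  have "(F \<longlongrightarrow> F 1) (at_right 1)" using F(1)[of 1] by (simp add: continuous_within)
  moreover have "(F \<longlongrightarrow> F y0) (at_right 1)"
  proof (rule tendsto_eventually)
    show "\<forall>\<^sub>F x in at_right 1. F x = F y0"
      unfolding eventually_at_right_field using eq by (intro exI[of _ 2]) auto
  qed
  ultimately have F1: "F 1 = F y0" by (intro tendsto_unique[of "at_right 1"]) auto
  show "(\<lambda>n. f n 1) \<longlonglongrightarrow> F 1" using big[OF y0] by (simp add: F1)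
  show "right_cont01 F"
    by (rule right_cont01I) (use F0 eq F1 F(1) in auto)
qed

lemma mono_at_left_limit:
  fixes F :: "real \<Rightarrow> real"
  assumes "mono F"
  shows "\<exists>l. (F \<longlongrightarrow> l) (at_left x)"
proof -
  let ?l = "Sup (F ` {..<x})"
  have bd: "bdd_above (F ` {..<x})" 
  proof (rule bdd_aboveI)
    show "z \<le> F x" if "z \<in> F ` {..<x}" for z using that monoD[OF assms, of _ x] by force
  qed
  have "(F \<longlongrightarrow> ?l) (at_left x)"
  proof (rule increasing_tendsto)
    show "\<forall>\<^sub>F y in at_left x. F y \<le> ?l"
      unfolding eventually_at_left_field using bd by (intro exI[of _ "x - 1"]) (auto intro: cSup_upper)
    fix z assume "z < ?l"
    moreover have "F ` {..<x} \<noteq> {}" by auto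
    ultimately obtain w where w: "w < x" "z < F w" using less_cSup_iff[OF _ bd, of z] by blast
    have "z < F y" if "w < y" for y
      using w(2) monoD[OF assms less_imp_le[OF that]] by (rule less_le_trans)
    then show "\<forall>\<^sub>F y in at_left x. z < F y"
      unfolding eventually_at_left_field using w(1) by blast
  qed
  then show ?thesis ..
qed

text \<open>Helly's theorem is applied to the increasing functions \<open>V\<close> and
  \<open>V + H \<bullet> b\<close> for basis vectors \<open>b\<close>; differences of their limits
  are the coordinates of the limit function, which inherits right-continuity and left limits from
  them.\<close>

lemma BV01_Helly_selection:
  fixes \<sigma> :: "nat \<Rightarrow> real \<Rightarrow> 'a::euclidean_space"
  assumes BV: "\<And>n. \<sigma> n \<in> BV01" and bd: "\<And>n. rate_upto var_set (extend01 (\<sigma> n)) 1 \<le> m"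
  shows "\<exists>s l Q. strict_mono (s :: nat \<Rightarrow> nat) \<and> l \<in> BV01 \<and> dense01 Q \<and> countable ({0..1} - Q) \<and>
    (\<forall>q\<in>Q. (\<lambda>n. extend01 (\<sigma> (s n)) q) \<longlonglongrightarrow> extend01 l q)"
proof -
  define H where "H n = extend01 (\<sigma> n)" for n
  have br: "bounded_rate var_set (H n)" for n unfolding H_def by (rule BV01_bounded_rate[OF BV])
  define V where "V n = rate_upto var_set (H n)" for n
  have V1: "V n 1 \<le> m" for n using bd[of n] by (simp add: V_def H_def)
  \<comment> \<open>The index 0 stands for the variation itself, since
    \<open>f 0 n = V n\<close>.\<close>
  define A where "A = insert (0::'a) Basis"
  define f where "f i n x = V n x + H n x \<bullet> i" for i :: 'a and n x
  have Ab: "norm i \<le> 1" if "i \<in> A" for i using that by (auto simp: A_def)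
  have f_rc: "right_cont01 (f i n)" for i n
  proof -
    have "right_cont01 (\<lambda>x. V n x + i \<bullet> H n x)"
      unfolding V_def by (intro right_cont01_add right_cont01_inner bounded_rate.right_cont01_rate_upto[OF br] bounded_rate.rc[OF br])
    moreover have "f i n = (\<lambda>x. V n x + i \<bullet> H n x)" by (simp add: fun_eq_iff f_def inner_commute)
    ultimately show ?thesis by simp
  qed
  have inner_le: "\<bar>v \<bullet> i\<bar> \<le> norm v" if "i \<in> A" for v i
  proof -
    have "\<bar>v \<bullet> i\<bar> \<le> norm v * norm i" by (rule Cauchy_Schwarz_ineq2)
    also have "\<dots> \<le> norm v * 1" by (rule mult_left_mono[OF Ab[OF that]]) simp
    finally show ?thesis by simp
  qed
  have f_mono: "mono (f i n)" if "i \<in> A" for i n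
  proof (rule monoI)
    fix x y :: real assume "x \<le> y"
    then have "norm (H n y - H n x) \<le> V n y - V n x"
      unfolding V_def by (rule bounded_rate.norm_diff_le_rate_upto[OF br refl])
    then show "f i n x \<le> f i n y"
      using inner_le[OF that, of "H n y - H n x"] by (simp add: f_def inner_diff_left)
  qed
  have f_bd: "\<bar>f i n x\<bar> \<le> 2 * m" if "i \<in> A" for i n x
  proof -
    have "0 \<le> V n x" unfolding V_def by (rule bounded_rate.reach_le_rate_upto[OF br bounded_rate.reach0[OF br]])
    moreover have "V n x \<le> V n (max x 1)" unfolding V_def by (rule bounded_rate.rate_upto_mono[OF br]) simp
    moreover have "V n (max x 1) = V n 1" unfolding V_def by (rule bounded_rate.rate_upto_ge1[OF br]) simp
    moreover have "norm (H n x) \<le> V n 1" unfolding V_def by (rule bounded_rate.norm_le_rate_upto[OF br refl])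
    ultimately show ?thesis using inner_le[OF that, of "H n x"] V1[of n] unfolding f_def by linarith
  qed
  have "\<exists>s F. strict_mono (s :: nat \<Rightarrow> nat) \<and> (\<forall>i\<in>A. (\<forall>x. continuous (at_right x) (F i)) \<and> mono (F i) \<and>
      (\<forall>x. isCont (F i) x \<longrightarrow> (\<lambda>n. f i (s n) x) \<longlonglongrightarrow> F i x))"
    by (rule Helly_selection_finite[OF _ right_cont01D(3)[OF f_rc] f_mono f_bd]) (auto simp: A_def)
  then obtain s F where s: "strict_mono (s :: nat \<Rightarrow> nat)" and F: "\<forall>i\<in>A. (\<forall>x. continuous (at_right x) (F i)) \<and> mono (F i) \<and>
      (\<forall>x. isCont (F i) x \<longrightarrow> (\<lambda>n. f i (s n) x) \<longlonglongrightarrow> F i x)" by (elim exE conjE)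
  have Fc: "continuous (at_right x) (F i)" if "i \<in> A" for i x using F that by blast
  have Fm: "mono (F i)" if "i \<in> A" for i using F that by blast
  have Fl: "(\<lambda>n. f i (s n) x) \<longlonglongrightarrow> F i x" if "i \<in> A" "isCont (F i) x" for i x using F that by blast
  have Frc: "right_cont01 (F i)" and F1: "(\<lambda>n. f i (s n) 1) \<longlonglongrightarrow> F i 1" if i: "i \<in> A" for i
    using right_cont01_limit[OF f_rc Fc[OF i] Fm[OF i] Fl[OF i]] by auto
  define K where "K x = (\<Sum>b\<in>(Basis::'a set). (F b x - F 0 x) *\<^sub>R b)" for x
  have K0: "K x = 0" if "x < 0" for x
    unfolding K_def using right_cont01D(1)[OF Frc that] by (intro sum.neutral) (auto simp: A_def)
  have K1: "K x = K 1" if "1 \<le> x" for x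
    unfolding K_def using right_cont01D(2)[OF Frc that] by (intro sum.cong refl) (auto simp: A_def)
  have Krc: "right_cont01 K"
  proof (rule right_cont01I)
    show "continuous (at_right x) K" for x
      unfolding K_def by (intro continuous_intros Fc) (auto simp: A_def)
    show "K x = 0" if "x < 0" for x by (rule K0[OF that])
    show "K x = K 1" if "1 < x" for x by (rule K1[OF less_imp_le[OF that]])
  qed
  define l where "l x = (if x \<in> {0..1} then K x else 0)" for x
  have el: "extend01 l = K"
  proof
    fix x show "extend01 l x = K x"
      using K0[of x] K1[of x] by (cases "x < 0"; cases "x \<le> 1") (auto simp: extend01_def l_def)
  qed
  define Q where "Q = {q\<in>{0<..1}. q = 1 \<or> (\<forall>i\<in>A. isCont (F i) q)}"
  define D where "D = (\<Union>i\<in>A. {x. \<not> isCont (F i) x})"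
  have cD: "countable D"
    unfolding D_def
  proof (rule countable_UN)
    show "countable A" by (simp add: A_def countable_finite)
    show "countable {x. \<not> isCont (F i) x}" if "i \<in> A" for i by (rule mono_ctble_discont[OF Fm[OF that]])
  qed
  have Qd: "dense01 Q"
    unfolding dense01_def
  proof (intro conjI allI impI)
    fix x e :: real assume x: "0 \<le> x" "x < 1" "0 < e"
    then have "x < min 1 (x + e)" by simp
    from countable_exists_between[OF cD this] obtain q where q: "x < q" "q < min 1 (x + e)" "q \<notin> D" by blast
    then have "q \<in> Q" using x by (auto simp: Q_def D_def)
    with q show "\<exists>q\<in>Q. x < q \<and> q < x + e" by auto
  qed (auto simp: Q_def)
  have "{0..1} - Q \<subseteq> insert 0 D" by (auto simp: Q_def D_def)
  then have cQ: "countable ({0..1} - Q)" by (rule countable_subset) (use cD in simp)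
  have HK: "(\<lambda>n. H (s n) q) \<longlonglongrightarrow> K q" if q: "q \<in> Q" for q
  proof -
    have fl: "(\<lambda>n. f i (s n) q) \<longlonglongrightarrow> F i q" if "i \<in> A" for i
      using q that Fl[OF that, of q] F1[OF that] by (auto simp: Q_def)
    have "(\<lambda>n. \<Sum>b\<in>(Basis::'a set). (f b (s n) q - f 0 (s n) q) *\<^sub>R b) \<longlonglongrightarrow> K q"
      unfolding K_def by (intro tendsto_intros fl) (auto simp: A_def)
    moreover have "(\<Sum>b\<in>(Basis::'a set). (f b (s n) q - f 0 (s n) q) *\<^sub>R b) = H (s n) q" for n
      by (simp add: f_def euclidean_representation)
    ultimately show ?thesis by simp
  qed
  \<comment> \<open>Lower semicontinuity of the total variation: the bound \<open>m\<close> survives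
    in the limit.\<close>
  have "bounded_rate var_set K"
  proof
    show "bdd_above {c. reach UNIV var_set K 1 c}"
    proof (rule bdd_aboveI)
      fix c assume "c \<in> {c. reach UNIV var_set K 1 c}"
      then have r: "reach UNIV var_set K 1 c" by simp
      show "c \<le> m"
      proof (rule reach_bound_lsc[OF Krc Qd _ HK _ r])
        show "H (s n) x = 0" if "x < 0" for n x by (rule right_cont01D(1)[OF bounded_rate.rc[OF br] that])
        fix n c assume "reach {0<..1} var_set (H (s n)) 1 c"
        then have "reach UNIV var_set (H (s n)) 1 c" by (rule reach_mono_Q) simp
        then have "c \<le> V (s n) 1" unfolding V_def by (rule bounded_rate.reach_le_rate_upto[OF br])
        then show "c \<le> m" using V1[of "s n"] by simp
      qed
    qed
  qed (fact var_set_0 Krc)+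
  moreover have "l \<in> D01"
  proof -
    have "cadlag l"
      unfolding cadlag_def
    proof (intro conjI ballI)
      show "continuous (at_right t) l" if "t \<in> {0..<1}" for t
        by (rule continuous_at_right_cong[of t 1 K]) (use that right_cont01D(3)[OF Krc] in \<open>auto simp: l_def\<close>)
      fix t :: real assume t: "t \<in> {0<..1}"
      have "\<forall>i\<in>A. \<exists>l. (F i \<longlongrightarrow> l) (at_left t)" using mono_at_left_limit[OF Fm] by blast
      from bchoice[OF this] obtain z where z: "\<forall>i\<in>A. (F i \<longlongrightarrow> z i) (at_left t)" ..
      have "(K \<longlongrightarrow> (\<Sum>b\<in>(Basis::'a set). (z b - z 0) *\<^sub>R b)) (at_left t)"
        unfolding K_def using z by (intro tendsto_intros) (auto simp: A_def)
      moreover have "\<forall>\<^sub>F x in at_left t. K x = l x"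
        unfolding eventually_at_left_field using t by (intro exI[of _ 0]) (auto simp: l_def)
      ultimately show "\<exists>L. (l \<longlongrightarrow> L) (at_left t)" by (blast intro: Lim_transform_eventually)
    qed
    then show ?thesis by (auto simp: D01_def l_def)
  qed
  ultimately have "l \<in> BV01" by (simp add: BV01_iff el)
  then show ?thesis
    using s Qd cQ HK unfolding H_def el[symmetric] by (intro exI[of _ s] exI[of _ l] exI[of _ Q]) simp
qed

text \<open>Dominated convergence: pointwise convergence can fail only on a countable set, the
  variations give a uniform bound, and \<open>1 \<in> Q\<close> handles the last summand.\<close>

lemma rho_star_tendsto_0:
  fixes \<sigma> :: "nat \<Rightarrow> real \<Rightarrow> 'a::euclidean_space"
  assumes BV: "\<And>n. \<sigma> n \<in> BV01" and l: "l \<in> BV01" and bd: "\<And>n. rate_upto var_set (extend01 (\<sigma> n)) 1 \<le> m"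
    and Q: "dense01 Q" "countable ({0..1} - Q)"
    and lim: "\<And>q. q \<in> Q \<Longrightarrow> (\<lambda>n. extend01 (\<sigma> n) q) \<longlonglongrightarrow> extend01 l q"
  shows "(\<lambda>n. rho_star (\<sigma> n) l) \<longlonglongrightarrow> 0"
proof -
  let ?g = "\<lambda>n s. indicator {0..1} s *\<^sub>R norm (extend01 (\<sigma> n) s - extend01 l s)"
  let ?c = "m + rate_upto var_set (extend01 l) 1"
  have "(\<lambda>n. integral\<^sup>L lborel (?g n)) \<longlonglongrightarrow> integral\<^sup>L lborel (\<lambda>_::real. 0::real)"
  proof (rule integral_dominated_convergence)
    show "(\<lambda>_::real. 0::real) \<in> borel_measurable lborel" by simp
    show "?g n \<in> borel_measurable lborel" for n
      using set_integrable_norm_diff[OF BV l, of n] unfolding set_integrable_def by (rule borel_measurable_integrable)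
    show "integrable lborel (\<lambda>x::real. ?c * indicator {0..1} x)"
      by (intro integrable_mult_right integrable_real_indicator) auto
    have "AE s in lborel. s \<notin> {0..1} - Q"
      by (rule AE_not_in) (rule countable_imp_null_set_lborel[OF Q(2)])
    then show "AE s in lborel. (\<lambda>n. ?g n s) \<longlonglongrightarrow> 0"
    proof eventually_elim
      fix s assume s: "s \<notin> {0..1} - Q"
      show "(\<lambda>n. ?g n s) \<longlonglongrightarrow> 0"
      proof (cases "s \<in> {0..1}")
        case True
        then have "(\<lambda>n. extend01 (\<sigma> n) s - extend01 l s) \<longlonglongrightarrow> 0" using s lim[of s] by (simp add: LIM_zero)
        then show ?thesis using True by (simp add: tendsto_norm_zero)
      qed simp
    qed
    show "AE s in lborel. norm (?g n s) \<le> ?c * indicator {0..1} s" for n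
    proof (rule AE_I2)
      fix s
      have "norm (extend01 (\<sigma> n) s - extend01 l s) \<le> norm (extend01 (\<sigma> n) s) + norm (extend01 l s)" by (rule norm_triangle_ineq4)
      also have "\<dots> \<le> ?c"
        using bounded_rate.norm_le_rate_upto[OF BV01_bounded_rate[OF BV] refl, of n s] bd[of n]
          bounded_rate.norm_le_rate_upto[OF BV01_bounded_rate[OF l] refl, of s] by linarith
      finally show "norm (?g n s) \<le> ?c * indicator {0..1} s" by (simp add: indicator_def)
    qed
  qed
  moreover have "(\<lambda>n. norm (extend01 (\<sigma> n) 1 - extend01 l 1)) \<longlonglongrightarrow> 0"
    using lim[of 1] Q(1) by (intro tendsto_norm_zero LIM_zero) (simp add: dense01_def)
  ultimately have "(\<lambda>n. integral\<^sup>L lborel (?g n) + norm (extend01 (\<sigma> n) 1 - extend01 l 1)) \<longlonglongrightarrow> 0 + 0"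
    by (intro tendsto_add) simp_all
  then show ?thesis unfolding rho_star_extend01 set_lebesgue_integral_def by simp
qed

theorem theorem5p1:
  fixes M :: "'w measure" and X :: "'w \<Rightarrow> 'a::euclidean_space"
  assumes "prob_space M"
    and "X \<in> borel_measurable M"
    and "0 \<in> interior (DL M X)"
  shows "(\<forall>\<alpha>::ennreal. \<alpha> < \<infinity> \<longrightarrow>
            compactin (Metric_space.mtopology BV01 rho_star) {h\<in>BV01. ID M X h \<le> \<alpha>})
       \<and> (\<forall>h\<in>BV01. ID M X h =
            (\<integral>\<^sup>+ t\<in>{0..1}. e2ennreal (Irate M X (dern h t)) \<partial>lborel)
          + (\<integral>\<^sup>+ l\<in>sphere 0 1. e2ennreal (Iinf M X l) \<partial>sigma_meas (hsing h)))"
proof (intro conjI allI impI ballI)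
  let ?S = "rate_set M X"
  have S0: "(0, 0) \<in> ?S" by (rule rate_set_0[OF assms(1)])
  {
    fix \<alpha> :: ennreal assume "\<alpha> < \<infinity>"
    then obtain a where a: "0 \<le> a" "\<alpha> = ennreal a" by (cases \<alpha>) auto
    interpret Metric_space "BV01 :: (real \<Rightarrow> 'a) set" rho_star by (rule Metric_space_BV01)
    obtain r C where r: "0 < r" and C: "\<And>u. norm u \<le> r \<Longrightarrow> \<exists>k\<le>C. (u, k) \<in> ?S"
      using rate_set_near_0[OF assms] by blast
    have reach_le: "c \<le> a" if "h \<in> BV01" "ID M X h \<le> \<alpha>" "reach {0<..1} ?S (extend01 h) 1 c" for h c
      using SUP_polygon_le_iff[OF S0 a(1), of h] that unfolding ID_eq a(2) by blast
    \<comment> \<open>Coercivity at time 1 gives \<open>r * c - C \<le> a\<close> for every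
      variation sum \<open>c\<close>, uniformly over the sub-level set.\<close>
    have rate_upto_le: "rate_upto var_set (extend01 h) 1 \<le> (a + C) / r" if h: "h \<in> BV01" "ID M X h \<le> \<alpha>" for h
    proof (rule bounded_rate.rate_upto_leI[OF BV01_bounded_rate[OF h(1)]])
      fix c assume "reach UNIV var_set (extend01 h) 1 c"
      then show "c \<le> (a + C) / r"
      proof (rule reach_bound_lsc[OF bounded_rate.rc[OF BV01_bounded_rate[OF h(1)]] dense01_Ioc, of "\<lambda>_. extend01 h", rotated -1])
        show "extend01 h x = 0" if "x < 0" for x using that by (simp add: extend01_def)
        fix c assume "reach {0<..1} var_set (extend01 h) 1 c"
        from reach_var_set_imp_reach[OF r C this] obtain c' where
          c': "reach {0<..1} ?S (extend01 h) 1 c'" "r * c - C * clamp01 1 \<le> c'" by blast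
        have "r * c \<le> a + C" using c'(2) reach_le[OF h c'(1)] by (simp add: clamp01_def)
        then show "c \<le> (a + C) / r" using r by (simp add: field_simps)
      qed simp
    qed
    show "compactin mtopology {h\<in>BV01. ID M X h \<le> \<alpha>}"
      unfolding compactin_sequentially
    proof (intro conjI allI impI)
      fix \<sigma> :: "nat \<Rightarrow> real \<Rightarrow> 'a" assume "range \<sigma> \<subseteq> {h\<in>BV01. ID M X h \<le> \<alpha>}"
      then have \<sigma>: "\<sigma> n \<in> BV01" "ID M X (\<sigma> n) \<le> \<alpha>" for n by auto
      from BV01_Helly_selection[where \<sigma> = \<sigma>, OF \<sigma>(1) rate_upto_le[OF \<sigma>]]
      obtain s l Q where s: "strict_mono s" and l: "l \<in> BV01" and Q: "dense01 Q" "countable ({0..1} - Q)"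
        and lim: "\<forall>q\<in>Q. (\<lambda>n. extend01 (\<sigma> (s n)) q) \<longlonglongrightarrow> extend01 l q" by (elim exE conjE)
      have lim': "(\<lambda>n. extend01 (\<sigma> (s n)) q) \<longlonglongrightarrow> extend01 l q" if "q \<in> Q" for q using lim that by blast
      have rcl: "right_cont01 (extend01 l)" by (rule bounded_rate.rc[OF BV01_bounded_rate[OF l]])
      \<comment> \<open>Every sum for the limit inherits the bound \<open>a\<close>, so the limit
        stays in the sub-level set.\<close>
      have "\<forall>c. reach UNIV ?S (extend01 l) 1 c \<longrightarrow> c \<le> a"
      proof (intro allI impI)
        fix c assume "reach UNIV ?S (extend01 l) 1 c"
        from reach_bound_lsc[where Hn = "\<lambda>n. extend01 (\<sigma> (s n))", OF rcl Q(1) _ lim' reach_le[OF \<sigma>] this] show "c \<le> a" by (simp add: extend01_def)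
      qed
      then have "ID M X l \<le> \<alpha>" unfolding ID_eq a(2) SUP_polygon_le_iff_reach[OF S0 a(1) rcl] .
      moreover have "limitin mtopology (\<sigma> \<circ> s) l sequentially"
        unfolding limit_metric_sequentially
      proof (intro conjI allI impI l)
        fix \<epsilon> :: real assume "0 < \<epsilon>"
        have "(\<lambda>n. rho_star (\<sigma> (s n)) l) \<longlonglongrightarrow> 0"
          by (rule rho_star_tendsto_0[where \<sigma> = "\<lambda>n. \<sigma> (s n)", OF \<sigma>(1) l rate_upto_le[OF \<sigma>] Q lim'])
        from order_tendstoD(2)[OF this \<open>0 < \<epsilon>\<close>]
        show "\<exists>N. \<forall>n\<ge>N. (\<sigma> \<circ> s) n \<in> BV01 \<and> rho_star ((\<sigma> \<circ> s) n) l < \<epsilon>"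
          using \<sigma>(1) by (simp add: eventually_sequentially)
      qed
      ultimately show "\<exists>l r. l \<in> {h\<in>BV01. ID M X h \<le> \<alpha>} \<and> strict_mono r \<and> limitin mtopology (\<sigma> \<circ> r) l sequentially"
        using l s by blast
    qed auto
  }
  fix h :: "real \<Rightarrow> 'a" assume h: "h \<in> BV01"
  have hs: "hsing h \<in> BV01" using hsing_decomposition[OF h] by blast
  note g = hdot_spec[OF hs]
  have sV: "sets (dV (hsing h)) = sets borel" by (simp add: dV_eq[OF hs])
  have gm: "hdot (hsing h) \<in> measurable (dV (hsing h)) borel"
    using g(1) by (simp add: borel_measurable_cong_borel[OF sV])
  have "sphere (0::'a) 1 \<in> sets borel" by (rule borel_closed[OF closed_sphere])
  then have "(\<lambda>l. recession_rate ?S l * indicator (sphere 0 1) l) \<in> borel_measurable borel"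
    by (intro borel_measurable_times_ennreal borel_measurable_sup_rate(2)[OF S0] borel_measurable_indicator)
  then have "(\<integral>\<^sup>+ l\<in>sphere 0 1. e2ennreal (Iinf M X l) \<partial>sigma_meas (hsing h))
     = (\<integral>\<^sup>+ t. recession_rate ?S (hdot (hsing h) t) * indicator (sphere 0 1) (hdot (hsing h) t) \<partial>dV (hsing h))"
    unfolding sigma_meas_def Iinf_eq_recession_rate by (intro nn_integral_distr[OF gm]) simp
  \<comment> \<open>\<open>hdot\<close> has norm 1 almost everywhere, so the restriction to the
    sphere disappears.\<close>
  also have "\<dots> = (\<integral>\<^sup>+ t. recession_rate ?S (hdot (hsing h) t) \<partial>dV (hsing h))"
  proof (rule nn_integral_cong_AE)
    show "AE t in dV (hsing h). recession_rate ?S (hdot (hsing h) t) * indicator (sphere 0 1) (hdot (hsing h) t) = recession_rate ?S (hdot (hsing h) t)"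
      using g(3) by eventually_elim simp
  qed
  finally show "ID M X h = (\<integral>\<^sup>+ t\<in>{0..1}. e2ennreal (Irate M X (dern h t)) \<partial>lborel)
          + (\<integral>\<^sup>+ l\<in>sphere 0 1. e2ennreal (Iinf M X l) \<partial>sigma_meas (hsing h))"
    unfolding ID_eq Irate_eq_sup_rate SUP_polygon_formula[OF S0 h] by simp
qed

end
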